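(* There is a polynomial-time $2$-approximation algorithm for the Balanced Minimum Evolution Problem on metric instances: given a metric instance, it outputs a feasible solution $T'$ with $f(T')\le 2\,\mathrm{OPT}$, where $\mathrm{OPT}$ is the optimum cost. Specifically, the following algorithm has this property: compute a minimum spanning tree $T_0$ of the complete graph on the species with edge costs $\delta_{ij}$; for every species $i$ that is an internal vertex of the current tree, rename that vertex $i'$ and attach a new leaf labelled $i$ to $i'$ by an edge of cost $0$, obtaining a tree $T$ whose leaves are exactly the species; finally output a cubic tree $T'$ with leaves bijectively labelled by the species satisfying $f(T')\le f(T)$ (which can be found in polynomial time).
   Context: Balanced Minimum Evolution Problem: given a set $[n]=\{1,\dots,n\}$ of species and a symmetric $n\times n$ matrix $(\delta_{ij})$ with nonnegative entries and zero diagonal, a feasible solution is a cubic tree $T$ (every internal, i.e. non-leaf, vertex has degree exactly $3$) with exactly $n$ leaves, together with a bijection between its leaves and the species; its cost is $f(T)=\sum_{i<j}\delta_{ij}2^{2-d_{ij}}$, where $d_{ij}$ is the number of edges on the path between the leaves of species $i$ and $j$; the goal is to minimize $f$. An instance is metric if $\delta_{ik}\le\delta_{ij}+\delta_{jk}$ for all distinct $i,j,k$. For a general (not necessarily cubic) tree $T$ whose leaves are exactly the species, $f(T)=\sum_{i<j}\delta_{ij}\pi_{ij}(T)$ with $\pi_{ij}(T)=2\prod_{u}\frac{1}{\deg_T(u)-1}$, the product over the internal vertices $u$ of the $i$--$j$ path in $T$. *)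

theory Defs
  imports Complex_Main "HOL-Library.Log_Nat" "HOL-Computational_Algebra.Polynomial"
begin

section \<open>Trees\<close>

text \<open>Finite simple undirected graphs. Vertices are natural numbers, which loses nothing up to
  isomorphism.\<close>

record graph =
  verts :: "nat set"
  edges :: "nat set set"

definition simple_graph :: "graph \<Rightarrow> bool" where
  "simple_graph G \<longleftrightarrow> finite (verts G) \<and>
     (\<forall>e \<in> edges G. \<exists>u v. u \<in> verts G \<and> v \<in> verts G \<and> u \<noteq> v \<and> e = {u, v})"

definition is_path :: "graph \<Rightarrow> nat \<Rightarrow> nat list \<Rightarrow> nat \<Rightarrow> bool" where
  "is_path G u p v \<longleftrightarrow> p \<noteq> [] \<and> hd p = u \<and> last p = v \<and> distinct p \<and> set p \<subseteq> verts G \<and>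
     successively (\<lambda>x y. {x, y} \<in> edges G) p"

definition is_cycle :: "graph \<Rightarrow> nat list \<Rightarrow> bool" where
  "is_cycle G c \<longleftrightarrow> 3 \<le> length c \<and> distinct c \<and> set c \<subseteq> verts G \<and>
     successively (\<lambda>x y. {x, y} \<in> edges G) c \<and> {last c, hd c} \<in> edges G"

definition is_tree :: "graph \<Rightarrow> bool" where
  "is_tree G \<longleftrightarrow> simple_graph G \<and> verts G \<noteq> {} \<and>
     (\<forall>u \<in> verts G. \<forall>v \<in> verts G. \<exists>p. is_path G u p v) \<and> (\<nexists>c. is_cycle G c)"

definition vertex_degree :: "graph \<Rightarrow> nat \<Rightarrow> nat" where
  "vertex_degree G v = card {e \<in> edges G. v \<in> e}"

definition leaves :: "graph \<Rightarrow> nat set" where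
  "leaves G = {v \<in> verts G. vertex_degree G v = 1}"

definition internal :: "graph \<Rightarrow> nat set" where
  "internal G = verts G - leaves G"

text \<open>The path between two vertices; only meaningful in a tree, where it is unique.\<close>

definition tree_path :: "graph \<Rightarrow> nat \<Rightarrow> nat \<Rightarrow> nat list" where
  "tree_path G u v = (THE p. is_path G u p v)"

definition tree_dist :: "graph \<Rightarrow> nat \<Rightarrow> nat \<Rightarrow> nat" where
  "tree_dist G u v = length (tree_path G u v) - 1"


section \<open>Balanced minimum evolution\<close>

definition bme_instance :: "nat \<Rightarrow> (nat \<Rightarrow> nat \<Rightarrow> real) \<Rightarrow> bool" where
  "bme_instance n \<delta> \<longleftrightarrow> (\<forall>i \<in> {1..n}. \<forall>j \<in> {1..n}. \<delta> i j = \<delta> j i \<and> 0 \<le> \<delta> i j) \<and>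
     (\<forall>i \<in> {1..n}. \<delta> i i = 0)"

definition metric_instance :: "nat \<Rightarrow> (nat \<Rightarrow> nat \<Rightarrow> real) \<Rightarrow> bool" where
  "metric_instance n \<delta> \<longleftrightarrow> bme_instance n \<delta> \<and>
     (\<forall>i \<in> {1..n}. \<forall>j \<in> {1..n}. \<forall>k \<in> {1..n}.
        i \<noteq> j \<and> j \<noteq> k \<and> i \<noteq> k \<longrightarrow> \<delta> i k \<le> \<delta> i j + \<delta> j k)"

definition feasible :: "nat \<Rightarrow> graph \<Rightarrow> (nat \<Rightarrow> nat) \<Rightarrow> bool" where
  "feasible n G \<phi> \<longleftrightarrow> is_tree G \<and> (\<forall>v \<in> internal G. vertex_degree G v = 3) \<and>
     bij_betw \<phi> {1..n} (leaves G)"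

definition bme_cost :: "nat \<Rightarrow> (nat \<Rightarrow> nat \<Rightarrow> real) \<Rightarrow> graph \<Rightarrow> (nat \<Rightarrow> nat) \<Rightarrow> real" where
  "bme_cost n \<delta> G \<phi> =
     (\<Sum>j \<in> {1..n}. \<Sum>i \<in> {1..<j}. \<delta> i j * 2 powi (2 - int (tree_dist G (\<phi> i) (\<phi> j))))"

definition bme_opt :: "nat \<Rightarrow> (nat \<Rightarrow> nat \<Rightarrow> real) \<Rightarrow> real" where
  "bme_opt n \<delta> = Inf {bme_cost n \<delta> G \<phi> | G \<phi>. feasible n G \<phi>}"

text \<open>The cost of a not necessarily cubic tree, whose leaves are the species themselves.\<close>

definition tree_weight :: "graph \<Rightarrow> nat \<Rightarrow> nat \<Rightarrow> real" where
  "tree_weight G i j =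
     2 * (\<Prod>u \<in> set (tree_path G i j) \<inter> internal G. 1 / (real (vertex_degree G u) - 1))"

definition general_cost :: "nat \<Rightarrow> (nat \<Rightarrow> nat \<Rightarrow> real) \<Rightarrow> graph \<Rightarrow> real" where
  "general_cost n \<delta> G = (\<Sum>j \<in> {1..n}. \<Sum>i \<in> {1..<j}. \<delta> i j * tree_weight G i j)"


section \<open>The algorithm\<close>

definition spanning_tree :: "nat \<Rightarrow> graph \<Rightarrow> bool" where
  "spanning_tree n G \<longleftrightarrow> is_tree G \<and> verts G = {1..n}"

definition spanning_cost :: "nat \<Rightarrow> (nat \<Rightarrow> nat \<Rightarrow> real) \<Rightarrow> graph \<Rightarrow> real" where
  "spanning_cost n \<delta> G = (\<Sum>(i, j) | i \<in> {1..n} \<and> j \<in> {1..n} \<and> i < j \<and> {i, j} \<in> edges G. \<delta> i j)"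

definition minimum_spanning_tree :: "nat \<Rightarrow> (nat \<Rightarrow> nat \<Rightarrow> real) \<Rightarrow> graph \<Rightarrow> bool" where
  "minimum_spanning_tree n \<delta> G \<longleftrightarrow> spanning_tree n G \<and>
     (\<forall>G'. spanning_tree n G' \<longrightarrow> spanning_cost n \<delta> G \<le> spanning_cost n \<delta> G')"

text \<open>The new name \<open>i'\<close> of an internal species \<open>i\<close> is the number \<open>n + i\<close>. The cost \<open>0\<close> of the new
  edge is not recorded: the costs of trees above are determined by \<open>\<delta>\<close> and the shape of the tree.\<close>

definition attach_leaf :: "nat \<Rightarrow> nat \<Rightarrow> graph \<Rightarrow> graph" where
  "attach_leaf n i G = (let r = (\<lambda>v. if v = i then n + i else v) in
     \<lparr>verts = insert i (r ` verts G), edges = insert {i, n + i} ((\<lambda>e. r ` e) ` edges G)\<rparr>)"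

definition attach_leaves :: "nat \<Rightarrow> graph \<Rightarrow> graph" where
  "attach_leaves n G =
     fold (\<lambda>i H. if i \<in> internal H then attach_leaf n i H else H) [1..<Suc n] G"

text \<open>\<open>(G, \<phi>)\<close> is a possible output of the algorithm if its first step computes \<open>T\<^sub>0\<close>.\<close>

definition algorithm_output ::
    "nat \<Rightarrow> (nat \<Rightarrow> nat \<Rightarrow> real) \<Rightarrow> graph \<Rightarrow> graph \<Rightarrow> (nat \<Rightarrow> nat) \<Rightarrow> bool" where
  "algorithm_output n \<delta> T\<^sub>0 G \<phi> \<longleftrightarrow> minimum_spanning_tree n \<delta> T\<^sub>0 \<and> feasible n G \<phi> \<and>
     bme_cost n \<delta> G \<phi> \<le> general_cost n \<delta> (attach_leaves n T\<^sub>0)"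


section \<open>Polynomial time\<close>

text \<open>
  The machine model is a while language over nested lists of rational numbers with logarithmic
  (bit) cost. Every evaluation of a subexpression is charged the full binary encoding length of
  its value, so each elementary operation is charged at least the lengths of its operands and of
  its result. All these operations are computable by a Turing machine in time polynomial in that
  charge, and a Turing machine is easily simulated with polynomial overhead; hence polynomial time
  in this model is polynomial time in the usual sense.
\<close>

datatype val = Num rat | Lst "val list"

definition rat_bits :: "rat \<Rightarrow> nat" where
  "rat_bits r = (let (p, q) = quotient_of r in floorlog 2 (nat \<bar>p\<bar>) + floorlog 2 (nat q))"

fun bits :: "val \<Rightarrow> nat" where
  "bits (Num r) = 1 + rat_bits r"
| "bits (Lst vs) = 1 + sum_list (map bits vs)"

text \<open>Ill-typed operations and out-of-range accesses yield the empty list.\<close>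

datatype unop = Length | Singleton

datatype binop = Plus | Minus | Times | Divide | Less | Equal | Append | Nth | Take | Drop

fun apply_unop :: "unop \<Rightarrow> val \<Rightarrow> val" where
  "apply_unop Length (Lst vs) = Num (of_nat (length vs))"
| "apply_unop Singleton v = Lst [v]"
| "apply_unop _ _ = Lst []"

fun apply_binop :: "binop \<Rightarrow> val \<Rightarrow> val \<Rightarrow> val" where
  "apply_binop Plus (Num a) (Num b) = Num (a + b)"
| "apply_binop Minus (Num a) (Num b) = Num (a - b)"
| "apply_binop Times (Num a) (Num b) = Num (a * b)"
| "apply_binop Divide (Num a) (Num b) = Num (a / b)"
| "apply_binop Less (Num a) (Num b) = Num (of_bool (a < b))"
| "apply_binop Equal v w = Num (of_bool (v = w))"
| "apply_binop Append (Lst vs) (Lst ws) = Lst (vs @ ws)"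
| "apply_binop Nth (Lst vs) (Num a) =
     (let k = nat \<lfloor>a\<rfloor> in if k < length vs then vs ! k else Lst [])"
| "apply_binop Take (Num a) (Lst vs) = Lst (take (nat \<lfloor>a\<rfloor>) vs)"
| "apply_binop Drop (Num a) (Lst vs) = Lst (drop (nat \<lfloor>a\<rfloor>) vs)"
| "apply_binop _ _ _ = Lst []"

type_synonym store = "string \<Rightarrow> val"

datatype expr = Const val | Var string | Unary unop expr | Binary binop expr expr

fun eval_expr :: "expr \<Rightarrow> store \<Rightarrow> val" where
  "eval_expr (Const v) s = v"
| "eval_expr (Var x) s = s x"
| "eval_expr (Unary f a) s = apply_unop f (eval_expr a s)"
| "eval_expr (Binary f a b) s = apply_binop f (eval_expr a s) (eval_expr b s)"

fun expr_time :: "expr \<Rightarrow> store \<Rightarrow> nat" where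
  "expr_time (Const v) s = bits v"
| "expr_time (Var x) s = bits (s x)"
| "expr_time (Unary f a) s = expr_time a s + bits (eval_expr (Unary f a) s)"
| "expr_time (Binary f a b) s = expr_time a s + expr_time b s + bits (eval_expr (Binary f a b) s)"

datatype prog = Assign string expr | Then prog prog | Cond expr prog prog | While expr prog

definition holds :: "expr \<Rightarrow> store \<Rightarrow> bool" where
  "holds e s \<longleftrightarrow> eval_expr e s \<noteq> Num 0"

text \<open>\<open>exec c s t s'\<close>: started in \<open>s\<close>, the program \<open>c\<close> terminates in \<open>s'\<close> after time \<open>t\<close>.\<close>

inductive exec :: "prog \<Rightarrow> store \<Rightarrow> nat \<Rightarrow> store \<Rightarrow> bool" where
  Assign: "exec (Assign x e) s (1 + expr_time e s) (s(x := eval_expr e s))"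
| Then: "exec c s t s' \<Longrightarrow> exec d s' t' s'' \<Longrightarrow> exec (Then c d) s (t + t') s''"
| CondTrue: "holds e s \<Longrightarrow> exec c s t s' \<Longrightarrow> exec (Cond e c d) s (1 + expr_time e s + t) s'"
| CondFalse: "\<not> holds e s \<Longrightarrow> exec d s t s' \<Longrightarrow> exec (Cond e c d) s (1 + expr_time e s + t) s'"
| WhileFalse: "\<not> holds e s \<Longrightarrow> exec (While e c) s (1 + expr_time e s) s"
| WhileTrue: "holds e s \<Longrightarrow> exec c s t s' \<Longrightarrow> exec (While e c) s' t' s'' \<Longrightarrow>
    exec (While e c) s (1 + expr_time e s + t + t') s''"

definition start :: "val \<Rightarrow> store" where
  "start v = (\<lambda>x. if x = ''in'' then v else Lst [])"

text \<open>A single program maps the encoding of every \<open>x \<in> X\<close> to an output related to \<open>x\<close> by \<open>R\<close>, in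
  time polynomial in the length of the encoding.\<close>

definition poly_time :: "('x \<Rightarrow> val) \<Rightarrow> 'x set \<Rightarrow> ('x \<Rightarrow> val \<Rightarrow> bool) \<Rightarrow> bool" where
  "poly_time enc X R \<longleftrightarrow> (\<exists>c (p :: nat poly). \<forall>x \<in> X. \<exists>t s.
     exec c (start (enc x)) t s \<and> t \<le> poly p (bits (enc x)) \<and> R x (s ''out''))"


section \<open>Encodings\<close>

definition enc_nat :: "nat \<Rightarrow> val" where
  "enc_nat k = Num (of_nat k)"

definition enc_matrix :: "nat \<Rightarrow> (nat \<Rightarrow> nat \<Rightarrow> rat) \<Rightarrow> val" where
  "enc_matrix n d = Lst (map (\<lambda>i. Lst (map (\<lambda>j. Num (d i j)) [1..<Suc n])) [1..<Suc n])"

definition enc_graph :: "nat list \<Rightarrow> (nat \<times> nat) list \<Rightarrow> val" where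
  "enc_graph vs es =
     Lst [Lst (map enc_nat vs), Lst (map (\<lambda>(u, v). Lst [enc_nat u, enc_nat v]) es)]"

definition enc_labels :: "nat \<Rightarrow> (nat \<Rightarrow> nat) \<Rightarrow> val" where
  "enc_labels n \<phi> = Lst (map (\<lambda>i. enc_nat (\<phi> i)) [1..<Suc n])"

definition lists_graph :: "nat list \<Rightarrow> (nat \<times> nat) list \<Rightarrow> graph \<Rightarrow> bool" where
  "lists_graph vs es G \<longleftrightarrow> distinct vs \<and> set vs = verts G \<and>
     distinct (map (\<lambda>(u, v). {u, v}) es) \<and> set (map (\<lambda>(u, v). {u, v}) es) = edges G"

definition encodes_solution :: "nat \<Rightarrow> val \<Rightarrow> graph \<Rightarrow> (nat \<Rightarrow> nat) \<Rightarrow> bool" where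
  "encodes_solution n v G \<phi> \<longleftrightarrow>
     (\<exists>vs es. lists_graph vs es G \<and> v = Lst [enc_graph vs es, enc_labels n \<phi>])"

definition real_matrix :: "(nat \<Rightarrow> nat \<Rightarrow> rat) \<Rightarrow> nat \<Rightarrow> nat \<Rightarrow> real" where
  "real_matrix d i j = real_of_rat (d i j)"

end

theory Submission
  imports Defs
begin

text \<open>
  A tree is described by a sequence of bundles: leaves \<open>cs\<close> with a common neighbour \<open>u\<close> are removed,
  which makes \<open>u\<close> a leaf, until a single edge remains. Every statement about costs is an induction
  along this sequence in which the removed leaves are merged into \<open>u\<close> and \<open>\<delta>\<close> is averaged over them.

  Lower bound: from a spanning tree of the merged instance one obtains a spanning tree of the
  original one by replacing \<open>u\<close> by a star on \<open>cs\<close> and moving every edge at \<open>u\<close> to the cheapest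
  element of \<open>cs\<close>; averaging shows that its cost does not exceed the cost of the tree. So the minimum
  spanning tree costs at most \<open>OPT\<close>. Upper bound: by the triangle inequality \<open>\<delta>\<close> is at most the path
  metric of the spanning tree, and the weights of the pairs separated by an edge of \<open>T\<close> sum up to \<open>2\<close>,
  hence \<open>f(T)\<close> is at most twice the cost of the spanning tree.

  For the cubic tree, separate one of the children \<open>q\<close> of a vertex of degree at least \<open>4\<close> from
  the others, which get a new common parent. All weights are preserved on average over \<open>q\<close>, so some \<open>q\<close>
  does not increase the cost, and trying all \<open>q\<close> repeatedly yields a cubic tree.

  Polynomial running time is closed under composition, case distinction and folds over lists whose
  intermediate results have polynomial size; this covers Prim's algorithm and the above
  procedure, written as functions on lists.
\<close>

section \<open>Polynomial-time functions\<close>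

text \<open>The weight of a pair is a product along its path, and the centre of a bundle of k leaves
  contributes 1/k because its degree is k + 1. So removing a bundle amounts to averaging over its k
  leaves, plus one term for the pairs inside it (\<open>bundle_cost_Cons\<close>), and both bounds
  become inductions about matrices. Costs are summed over ordered pairs, which absorbs the factor 2
  in the weights.

  Each induction needs a generalisation. In the lower bound, moved edges may coincide; a connected
  set of fewer than \<open>card L\<close> pairs is carried along and becomes a tree only at the end,
  by counting. In the upper bound, an averaged distance from \<open>u\<close> can exceed the path
  metric at \<open>u\<close> by the mean distance to the merged leaves, so every leaf carries an
  offset.

  Numbers are stored in binary, so loops run over lists only. Iterating a polynomial step can still
  blow up its data, hence a size bound accompanies every fold. The machine works with rationals
  while the guarantee is about reals; weights and costs are therefore defined over an arbitrary
  field.\<close>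

lemma poly_nat_mono: "poly (p :: nat poly) m \<le> poly p n" if "m \<le> n"
  using that by (induction p) (auto intro!: add_mono mult_mono)

section \<open>Bit lengths under rational arithmetic\<close>

lemma floorlog_mult_le: "floorlog 2 (m * n) \<le> floorlog 2 m + floorlog 2 n"
proof -
  have "m < 2 ^ floorlog 2 m" "n < 2 ^ floorlog 2 n"
    by (auto intro: floorlog_leD)
  then have "m * n < 2 ^ (floorlog 2 m + floorlog 2 n)"
    by (auto simp: power_add intro!: mult_strict_mono')
  then show ?thesis by (simp add: floorlog_le_iff)
qed

lemma floorlog_add_le: "floorlog 2 (m + n) \<le> max (floorlog 2 m) (floorlog 2 n) + 1"
proof -
  let ?k = "max (floorlog 2 m) (floorlog 2 n)"
  have "m < 2 ^ ?k" "n < 2 ^ ?k"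
    by (auto intro!: floorlog_leD)
  then have "m + n < 2 ^ (?k + 1)" by simp
  then show ?thesis by (simp only: floorlog_le_iff) simp
qed

text \<open>Numerator and denominator are measured apart because addition treats them differently,
  see \<open>bits_add\<close>.\<close>

definition num_bits :: "rat \<Rightarrow> nat" where
  "num_bits r = floorlog 2 (nat \<bar>fst (quotient_of r)\<bar>)"

definition den_bits :: "rat \<Rightarrow> nat" where
  "den_bits r = floorlog 2 (nat (snd (quotient_of r)))"

lemma rat_bits_eq: "rat_bits r = num_bits r + den_bits r"
  by (simp add: rat_bits_def num_bits_def den_bits_def case_prod_beta)

text \<open>Cancelling only shrinks: for the reduced fraction x/y, the equation x q = p y and
  coprimality give that x divides p and y divides q. Lengths can therefore be estimated on any
  unreduced fraction.\<close>

lemma quotient_of_le: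
  assumes "r = of_int p / of_int q" "q \<noteq> 0"
  shows "\<bar>fst (quotient_of r)\<bar> \<le> \<bar>p\<bar>" "snd (quotient_of r) \<le> \<bar>q\<bar>"
proof -
  obtain x y where xy: "quotient_of r = (x, y)" by (cases "quotient_of r")
  have y: "y > 0" and cop: "coprime x y"
    using xy by (auto intro: quotient_of_denom_pos quotient_of_coprime)
  have "rat_of_int x / of_int y = of_int p / of_int q"
    using quotient_of_div[OF xy] assms by simp
  then have "rat_of_int (x * q) = of_int (p * y)"
    using y assms(2) by (simp add: field_simps)
  then have eq: "x * q = p * y" by (simp only: of_int_eq_iff)
  have "y dvd q"
    using eq cop by (metis coprime_commute coprime_dvd_mult_right_iff dvd_triv_right)
  then show "snd (quotient_of r) \<le> \<bar>q\<bar>"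
    using xy assms(2) by (simp add: dvd_imp_le_int y zdvd_imp_le)
  have "x dvd p"
    using eq cop by (metis coprime_dvd_mult_left_iff dvd_triv_left)
  moreover have "x = 0" if "p = 0" using eq that assms(2) by simp
  ultimately show "\<bar>fst (quotient_of r)\<bar> \<le> \<bar>p\<bar>"
    using xy by (cases "p = 0") (auto simp: dvd_imp_le_int)
qed

lemma bits_fraction:
  assumes "r = of_int p / of_int q" "q \<noteq> 0"
  shows "num_bits r \<le> floorlog 2 (nat \<bar>p\<bar>)" "den_bits r \<le> floorlog 2 (nat \<bar>q\<bar>)"
  using quotient_of_le[OF assms] by (auto simp: num_bits_def den_bits_def intro!: floorlog_mono)

lemma floorlog_abs_mult:
  "floorlog 2 (nat \<bar>a * b\<bar>) \<le> floorlog 2 (nat \<bar>a\<bar>) + floorlog 2 (nat \<bar>b\<bar>)"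
  using floorlog_mult_le by (simp add: abs_mult nat_mult_distrib)

lemma floorlog_abs_add:
  "floorlog 2 (nat \<bar>a + b\<bar>) \<le> max (floorlog 2 (nat \<bar>a\<bar>)) (floorlog 2 (nat \<bar>b\<bar>)) + 1"
proof -
  have "floorlog 2 (nat \<bar>a + b\<bar>) \<le> floorlog 2 (nat \<bar>a\<bar> + nat \<bar>b\<bar>)"
    by (intro floorlog_mono) linarith
  then show ?thesis using floorlog_add_le order_trans by blast
qed

text \<open>Over the common denominator the numerator is p s + r q, so its length is a maximum of
  two products plus a carry bit. The maximum in place of a sum is what bounds long sums of
  rationals.\<close>

lemma bits_add:
  "num_bits (a + b) \<le> max (num_bits a + den_bits b) (num_bits b + den_bits a) + 1"
  "den_bits (a + b) \<le> den_bits a + den_bits b"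
proof -
  obtain p q where pq: "quotient_of a = (p, q)" by (cases "quotient_of a")
  obtain r s where rs: "quotient_of b = (r, s)" by (cases "quotient_of b")
  have pos: "q > 0" "s > 0" using pq rs by (auto intro: quotient_of_denom_pos)
  have eq: "a + b = of_int (p * s + r * q) / of_int (q * s)"
    using quotient_of_div[OF pq] quotient_of_div[OF rs] pos by (simp add: field_simps)
  have nz: "q * s \<noteq> 0" using pos by simp
  show "den_bits (a + b) \<le> den_bits a + den_bits b"
    using bits_fraction(2)[OF eq nz] floorlog_abs_mult[of q s] pq rs pos
    by (simp add: den_bits_def)
  have arith: "x \<le> max u' v' + 1"
    if "x \<le> y" "y \<le> max u v + 1" "u \<le> u'" "v \<le> v'" for x y u v u' v' :: nat
    using that by linarith
  show "num_bits (a + b) \<le> max (num_bits a + den_bits b) (num_bits b + den_bits a) + 1"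
    using arith[OF bits_fraction(1)[OF eq nz] floorlog_abs_add[of "p * s" "r * q"]
      floorlog_abs_mult[of p s] floorlog_abs_mult[of r q]] pq rs pos
    by (simp add: den_bits_def num_bits_def)
qed

lemma rat_bits_uminus: "num_bits (- b) = num_bits b" "den_bits (- b) = den_bits b"
  by (simp_all add: num_bits_def den_bits_def rat_uminus_code case_prod_beta)

lemma rat_bits_mult: "rat_bits (a * b) \<le> rat_bits a + rat_bits b"
proof -
  obtain p q where pq: "quotient_of a = (p, q)" by (cases "quotient_of a")
  obtain r s where rs: "quotient_of b = (r, s)" by (cases "quotient_of b")
  have pos: "q > 0" "s > 0" using pq rs by (auto intro: quotient_of_denom_pos)
  have eq: "a * b = of_int (p * r) / of_int (q * s)"
    using quotient_of_div[OF pq] quotient_of_div[OF rs] pos by (simp add: field_simps)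
  have nz: "q * s \<noteq> 0" using pos by simp
  show ?thesis
    using bits_fraction[OF eq nz] floorlog_abs_mult[of q s] floorlog_abs_mult[of p r] pq rs pos
    by (simp add: den_bits_def num_bits_def rat_bits_eq)
qed

lemma rat_bits_divide: "rat_bits (a / b) \<le> rat_bits a + rat_bits b + 1"
proof -
  obtain p q where pq: "quotient_of a = (p, q)" by (cases "quotient_of a")
  obtain r s where rs: "quotient_of b = (r, s)" by (cases "quotient_of b")
  have pos: "q > 0" "s > 0" using pq rs by (auto intro: quotient_of_denom_pos)
  have eq: "a / b = of_int (p * s) / of_int (q * r)"
    using quotient_of_div[OF pq] quotient_of_div[OF rs] by simp
  show ?thesis
  proof (cases "r = 0")
    \<comment> \<open>Division by zero yields 0 = 0/1, whose length 1 is covered by the summand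
      1.\<close>
    case True
    then have "b = 0" using quotient_of_div[OF rs] by simp
    then show ?thesis by (simp add: rat_bits_def floorlog_def)
  next
    case False
    then have nz: "q * r \<noteq> 0" using pos by simp
    show ?thesis
      using bits_fraction[OF eq nz] floorlog_abs_mult[of q r] floorlog_abs_mult[of p s] pq rs pos
      by (simp add: den_bits_def num_bits_def rat_bits_eq)
  qed
qed

lemma rat_bits_add: "rat_bits (a + b) \<le> 2 * (rat_bits a + rat_bits b) + 1"
  using bits_add[of a b] by (auto simp: rat_bits_eq)

lemma rat_bits_diff: "rat_bits (a - b) \<le> 2 * (rat_bits a + rat_bits b) + 1"
  using rat_bits_add[of a "- b"] by (simp add: rat_bits_eq rat_bits_uminus)

lemma floorlog_le_self: "floorlog 2 n \<le> n"
  by (simp add: floorlog_le_iff)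

lemma rat_bits_of_nat: "rat_bits (of_nat n) = floorlog 2 n + 1"
  by (simp add: rat_bits_def floorlog_def)

lemma bits_pos: "1 \<le> bits v"
  by (cases v) auto

lemma length_le_sum_bits: "length vs \<le> sum_list (map bits vs)"
  using sum_list_mono[of vs "\<lambda>_. 1" bits] bits_pos by (simp add: sum_list_triv)

lemma sum_bits_take_drop:
  "sum_list (map bits (take k vs)) \<le> sum_list (map bits vs)"
  "sum_list (map bits (drop k vs)) \<le> sum_list (map bits vs)"
  using arg_cong[OF append_take_drop_id[of k vs], of "\<lambda>vs. sum_list (map bits vs)"]
  by (simp_all only: map_append sum_list_append)

lemma bits_apply_unop: "bits (apply_unop f v) \<le> 2 * bits v + 3"
proof (cases f; cases v)
  fix vs assume "f = Length" "v = Lst vs"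
  then show ?thesis
    using length_le_sum_bits[of vs] floorlog_le_self[of "length vs"] by (simp add: rat_bits_of_nat)
qed auto

text \<open>One linear bound for all operations; the factor 2 is that of
  \<open>rat_bits_add\<close>.\<close>

lemma bits_apply_binop: "bits (apply_binop f v w) \<le> 2 * (bits v + bits w) + 3"
proof (cases f)
  case Nth
  show ?thesis
  proof (cases "\<exists>vs a. v = Lst vs \<and> w = Num a")
    case True
    then obtain vs a where vw: "v = Lst vs" "w = Num a" by blast
    have "bits x \<le> sum_list (map bits vs)" if "x \<in> set vs" for x
      using that by (simp add: member_le_sum_list)
    from this[OF nth_mem, of "nat \<lfloor>a\<rfloor>"] show ?thesis
      by (auto simp: vw Nth Let_def)
  qed (cases v; cases w; simp add: Nth)
next
  case Take
  then show ?thesis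
    by (cases v; cases w) (auto simp: Take intro!: order_trans[OF sum_bits_take_drop(1)])
next
  case Drop
  then show ?thesis
    by (cases v; cases w) (auto simp: Drop intro!: order_trans[OF sum_bits_take_drop(2)])
next
  case Plus
  show ?thesis
    using rat_bits_add by (cases v; cases w) (auto simp: Plus intro!: order_trans[OF rat_bits_add])
next
  case Minus
  show ?thesis
    using rat_bits_diff by (cases v; cases w) (auto simp: Minus intro!: order_trans[OF rat_bits_diff])
next
  case Times
  show ?thesis
    by (cases v; cases w) (auto simp: Times intro!: order_trans[OF rat_bits_mult])
next
  case Divide
  show ?thesis
    by (cases v; cases w) (auto simp: Divide intro!: order_trans[OF rat_bits_divide])
next
  case Less
  show ?thesis
    by (cases v; cases w) (simp_all add: Less rat_bits_def floorlog_def)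
next
  case Equal
  show ?thesis
    by (simp add: Equal rat_bits_def floorlog_def)
next
  case Append
  show ?thesis by (cases v; cases w) (auto simp: Append)
qed

lemma bits_eval_le_expr_time: "bits (eval_expr e s) \<le> expr_time e s"
  by (cases e) auto

section \<open>Running time of expressions and of composed programs\<close>

fun expr_vars :: "expr \<Rightarrow> string set" where
  "expr_vars (Const v) = {}"
| "expr_vars (Var x) = {x}"
| "expr_vars (Unary f a) = expr_vars a"
| "expr_vars (Binary f a b) = expr_vars a \<union> expr_vars b"

text \<open>Every operation enlarges the bound by constants only, and the expression is fixed, so
  these constants accumulate to one polynomial that does not depend on the store.\<close>

lemma expr_time_poly:
  "\<exists>p :: nat poly. \<forall>s M. (\<forall>v\<in>expr_vars e. bits (s v) \<le> M) \<longrightarrow> expr_time e s \<le> poly p M"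
proof (induction e)
  case (Const v)
  show ?case by (intro exI[of _ "[:bits v:]"]) simp
next
  case (Var x)
  show ?case by (intro exI[of _ "[:0, 1:]"]) simp
next
  case (Unary f a)
  then obtain p :: "nat poly" where
    p: "\<And>s M. \<forall>v\<in>expr_vars a. bits (s v) \<le> M \<Longrightarrow> expr_time a s \<le> poly p M" by blast
  have "expr_time (Unary f a) s \<le> poly (p + 2 * p + 3) M"
    if "\<forall>v\<in>expr_vars (Unary f a). bits (s v) \<le> M" for s M
    using p[of s M] that bits_eval_le_expr_time[of a s] bits_apply_unop[of f "eval_expr a s"]
    by simp
  then show ?case by blast
next
  case (Binary f a b)
  then obtain p q :: "nat poly" where
    p: "\<And>s M. \<forall>v\<in>expr_vars a. bits (s v) \<le> M \<Longrightarrow> expr_time a s \<le> poly p M" and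
    q: "\<And>s M. \<forall>v\<in>expr_vars b. bits (s v) \<le> M \<Longrightarrow> expr_time b s \<le> poly q M" by metis
  have "expr_time (Binary f a b) s \<le> poly (3 * p + 3 * q + 3) M"
    if "\<forall>v\<in>expr_vars (Binary f a b). bits (s v) \<le> M" for s M
    using p[of s M] q[of s M] that bits_eval_le_expr_time[of a s] bits_eval_le_expr_time[of b s]
      bits_apply_binop[of f "eval_expr a s" "eval_expr b s"]
    by simp
  then show ?case by blast
qed

text \<open>Programs are composed from pieces that keep their argument and result in the variable
  \<open>x\<close> and use the variable \<open>s\<close> as a stack for intermediate values. A piece is described by
  the contents of \<open>x\<close> and of the stack before and after, as functions of an index \<open>i \<in> I\<close>.\<close>

definition matches :: "store \<Rightarrow> val \<times> val list \<Rightarrow> bool" where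
  "matches s c \<longleftrightarrow> s ''x'' = fst c \<and> s ''s'' = Lst (snd c)"

definition csize :: "val \<times> val list \<Rightarrow> nat" where
  "csize c = bits (fst c) + bits (Lst (snd c))"

lemma expr_time_matches:
  assumes "expr_vars e \<subseteq> {''x'', ''s''}"
  obtains p :: "nat poly" where "\<And>s c. matches s c \<Longrightarrow> expr_time e s \<le> poly p (csize c)"
proof -
  obtain p :: "nat poly" where
    p: "\<And>s M. \<forall>v\<in>expr_vars e. bits (s v) \<le> M \<Longrightarrow> expr_time e s \<le> poly p M"
    using expr_time_poly by metis
  have "expr_time e s \<le> poly p (csize c)" if "matches s c" for s c
  proof (rule p, rule ballI)
    fix v assume "v \<in> expr_vars e"
    then have "v = ''x'' \<or> v = ''s''" using assms by blast
    then show "bits (s v) \<le> csize c"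
      using that by (auto simp: matches_def csize_def)
  qed
  then show ?thesis using that by blast
qed

text \<open>The size of the result is bounded along with the time, because the time bound of a
  following piece is a polynomial in that size. All variables other than the two of
  \<open>matches\<close> may hold anything before and after.\<close>

definition transforms ::
    "prog \<Rightarrow> nat poly \<Rightarrow> 'i set \<Rightarrow> ('i \<Rightarrow> val \<times> val list) \<Rightarrow> ('i \<Rightarrow> val \<times> val list) \<Rightarrow> bool" where
  "transforms c p I pre post \<longleftrightarrow> (\<forall>i\<in>I. csize (post i) \<le> poly p (csize (pre i)) \<and>
     (\<forall>s. matches s (pre i) \<longrightarrow>
       (\<exists>t s'. exec c s t s' \<and> matches s' (post i) \<and> t \<le> poly p (csize (pre i)))))"

definition feasibly :: "'i set \<Rightarrow> ('i \<Rightarrow> val \<times> val list) \<Rightarrow> ('i \<Rightarrow> val \<times> val list) \<Rightarrow> bool" where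
  "feasibly I pre post \<longleftrightarrow> (\<exists>c p. transforms c p I pre post)"

lemma feasibly_then [trans]:
  assumes "feasibly I pre mid" "feasibly I mid post"
  shows "feasibly I pre post"
proof -
  obtain c p d q where c: "transforms c p I pre mid" and d: "transforms d q I mid post"
    using assms unfolding feasibly_def by blast
  have "transforms (Then c d) (p + pcompose q p) I pre post"
    unfolding transforms_def
  proof (intro ballI conjI allI impI)
    fix i assume i: "i \<in> I"
    have mid: "csize (mid i) \<le> poly p (csize (pre i))"
      using c i by (simp add: transforms_def)
    then have mono: "poly q (csize (mid i)) \<le> poly (pcompose q p) (csize (pre i))"
      by (simp add: poly_pcompose poly_nat_mono)
    show "csize (post i) \<le> poly (p + pcompose q p) (csize (pre i))"
      using d i mono by (force simp: transforms_def)
    fix s assume "matches s (pre i)"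
    then obtain t s' where 1: "exec c s t s'" "matches s' (mid i)" "t \<le> poly p (csize (pre i))"
      using c i unfolding transforms_def by blast
    then obtain t' s'' where
      2: "exec d s' t' s''" "matches s'' (post i)" "t' \<le> poly q (csize (mid i))"
      using d i unfolding transforms_def by blast
    show "\<exists>t s'. exec (Then c d) s t s' \<and> matches s' (post i) \<and>
        t \<le> poly (p + pcompose q p) (csize (pre i))"
      using exec.Then[OF 1(1) 2(1)] 1(3) 2(2,3) mono
      by (intro exI[of _ "t + t'"] exI[of _ s'']) simp
  qed
  then show ?thesis unfolding feasibly_def by blast
qed

lemma feasibly_reindex:
  assumes "feasibly I pre post" "\<And>j. j \<in> J \<Longrightarrow> h j \<in> I"
    "\<And>j. j \<in> J \<Longrightarrow> pre' j = pre (h j)" "\<And>j. j \<in> J \<Longrightarrow> post' j = post (h j)"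
  shows "feasibly J pre' post'"
  using assms unfolding feasibly_def transforms_def by metis

lemma feasibly_assign_aux:
  assumes vars: "expr_vars e \<subseteq> {''x'', ''s''}" and y: "y \<in> {''x'', ''s''}"
    and post: "\<And>i s. i \<in> I \<Longrightarrow> matches s (pre i) \<Longrightarrow> matches (s(y := eval_expr e s)) (post i)"
  shows "feasibly I pre post"
proof -
  obtain p :: "nat poly" where p: "\<And>s c. matches s c \<Longrightarrow> expr_time e s \<le> poly p (csize c)"
    using expr_time_matches[OF vars] by metis
  have "transforms (Assign y e) ([:1, 1:] + p) I pre post"
    unfolding transforms_def
  proof (intro ballI conjI allI impI)
    fix i assume i: "i \<in> I"
    have time: "expr_time e s \<le> poly p (csize (pre i))" if "matches s (pre i)" for s
      using p that by blast
    \<comment> \<open>The size bound on \<open>post i\<close> mentions no store, so one that matches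
      \<open>pre i\<close> is made up to evaluate \<open>e\<close> in.\<close>
    let ?s = "(\<lambda>_. Lst [])(''x'' := fst (pre i), ''s'' := Lst (snd (pre i)))"
    have s: "matches ?s (pre i)" by (simp add: matches_def)
    from post[OF i s] show "csize (post i) \<le> poly ([:1, 1:] + p) (csize (pre i))"
      using y time[OF s] bits_eval_le_expr_time[of e ?s]
      by (auto simp: matches_def csize_def simp flip: bits.simps(2))
    fix s assume "matches s (pre i)"
    then show "\<exists>t s'. exec (Assign y e) s t s' \<and> matches s' (post i) \<and>
        t \<le> poly ([:1, 1:] + p) (csize (pre i))"
      using exec.Assign[of y e s] post[OF i] time[of s] by fastforce
  qed
  then show ?thesis unfolding feasibly_def by blast
qed

lemma feasibly_assign:
  assumes "expr_vars e \<subseteq> {''x'', ''s''}"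
    and "\<And>i s. i \<in> I \<Longrightarrow> s ''x'' = fst (pre i) \<Longrightarrow> s ''s'' = Lst (snd (pre i)) \<Longrightarrow>
      eval_expr e s = fst (post i)"
    and "\<And>i. i \<in> I \<Longrightarrow> snd (post i) = snd (pre i)"
  shows "feasibly I pre post"
  by (rule feasibly_assign_aux[of e "''x''"]) (use assms in \<open>auto simp: matches_def\<close>)

lemma feasibly_assign_stack:
  assumes "expr_vars e \<subseteq> {''x'', ''s''}"
    and "\<And>i s. i \<in> I \<Longrightarrow> s ''x'' = fst (pre i) \<Longrightarrow> s ''s'' = Lst (snd (pre i)) \<Longrightarrow>
      eval_expr e s = Lst (snd (post i))"
    and "\<And>i. i \<in> I \<Longrightarrow> fst (post i) = fst (pre i)"
  shows "feasibly I pre post"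
  by (rule feasibly_assign_aux[of e "''s''"]) (use assms in \<open>auto simp: matches_def\<close>)

lemma feasibly_push: "feasibly I pre (\<lambda>i. (fst (pre i), fst (pre i) # snd (pre i)))"
  by (rule feasibly_assign_stack[of "Binary Append (Unary Singleton (Var ''x'')) (Var ''s'')"]) auto

lemma feasibly_cond:
  assumes e: "expr_vars e \<subseteq> {''x'', ''s''}" "\<And>i s. i \<in> I \<Longrightarrow> matches s (pre i) \<Longrightarrow> holds e s \<longleftrightarrow> P i"
    and t: "feasibly {i\<in>I. P i} pre post" and f: "feasibly {i\<in>I. \<not> P i} pre post"
  shows "feasibly I pre post"
proof -
  obtain p :: "nat poly" where p: "\<And>s c. matches s c \<Longrightarrow> expr_time e s \<le> poly p (csize c)"
    using expr_time_matches[OF e(1)] by metis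
  obtain c q d r where c: "transforms c q {i\<in>I. P i} pre post"
    and d: "transforms d r {i\<in>I. \<not> P i} pre post"
    using t f unfolding feasibly_def by blast
  have "transforms (Cond e c d) (1 + p + q + r) I pre post"
    unfolding transforms_def
  proof (intro ballI conjI allI impI)
    fix i assume i: "i \<in> I"
    have time: "expr_time e s \<le> poly p (csize (pre i))" if "matches s (pre i)" for s
      using p that by blast
    show "csize (post i) \<le> poly (1 + p + q + r) (csize (pre i))"
      using c d i by (cases "P i") (force simp: transforms_def)+
    fix s assume s: "matches s (pre i)"
    show "\<exists>t s'. exec (Cond e c d) s t s' \<and> matches s' (post i) \<and>
        t \<le> poly (1 + p + q + r) (csize (pre i))"
    proof (cases "P i")
      case True
      then obtain t s' where "exec c s t s'" "matches s' (post i)" "t \<le> poly q (csize (pre i))"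
        using c i s unfolding transforms_def by blast
      then show ?thesis
        using exec.CondTrue[of e s c t s' d] e(2)[OF i s] True time[OF s]
        by (intro exI[of _ "1 + expr_time e s + t"] exI[of _ s']) simp
    next
      case False
      then obtain t s' where "exec d s t s'" "matches s' (post i)" "t \<le> poly r (csize (pre i))"
        using d i s unfolding transforms_def by blast
      then show ?thesis
        using exec.CondFalse[of e s d t s' c] e(2)[OF i s] False time[OF s]
        by (intro exI[of _ "1 + expr_time e s + t"] exI[of _ s']) simp
    qed
  qed
  then show ?thesis unfolding feasibly_def by blast
qed

text \<open>\<open>\<sigma> i k\<close> is the state after \<open>k\<close> of \<open>N i\<close>
  rounds. The body is treated as a single piece indexed by pairs \<open>(i, k)\<close>, which makes
  its polynomial independent of \<open>k\<close>. All intermediate states must be polynomial in the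
  first one: composing the bound of the body with itself \<open>N i\<close> times would not give a
  polynomial.\<close>

lemma feasibly_while:
  fixes \<sigma> :: "'i \<Rightarrow> nat \<Rightarrow> val \<times> val list" and q :: "nat poly"
  assumes e: "expr_vars e \<subseteq> {''x'', ''s''}"
      "\<And>i k s. i \<in> I \<Longrightarrow> k \<le> N i \<Longrightarrow> matches s (\<sigma> i k) \<Longrightarrow> holds e s \<longleftrightarrow> k < N i"
    and body: "feasibly {(i, k). i \<in> I \<and> k < N i} (\<lambda>(i, k). \<sigma> i k) (\<lambda>(i, k). \<sigma> i (Suc k))"
    and size: "\<And>i k. i \<in> I \<Longrightarrow> k \<le> N i \<Longrightarrow> csize (\<sigma> i k) \<le> poly q (csize (\<sigma> i 0))"
    and iter: "\<And>i. i \<in> I \<Longrightarrow> N i \<le> poly q (csize (\<sigma> i 0))"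
  shows "feasibly I (\<lambda>i. \<sigma> i 0) (\<lambda>i. \<sigma> i (N i))"
proof -
  obtain p :: "nat poly" where p: "\<And>s c. matches s c \<Longrightarrow> expr_time e s \<le> poly p (csize c)"
    using expr_time_matches[OF e(1)] by metis
  obtain c r where
    c: "transforms c r {(i, k). i \<in> I \<and> k < N i} (\<lambda>(i, k). \<sigma> i k) (\<lambda>(i, k). \<sigma> i (Suc k))"
    using body unfolding feasibly_def by blast
  \<comment> \<open>The cost of one round, its test included, at the largest size of a
    state.\<close>
  let ?w = "pcompose (1 + p + r) q"
  have "transforms (While e c) (q + (q + 1) * ?w) I (\<lambda>i. \<sigma> i 0) (\<lambda>i. \<sigma> i (N i))"
    unfolding transforms_def
  proof (intro ballI conjI allI impI)
    fix i assume i: "i \<in> I"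
    define M where "M = poly ?w (csize (\<sigma> i 0))"
    have time: "1 + expr_time e s + poly r (csize (\<sigma> i k)) \<le> M"
      if "matches s (\<sigma> i k)" "k \<le> N i" for s k
    proof -
      have "expr_time e s \<le> poly p (csize (\<sigma> i k))"
        using p that by blast
      also have "\<dots> \<le> poly p (poly q (csize (\<sigma> i 0)))"
        using size[OF i that(2)] by (rule poly_nat_mono)
      finally show ?thesis
        using poly_nat_mono[OF size[OF i that(2)], of r] by (simp add: M_def poly_pcompose)
    qed
    show "csize (\<sigma> i (N i)) \<le> poly (q + (q + 1) * ?w) (csize (\<sigma> i 0))"
      using size[OF i, of "N i"] by simp
    have loop: "\<exists>t s'. exec (While e c) s t s' \<and> matches s' (\<sigma> i (N i)) \<and> t \<le> (N i - k + 1) * M"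
      if "matches s (\<sigma> i k)" "k \<le> N i" for s k
      using that(2,1)
    \<comment> \<open>Backwards from the final state, where only the failing test is left to pay; it
      is the 1 in \<open>N i - k + 1\<close>.\<close>
    proof (induction k arbitrary: s rule: inc_induct)
      case base
      then show ?case
        using exec.WhileFalse[of e s c] e(2)[OF i, of "N i" s] time[of s "N i"]
        by (intro exI[of _ "1 + expr_time e s"] exI[of _ s]) simp
    next
      case (step k)
      then obtain t s' where 1: "exec c s t s'" "matches s' (\<sigma> i (Suc k))" "t \<le> poly r (csize (\<sigma> i k))"
        using c[unfolded transforms_def, THEN bspec, of "(i, k)"] i by auto
      then obtain t' s'' where 2: "exec (While e c) s' t' s''" "matches s'' (\<sigma> i (N i))"
          "t' \<le> (N i - Suc k + 1) * M"
        using step.IH by blast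
      have "N i - k + 1 = Suc (N i - Suc k + 1)" using step.hyps by simp
      then have "1 + expr_time e s + t + t' \<le> (N i - k + 1) * M"
        using time[OF step.prems] step.hyps 1(3) 2(3) by simp
      then show ?case
        using exec.WhileTrue[OF _ 1(1) 2(1)] e(2)[OF i _ step.prems] step.hyps 2(2)
        by (intro exI[of _ "1 + expr_time e s + t + t'"] exI[of _ s'']) simp
    qed
    fix s assume "matches s (\<sigma> i 0)"
    from loop[OF this] obtain t s' where
      "exec (While e c) s t s'" "matches s' (\<sigma> i (N i))" "t \<le> (N i + 1) * M" by auto
    moreover have "(N i + 1) * M \<le> poly ((q + 1) * ?w) (csize (\<sigma> i 0))"
      using iter[OF i] by (simp add: M_def)
    ultimately show "\<exists>t s'. exec (While e c) s t s' \<and> matches s' (\<sigma> i (N i)) \<and>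
        t \<le> poly (q + (q + 1) * ?w) (csize (\<sigma> i 0))"
      by (intro exI[of _ t] exI[of _ s']) (auto intro: trans_le_add2 order_trans)
  qed
  then show ?thesis unfolding feasibly_def by blast
qed

section \<open>Encoded types and the closure properties of polynomial time\<close>

class encodable =
  fixes enc :: "'a \<Rightarrow> val"
  assumes enc_eq_iff [simp]: "enc x = enc y \<longleftrightarrow> x = y"
begin

definition sz :: "'a \<Rightarrow> nat" where
  "sz a = bits (enc a)"

end

instantiation nat :: encodable
begin
definition encode_nat: "enc n = Num (of_nat n)"
instance by standard (simp add: encode_nat)
end

instantiation rat :: encodable
begin
definition encode_rat: "enc (r :: rat) = Num r"
instance by standard (simp add: encode_rat)
end

instantiation bool :: encodable
begin
definition encode_bool: "enc b = Num (of_bool b)"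
instance by standard (simp add: encode_bool)
end

instantiation list :: (encodable) encodable
begin
definition encode_list: "enc xs = Lst (map enc xs)"
instance by standard (simp add: encode_list inj_on_def)
end

instantiation prod :: (encodable, encodable) encodable
begin
definition encode_prod: "enc p = Lst [enc (fst p), enc (snd p)]"
instance by standard (simp add: encode_prod prod_eq_iff)
end

lemmas encode_defs = encode_nat encode_rat encode_bool encode_list encode_prod

lemma sz_simps:
  "sz (xs :: 'a :: encodable list) = 1 + sum_list (map sz xs)"
  "sz (p :: 'b :: encodable \<times> 'c :: encodable) = 1 + sz (fst p) + sz (snd p)"
  "sz (r :: rat) = 1 + rat_bits r"
  "sz (n :: nat) = 2 + floorlog 2 n"
  "sz (b :: bool) \<le> 3"
  by (simp_all add: sz_def encode_defs rat_bits_of_nat o_def sz_def[abs_def] rat_bits_def floorlog_def)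

lemma length_le_sz: "length xs \<le> sz xs"
  using length_le_sum_bits[of "map enc xs"] by (simp add: sz_def encode_defs o_def)

lemma sz_member: "x \<in> set xs \<Longrightarrow> sz x \<le> sz xs"
  by (simp add: sz_simps member_le_sum_list le_SucI)

text \<open>The arbitrary stack \<open>st\<close> makes a program callable as a subroutine: whatever
  the caller has saved there survives the call.\<close>

definition FP :: "('a :: encodable \<Rightarrow> 'b :: encodable) \<Rightarrow> bool" where
  "FP f \<longleftrightarrow> feasibly UNIV (\<lambda>(a, st). (enc a, st)) (\<lambda>(a, st). (enc (f a), st))"

named_theorems FP_intros

lemma FP_feasibly:
  assumes "FP f" "\<And>i. i \<in> I \<Longrightarrow> pre i = (enc (a i), st i)" "\<And>i. i \<in> I \<Longrightarrow> post i = (enc (f (a i)), st i)"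
  shows "feasibly I pre post"
  by (rule feasibly_reindex[OF assms(1)[unfolded FP_def], of _ "\<lambda>i. (a i, st i)"]) (use assms in auto)

lemma FP_assign:
  assumes "expr_vars e \<subseteq> {''x''}" "\<And>a s. s ''x'' = enc a \<Longrightarrow> eval_expr e s = enc (f a)"
  shows "FP f"
  unfolding FP_def by (rule feasibly_assign[of e]) (use assms in auto)

lemma FP_size:
  assumes "FP f"
  obtains p :: "nat poly" where "\<And>a. sz (f a) \<le> poly p (sz a)"
proof -
  obtain p :: "nat poly" where
    p: "\<And>a st. csize (enc (f a), st) \<le> poly p (csize (enc a, st))"
    using assms unfolding FP_def feasibly_def transforms_def by fastforce
  \<comment> \<open>Run on the empty stack, whose encoding has length 1; hence the shift by
    1.\<close>
  have "sz (f a) \<le> poly (pcompose p [:1, 1:]) (sz a)" for a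
    using p[of a "[]"] by (simp add: csize_def sz_def poly_pcompose)
  then show ?thesis using that by blast
qed

lemma FP_compose:
  assumes "FP g" "FP f"
  shows "FP (\<lambda>a. g (f a))"
  unfolding FP_def
proof (rule feasibly_then)
  show "feasibly UNIV (\<lambda>(a, st). (enc a, st)) (\<lambda>(a, st). (enc (f a), st))"
    using assms(2) by (simp add: FP_def)
  show "feasibly UNIV (\<lambda>(a, st). (enc (f a), st)) (\<lambda>(a, st). (enc (g (f a)), st))"
    by (rule FP_feasibly[OF assms(1), of _ _ "f \<circ> fst" snd]) auto
qed

lemma FP_id [FP_intros]: "FP (\<lambda>a. a)"
  by (rule FP_assign[of "Var ''x''"]) auto

lemma FP_const [FP_intros]: "FP (\<lambda>a. c)"
  by (rule FP_assign[of "Const (enc c)"]) auto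

text \<open>Computing \<open>f\<close> overwrites the input, so a copy is kept on the stack and
  fetched again for \<open>g\<close>; the value of \<open>f\<close> is stacked meanwhile.\<close>

lemma FP_Pair [FP_intros]:
  assumes "FP f" "FP g"
  shows "FP (\<lambda>a. (f a, g a))"
proof -
  have "feasibly UNIV (\<lambda>(a, st). (enc a, st)) (\<lambda>(a, st). (enc a, enc a # st))"
    by (rule feasibly_reindex[OF feasibly_push[of UNIV "\<lambda>(a, st). (enc a, st)"], of _ id]) auto
  also have "feasibly UNIV \<dots> (\<lambda>(a, st). (enc (f a), enc a # st))"
    by (rule FP_feasibly[OF assms(1), of _ _ fst "\<lambda>(a, st). enc a # st"]) auto
  also have "feasibly UNIV \<dots> (\<lambda>(a, st). (enc (f a), enc (f a) # enc a # st))"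
    by (rule feasibly_assign_stack[of "Binary Append (Unary Singleton (Var ''x'')) (Var ''s'')"]) auto
  also have "feasibly UNIV \<dots> (\<lambda>(a, st). (enc a, enc (f a) # enc a # st))"
    by (rule feasibly_assign[of "Binary Nth (Var ''s'') (Const (Num 1))"]) auto
  also have "feasibly UNIV \<dots> (\<lambda>(a, st). (enc (g a), enc (f a) # enc a # st))"
    by (rule FP_feasibly[OF assms(2), of _ _ fst "\<lambda>(a, st). enc (f a) # enc a # st"]) auto
  also have "feasibly UNIV \<dots> (\<lambda>(a, st). (enc (f a, g a), enc (f a) # enc a # st))"
    by (rule feasibly_assign[of "Binary Append
        (Unary Singleton (Binary Nth (Var ''s'') (Const (Num 0)))) (Unary Singleton (Var ''x''))"])
      (auto simp: encode_prod)
  also have "feasibly UNIV \<dots> (\<lambda>(a, st). (enc (f a, g a), st))"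
    by (rule feasibly_assign_stack[of "Binary Drop (Const (Num 2)) (Var ''s'')"]) auto
  finally show ?thesis by (simp add: FP_def)
qed

lemma FP_unary:
  assumes "FP f" "\<And>b. apply_unop p (enc b) = enc (h b)"
  shows "FP (\<lambda>a. h (f a))"
  by (rule FP_compose[OF FP_assign[of "Unary p (Var ''x'')"] assms(1)]) (use assms(2) in auto)

lemma FP_binary:
  assumes "FP f" "FP g" "\<And>b c. apply_binop p (enc b) (enc c) = enc (h b c)"
  shows "FP (\<lambda>a. h (f a) (g a))"
proof -
  have "FP (\<lambda>q. h (fst q) (snd q))"
    by (rule FP_assign[of "Binary p (Binary Nth (Var ''x'') (Const (Num 0)))
      (Binary Nth (Var ''x'') (Const (Num 1)))"]) (use assms(3) in \<open>auto simp: encode_prod\<close>)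
  from FP_compose[OF this FP_Pair[OF assms(1,2)]] show ?thesis by simp
qed

lemma FP_fst [FP_intros]: "FP f \<Longrightarrow> FP (\<lambda>a. fst (f a))"
  by (rule FP_compose[OF FP_assign[of "Binary Nth (Var ''x'') (Const (Num 0))"]])
    (auto simp: encode_prod)

lemma FP_snd [FP_intros]: "FP f \<Longrightarrow> FP (\<lambda>a. snd (f a))"
  by (rule FP_compose[OF FP_assign[of "Binary Nth (Var ''x'') (Const (Num 1))"]])
    (auto simp: encode_prod)

lemma FP_If [FP_intros]:
  assumes "FP P" "FP f" "FP g"
  shows "FP (\<lambda>a. if P a then f a else g a)"
proof -
  have "feasibly UNIV (\<lambda>q. (enc (fst q), snd q)) (\<lambda>q. (enc (P (fst q), fst q), snd q))"
    by (rule FP_feasibly[OF FP_Pair[OF assms(1) FP_id], of _ _ fst snd]) auto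
  also have "feasibly UNIV \<dots> (\<lambda>q. (if P (fst q) then enc (f (fst q)) else enc (g (fst q)), snd q))"
  proof (rule feasibly_cond[of "Binary Nth (Var ''x'') (Const (Num 0))" _ _ "P \<circ> fst"])
    have snd: "feasibly I (\<lambda>q. (enc (P (fst q), fst q), snd q)) (\<lambda>q. (enc (fst q), snd q))" for I
      by (rule FP_feasibly[OF FP_snd[OF FP_id], of _ _ "\<lambda>q. (P (fst q), fst q)" snd]) auto
    show "feasibly {i \<in> UNIV. (P \<circ> fst) i} (\<lambda>q. (enc (P (fst q), fst q), snd q))
        (\<lambda>q. (if P (fst q) then enc (f (fst q)) else enc (g (fst q)), snd q))"
      by (rule feasibly_then[OF snd FP_feasibly[OF assms(2), of _ _ fst snd]]) auto
    show "feasibly {i \<in> UNIV. \<not> (P \<circ> fst) i} (\<lambda>q. (enc (P (fst q), fst q), snd q))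
        (\<lambda>q. (if P (fst q) then enc (f (fst q)) else enc (g (fst q)), snd q))"
      by (rule feasibly_then[OF snd FP_feasibly[OF assms(3), of _ _ fst snd]]) auto
  qed (auto simp: matches_def holds_def encode_prod encode_bool)
  finally show ?thesis unfolding FP_def by (rule feasibly_reindex[of _ _ _ _ id]) auto
qed

lemma conj_if: "P \<and> Q \<longleftrightarrow> (if P then Q else False)" and not_if: "\<not> P \<longleftrightarrow> (if P then False else True)"
  by auto

lemma FP_conj [FP_intros]: "FP P \<Longrightarrow> FP Q \<Longrightarrow> FP (\<lambda>a. P a \<and> Q a)"
  by (subst conj_if) (intro FP_If FP_const)

lemma FP_not [FP_intros]: "FP P \<Longrightarrow> FP (\<lambda>a. \<not> P a)"
  by (subst not_if) (intro FP_If FP_const)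

lemma FP_disj [FP_intros]: "FP P \<Longrightarrow> FP Q \<Longrightarrow> FP (\<lambda>a. P a \<or> Q a)"
  using FP_not[OF FP_conj[OF FP_not FP_not], of P Q] by simp

text \<open>Encodings are injective (\<open>enc_eq_iff\<close>), so the machine may compare
  encodings in place of values.\<close>

lemma FP_eq [FP_intros]: "FP f \<Longrightarrow> FP g \<Longrightarrow> FP (\<lambda>a. f a = g a)"
  by (rule FP_binary[of _ _ Equal]) (auto simp: encode_bool)

lemma FP_less [FP_intros]:
  "FP f \<Longrightarrow> FP g \<Longrightarrow> FP (\<lambda>a. f a < (g a :: nat))"
  "FP f' \<Longrightarrow> FP g' \<Longrightarrow> FP (\<lambda>a. f' a < (g' a :: rat))"
  by (rule FP_binary[of _ _ Less]; simp add: encode_bool encode_nat encode_rat)+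

lemma FP_plus [FP_intros]:
  "FP f \<Longrightarrow> FP g \<Longrightarrow> FP (\<lambda>a. f a + (g a :: nat))"
  "FP f' \<Longrightarrow> FP g' \<Longrightarrow> FP (\<lambda>a. f' a + (g' a :: rat))"
  by (rule FP_binary[of _ _ Plus]; simp add: encode_nat encode_rat)+

lemma FP_times [FP_intros]:
  "FP f \<Longrightarrow> FP g \<Longrightarrow> FP (\<lambda>a. f a * (g a :: rat))"
  by (rule FP_binary[of _ _ Times]; simp add: encode_rat)

lemma FP_divide [FP_intros]:
  "FP f \<Longrightarrow> FP g \<Longrightarrow> FP (\<lambda>a. f a / (g a :: rat))"
  by (rule FP_binary[of _ _ Divide]; simp add: encode_rat)

lemma FP_rat_of_nat [FP_intros]: "FP f \<Longrightarrow> FP (\<lambda>a. rat_of_nat (f a))"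
  by (rule FP_compose[OF FP_assign[of "Var ''x''"]]) (auto simp: encode_rat encode_nat)

lemma FP_Cons [FP_intros]:
  assumes "FP f" "FP g"
  shows "FP (\<lambda>a. f a # g a)"
proof -
  have "FP (\<lambda>q. fst q # snd q)"
    by (rule FP_assign[of "Binary Append (Unary Singleton (Binary Nth (Var ''x'') (Const (Num 0))))
      (Binary Nth (Var ''x'') (Const (Num 1)))"]) (auto simp: encode_prod encode_list)
  from FP_compose[OF this FP_Pair[OF assms]] show ?thesis by simp
qed

lemma FP_append [FP_intros]: "FP f \<Longrightarrow> FP g \<Longrightarrow> FP (\<lambda>a. f a @ g a)"
  by (rule FP_binary[of _ _ Append]; simp add: encode_list)

lemma FP_take [FP_intros]: "FP f \<Longrightarrow> FP g \<Longrightarrow> FP (\<lambda>a. take (f a) (g a))"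
  by (rule FP_binary[of _ _ Take]; simp add: encode_list encode_nat take_map)

lemma FP_drop [FP_intros]: "FP f \<Longrightarrow> FP g \<Longrightarrow> FP (\<lambda>a. drop (f a) (g a))"
  by (rule FP_binary[of _ _ Drop]; simp add: encode_list encode_nat drop_map)

lemma FP_length [FP_intros]: "FP f \<Longrightarrow> FP (\<lambda>a. length (f a))"
  by (rule FP_unary[of _ Length]) (simp_all add: encode_list encode_nat)

text \<open>Out of range, the machine's own access yields the empty list, which is in general not
  the encoding of the default; the index is therefore compared with the length first.\<close>

lemma FP_nth_default [FP_intros]:
  assumes "FP d" "FP f" "FP g"
  shows "FP (\<lambda>a. nth_default (d a) (f a) (g a))"
proof -
  let ?pre = "\<lambda>q. (enc (fst q), snd q)"
  let ?post = "\<lambda>q. (enc (nth_default (fst (fst q)) (fst (snd (fst q))) (snd (snd (fst q)))), snd q)"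
  let ?p = "\<lambda>k. Binary Nth (Binary Nth (Var ''x'') (Const (Num 1))) (Const (Num k))"
  have "feasibly UNIV ?pre ?post"
  proof (rule feasibly_cond[of "Binary Less (?p 1) (Unary Length (?p 0))" _ _
      "\<lambda>q. snd (snd (fst q)) < length (fst (snd (fst q)))"])
    show "feasibly {q \<in> UNIV. snd (snd (fst q)) < length (fst (snd (fst q)))} ?pre ?post"
      by (rule feasibly_assign[of "Binary Nth (?p 0) (?p 1)"])
        (auto simp: encode_defs nth_default_def)
    show "feasibly {q \<in> UNIV. \<not> snd (snd (fst q)) < length (fst (snd (fst q)))} ?pre ?post"
      by (rule feasibly_assign[of "Binary Nth (Var ''x'') (Const (Num 0))"])
        (auto simp: encode_defs nth_default_def)
  qed (auto simp: encode_defs matches_def holds_def)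
  then have "FP (\<lambda>q. nth_default (fst q) (fst (snd q)) (snd (snd q)))"
    unfolding FP_def by (rule feasibly_reindex[of _ _ _ _ id]) auto
  from FP_compose[OF this FP_Pair[OF assms(1) FP_Pair[OF assms(2,3)]]] show ?thesis by simp
qed

lemma sum_list_take_le: "sum_list (map f (take k xs)) \<le> (sum_list (map f xs) :: nat)"
  and sum_list_drop_le: "sum_list (map f (drop k xs)) \<le> (sum_list (map f xs) :: nat)"
  using arg_cong[OF append_take_drop_id[of k xs], of "\<lambda>xs. sum_list (map f xs)"]
  by (simp_all only: map_append sum_list_append)

text \<open>The size hypothesis on every partial result cannot be left to \<open>FP F\<close>: a
  step that merely doubles its accumulator is polynomial, but its iteration is exponential.\<close>

lemma FP_fold:
  fixes q :: "nat poly"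
  assumes F: "FP (\<lambda>p. F (fst p) (fst (snd p)) (snd (snd p)))" and xs: "FP xs" and ini: "FP ini"
    and size: "\<And>a k. k \<le> length (xs a) \<Longrightarrow> sz (fold (F a) (take k (xs a)) (ini a)) \<le> poly q (sz a)"
  shows "FP (\<lambda>a. fold (F a) (xs a) (ini a))"
proof -
  \<comment> \<open>One round of the loop. The state consists of the input, the rest of the list and
    the accumulator. The default \<open>undefined\<close> would be read for an empty rest only, and
    then the loop has already ended.\<close>
  define B where "B = (\<lambda>p. (fst p, drop 1 (fst (snd p)),
    F (fst p) (nth_default undefined (fst (snd p)) 0) (snd (snd p))))"
  have "FP (\<lambda>p. F (fst p) (nth_default undefined (fst (snd p)) 0) (snd (snd p)))"
    by (rule FP_compose[OF F, of "\<lambda>p. (fst p, nth_default undefined (fst (snd p)) 0, snd (snd p))", simplified])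
      (intro FP_intros)
  then have B: "FP B" unfolding B_def by (intro FP_intros)
  define \<tau> where "\<tau> = (\<lambda>a k. (a, drop k (xs a), fold (F a) (take k (xs a)) (ini a)))"
  have step: "B (\<tau> a k) = \<tau> a (Suc k)" if "k < length (xs a)" for a k
    using that by (simp add: B_def \<tau>_def nth_default_def take_Suc_conv_app_nth)
  define \<sigma> where "\<sigma> = (\<lambda>(q :: 'a \<times> val list) k. (enc (\<tau> (fst q) k), snd q))"
  let ?N = "\<lambda>q. length (xs (fst q))"
  have "feasibly UNIV (\<lambda>q. (enc (fst q), snd q)) (\<lambda>q. \<sigma> q 0)"
    by (rule FP_feasibly[OF FP_Pair[OF FP_id FP_Pair[OF xs ini]], of _ _ fst snd])
       (auto simp: \<sigma>_def \<tau>_def)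
  also have "feasibly UNIV \<dots> (\<lambda>q. \<sigma> q (?N q))"
  \<comment> \<open>The test is the length of the rest, a number that is nonzero exactly as long as
    elements remain.\<close>
  proof (rule feasibly_while[of "Unary Length (Binary Nth (Binary Nth (Var ''x'') (Const (Num 1))) (Const (Num 0)))"
      _ _ _ "[:0, 2:] + q"])
    fix i :: "'a \<times> val list" and k s assume "k \<le> length (xs (fst i))" "matches s (\<sigma> i k)"
    then show "holds (Unary Length (Binary Nth (Binary Nth (Var ''x'') (Const (Num 1))) (Const (Num 0)))) s
        \<longleftrightarrow> k < length (xs (fst i))"
      by (auto simp: holds_def matches_def \<sigma>_def \<tau>_def encode_prod encode_list)
  next
    show "feasibly {(i, k). i \<in> UNIV \<and> k < ?N i} (\<lambda>(i, k). \<sigma> i k) (\<lambda>(i, k). \<sigma> i (Suc k))"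
      by (rule FP_feasibly[OF B, of _ _ "\<lambda>(i, k). \<tau> (fst i) k" "\<lambda>(i, k). snd i"])
        (auto simp: \<sigma>_def step)
  next
    fix i :: "'a \<times> val list" and k assume k: "k \<le> length (xs (fst i))"
    have "sz (fst i) \<le> sz (\<tau> (fst i) 0)" by (simp add: \<tau>_def sz_simps(2))
    then have "poly q (sz (fst i)) \<le> poly q (csize (\<sigma> i 0))"
      by (intro poly_nat_mono) (simp add: csize_def \<sigma>_def sz_def)
    then have "sz (\<tau> (fst i) k) \<le> 2 * sz (\<tau> (fst i) 0) + poly q (csize (\<sigma> i 0))"
      using size[OF k] sum_list_drop_le[of sz k "xs (fst i)"]
      by (simp add: \<tau>_def sz_simps)
    then show "csize (\<sigma> i k) \<le> poly ([:0, 2:] + q) (csize (\<sigma> i 0))"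
      by (simp add: csize_def \<sigma>_def sz_def)
  next
    fix i :: "'a \<times> val list"
    have "?N i \<le> csize (\<sigma> i 0)"
      using length_le_sz[of "xs (fst i)"]
      by (simp add: csize_def \<sigma>_def \<tau>_def sz_simps(2) flip: sz_def)
    then show "?N i \<le> poly ([:0, 2:] + q) (csize (\<sigma> i 0))" by simp
  qed auto
  also have "feasibly UNIV \<dots> (\<lambda>q. (enc (fold (F (fst q)) (xs (fst q)) (ini (fst q))), snd q))"
    by (rule FP_feasibly[OF FP_snd[OF FP_snd[OF FP_id]], of _ _ "\<lambda>q. \<tau> (fst q) (?N q)" snd])
      (auto simp: \<sigma>_def \<tau>_def)
  finally show ?thesis unfolding FP_def by (rule feasibly_reindex[of _ _ _ _ id]) auto
qed

text \<open>The increment per round may depend on the input and on the current element but not on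
  the accumulator, so the total growth is at most the number of rounds times one fixed
  polynomial.\<close>

lemma FP_fold_additive:
  fixes q :: "nat poly"
  assumes F: "FP (\<lambda>p. F (fst p) (fst (snd p)) (snd (snd p)))" and xs: "FP xs" and ini: "FP ini"
    and size: "\<And>a y acc. sz (F a y acc) \<le> sz acc + poly q (sz a + sz y)"
  shows "FP (\<lambda>a. fold (F a) (xs a) (ini a))"
proof -
  obtain p r :: "nat poly" where p: "\<And>a. sz (xs a) \<le> poly p (sz a)" and
    r: "\<And>a. sz (ini a) \<le> poly r (sz a)"
    using FP_size xs ini by metis
  have "sz (fold (F a) (take k (xs a)) (ini a)) \<le> poly (r + p * pcompose q ([:0, 1:] + p)) (sz a)" for a k
  proof -
    have "sz (fold (F a) ys z) \<le> sz z + length ys * poly q (sz a + poly p (sz a))"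
      if "set ys \<subseteq> set (xs a)" for ys z
      using that
    proof (induction ys arbitrary: z)
      case (Cons y ys)
      have "poly q (sz a + sz y) \<le> poly q (sz a + poly p (sz a))"
        using sz_member[of y "xs a"] Cons.prems p[of a] by (intro poly_nat_mono) auto
      moreover have "sz (fold (F a) ys (F a y z)) \<le> sz (F a y z) + length ys * poly q (sz a + poly p (sz a))"
        using Cons.IH Cons.prems by simp
      ultimately show ?case using size[of a y z] by simp
    qed simp
    from this[of "take k (xs a)" "ini a"]
    have "sz (fold (F a) (take k (xs a)) (ini a))
      \<le> sz (ini a) + length (take k (xs a)) * poly q (sz a + poly p (sz a))"
      by (simp add: set_take_subset)
    also have "\<dots> \<le> poly r (sz a) + poly p (sz a) * poly q (sz a + poly p (sz a))"
      using length_le_sz[of "xs a"] p[of a] r[of a] by (intro add_mono mult_mono) auto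
    finally show ?thesis by (simp add: poly_pcompose)
  qed
  then show ?thesis by (intro FP_fold[OF F xs ini])
qed

lemma FP_map [FP_intros]:
  assumes F: "FP (\<lambda>p. F (fst p) (snd p))" and xs: "FP xs"
  shows "FP (\<lambda>a. map (F a) (xs a))"
proof -
  obtain p :: "nat poly" where p: "\<And>a. sz (F (fst a) (snd a)) \<le> poly p (sz a)"
    using FP_size[OF F] by metis
  have F': "FP (\<lambda>p. F (fst p) (fst (snd p)))"
    by (rule FP_compose[OF F, of "\<lambda>p. (fst p, fst (snd p))", simplified]) (intro FP_intros)
  have "FP (\<lambda>a. fold (\<lambda>y acc. acc @ [F a y]) (xs a) [])"
  proof (rule FP_fold_additive[of _ _ _ "pcompose p [:1, 1:]"])
    show "FP (\<lambda>p. snd (snd p) @ [F (fst p) (fst (snd p))])" using F' by (intro FP_intros)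
    show "sz (acc @ [F a y]) \<le> sz acc + poly (pcompose p [:1, 1:]) (sz a + sz y)" for a y acc
      using p[of "(a, y)"] by (simp add: sz_simps poly_pcompose)
  qed (use xs in \<open>auto intro: FP_intros\<close>)
  moreover have "fold (\<lambda>y acc. acc @ [F a y]) ys zs = zs @ map (F a) ys" for a ys zs
    by (induction ys arbitrary: zs) auto
  ultimately show ?thesis by simp
qed

lemma FP_filter [FP_intros]:
  assumes F: "FP (\<lambda>p. F (fst p) (snd p))" and xs: "FP xs"
  shows "FP (\<lambda>a. filter (F a) (xs a))"
proof -
  have F': "FP (\<lambda>p. F (fst p) (fst (snd p)))"
    by (rule FP_compose[OF F, of "\<lambda>p. (fst p, fst (snd p))", simplified]) (intro FP_intros)
  have "FP (\<lambda>a. fold (\<lambda>y acc. if F a y then acc @ [y] else acc) (xs a) [])"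
  proof (rule FP_fold_additive[of _ _ _ "[:0, 1:]"])
    show "FP (\<lambda>p. if F (fst p) (fst (snd p)) then snd (snd p) @ [fst (snd p)] else snd (snd p))"
      using F' by (intro FP_intros)
  qed (use xs in \<open>auto intro: FP_intros simp: sz_simps\<close>)
  moreover have "fold (\<lambda>y acc. if F a y then acc @ [y] else acc) ys zs = zs @ filter (F a) ys" for a ys zs
    by (induction ys arbitrary: zs) auto
  ultimately show ?thesis by simp
qed

lemma FP_concat [FP_intros]:
  assumes xs: "FP xs"
  shows "FP (\<lambda>a. concat (xs a))"
proof -
  have "FP (\<lambda>a. fold (\<lambda>y acc. acc @ y) (xs a) [])"
  proof (rule FP_fold_additive[of _ _ _ "[:0, 1:]"])
    show "FP (\<lambda>p. snd (snd p) @ fst (snd p))" by (intro FP_intros)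
  qed (use xs in \<open>auto intro: FP_intros simp: sz_simps\<close>)
  moreover have "fold (\<lambda>y acc. acc @ y) ys zs = zs @ concat ys" for ys and zs :: "'b list"
    by (induction ys arbitrary: zs) auto
  ultimately show ?thesis by simp
qed

lemma FP_member [FP_intros]:
  assumes "FP f" "FP xs"
  shows "FP (\<lambda>a. f a \<in> set (xs a))"
proof -
  have "FP (\<lambda>a. filter (\<lambda>x. x = f a) (xs a) \<noteq> [])"
    by (intro FP_intros FP_compose[OF assms(1), of fst] assms(2))
  then show ?thesis by (simp add: filter_empty_conv)
qed

text \<open>The upper end is the length of a list. An interval up to a number given in binary would
  be exponentially long in the size of that number.\<close>

lemma FP_indices [FP_intros]:
  assumes xs: "FP xs"
  shows "FP (\<lambda>a. [0..<length (xs a)])"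
proof -
  obtain p :: "nat poly" where p: "\<And>a. sz (xs a) \<le> poly p (sz a)"
    using FP_size[OF xs] by metis
  have upt: "fold (\<lambda>y acc. acc @ [length acc]) ys [0..<k] = [0..<k + length ys]" for ys :: "'b list" and k
  proof (induction ys arbitrary: k)
    case (Cons y ys)
    show ?case using Cons.IH[of "Suc k"] by simp
  qed simp
  have "FP (\<lambda>a. fold (\<lambda>y acc. acc @ [length acc]) (xs a) [])"
  proof (rule FP_fold[of _ _ _ "1 + p * (2 + p)"])
    show "FP (\<lambda>p. snd (snd p) @ [length (snd (snd p))])" by (intro FP_intros)
    fix a k assume k: "k \<le> length (xs a)"
    have "sz [0..<k] \<le> 1 + k * (2 + k)"
    proof -
      have "sum_list (map sz [0..<k]) \<le> sum_list (map (\<lambda>_. 2 + k) [0..<k])"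
        by (rule sum_list_mono) (auto simp: sz_simps intro: order_trans[OF floorlog_le_self])
      then show ?thesis by (simp add: sz_simps sum_list_triv)
    qed
    also have "\<dots> \<le> 1 + poly p (sz a) * (2 + poly p (sz a))"
      using length_le_sz[of "xs a"] p[of a] k by (intro add_mono mult_mono) auto
    finally show "sz (fold (\<lambda>y acc. acc @ [length acc]) (take k (xs a)) []) \<le> poly (1 + p * (2 + p)) (sz a)"
      using upt[of "take k (xs a)" 0] k by simp
  qed (use xs in \<open>auto intro: FP_intros\<close>)
  then show ?thesis using upt[of _ 0] by simp
qed

text \<open>Unlike the total size, the larger of the sizes of numerator and denominator grows only
  additively when rationals are summed up.\<close>

lemma FP_sum_list [FP_intros]:
  assumes xs: "FP xs"
  shows "FP (\<lambda>a. sum_list (xs a) :: rat)"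
proof -
  obtain p :: "nat poly" where p: "\<And>a. sz (xs a) \<le> poly p (sz a)"
    using FP_size[OF xs] by metis
  have fold: "fold (\<lambda>y acc. acc + y) ys z = z + sum_list ys" for ys and z :: rat
    by (induction ys arbitrary: z) auto
  have "FP (\<lambda>a. fold (\<lambda>y acc. acc + y) (xs a) 0)"
  proof (rule FP_fold[of _ _ _ "2 * p + 3"])
    show "FP (\<lambda>p :: 'a \<times> rat \<times> rat. snd (snd p) + fst (snd p))" by (intro FP_intros)
    fix a k
    have "max (num_bits (sum_list ys)) (den_bits (sum_list ys)) \<le> 1 + sum_list (map sz ys)" for ys
    proof (induction ys)
      case (Cons y ys)
      have arith: "max u v \<le> 1 + (1 + (m + n) + c)"
        if "u \<le> max (m + d) (b + n) + 1" "v \<le> n + d" "max b d \<le> 1 + c" for b c d m n u v :: nat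
        using that by linarith
      from arith[OF bits_add Cons.IH] show ?case by (simp add: sz_simps rat_bits_eq)
    qed (simp add: num_bits_def den_bits_def floorlog_def)
    from this[of "take k (xs a)"]
    have "rat_bits (sum_list (take k (xs a))) \<le> 2 * (1 + sum_list (map sz (take k (xs a))))"
      by (simp add: rat_bits_eq)
    then have "sz (sum_list (take k (xs a))) \<le> 2 * sz (xs a) + 3"
      using sum_list_take_le[of sz k "xs a"] by (simp add: sz_simps)
    then show "sz (fold (\<lambda>y acc. acc + y) (take k (xs a)) 0) \<le> poly (2 * p + 3) (sz a)"
      using p[of a] by (simp add: fold)
  qed (use xs in \<open>auto intro: FP_intros\<close>)
  then show ?thesis by (simp add: fold)
qed

text \<open>The start value \<open>d\<close> competes as well; callers with a nonempty list pass its
  first element, so the winner lies in \<open>xs\<close>.\<close>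

definition best :: "('a \<Rightarrow> rat) \<Rightarrow> 'a list \<Rightarrow> 'a \<Rightarrow> 'a" where
  "best f xs d = fold (\<lambda>y b. if f y < f b then y else b) xs d"

lemma best_cases: "best f xs d \<in> insert d (set xs)"
  unfolding best_def by (induction xs arbitrary: d) fastforce+

lemma best_le: "x \<in> insert d (set xs) \<Longrightarrow> f (best f xs d) \<le> f x"
  unfolding best_def
proof (induction xs arbitrary: d x)
  case (Cons y ys)
  have "f (fold (\<lambda>y b. if f y < f b then y else b) ys b) \<le> f b" for b
    using Cons.IH by simp
  from this[of "if f y < f d then y else d"] show ?case
    using Cons.IH[of x "if f y < f d then y else d"] Cons.prems by auto
qed simp

lemma FP_best [FP_intros]:
  assumes F: "FP (\<lambda>p. F (fst p) (snd p))" and xs: "FP xs" and d: "FP d"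
  shows "FP (\<lambda>a. best (F a) (xs a) (d a))"
  unfolding best_def
proof (rule FP_fold_additive[of _ _ _ "[:0, 1:]"])
  have "FP (\<lambda>p. F (fst p) (fst (snd p)))"
    by (rule FP_compose[OF F, of "\<lambda>p. (fst p, fst (snd p))", simplified]) (intro FP_intros)
  moreover have "FP (\<lambda>p. F (fst p) (snd (snd p)))"
    by (rule FP_compose[OF F, of "\<lambda>p. (fst p, snd (snd p))", simplified]) (intro FP_intros)
  ultimately show "FP (\<lambda>p. if F (fst p) (fst (snd p)) < F (fst p) (snd (snd p)) then fst (snd p) else snd (snd p))"
    by (intro FP_intros)
qed (use xs d in \<open>auto simp: sz_simps\<close>)

lemma FP_poly_time:
  assumes "FP f" "\<And>x. x \<in> X \<Longrightarrow> e x = enc (g x)" "\<And>x. x \<in> X \<Longrightarrow> R x (enc (f (g x)))"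
  shows "poly_time e X R"
proof -
  obtain c p where c: "transforms c p UNIV (\<lambda>(a, st). (enc a, st)) (\<lambda>(a, st). (enc (f a), st))"
    using assms(1) unfolding FP_def feasibly_def by blast
  let ?c = "Then (Assign ''x'' (Var ''in'')) (Then c (Assign ''out'' (Var ''x'')))"
  let ?p = "[:2, 1:] + 2 * pcompose p [:1, 1:]"
  have "\<exists>t s. exec ?c (start (e x)) t s \<and> t \<le> poly ?p (bits (e x)) \<and> R x (s ''out'')" if x: "x \<in> X" for x
  proof -
    let ?s = "(start (e x))(''x'' := e x)"
    \<comment> \<open>All variables other than the input initially hold the empty list, so the stack
      starts empty.\<close>
    have "matches ?s (enc (g x), [])" using assms(2)[OF x] by (simp add: matches_def start_def)
    then obtain t s where 1: "exec c ?s t s" "matches s (enc (f (g x)), [])"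
        "t \<le> poly p (csize (enc (g x), []))" "csize (enc (f (g x)), []) \<le> poly p (csize (enc (g x), []))"
      using c[unfolded transforms_def, THEN bspec, of "(g x, [])"] by auto
    have "exec ?c (start (e x)) (1 + bits (e x) + (t + (1 + bits (s ''x'')))) (s(''out'' := s ''x''))"
      using exec.Assign[of "''x''" "Var ''in''" "start (e x)"] exec.Assign[of "''out''" "Var ''x''" s] 1(1)
      by (intro exec.Then) (auto simp: start_def)
    moreover have "1 + bits (e x) + (t + (1 + bits (s ''x''))) \<le> poly ?p (bits (e x))"
      using 1(2-4) assms(2)[OF x] by (simp add: matches_def csize_def poly_pcompose)
    moreover have "R x ((s(''out'' := s ''x'')) ''out'')"
      using 1(2) assms(3)[OF x] by (simp add: matches_def)
    ultimately show ?thesis by blast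
  qed
  then show ?thesis unfolding poly_time_def by blast
qed

section \<open>Trees\<close>

definition adj :: "nat set set \<Rightarrow> (nat \<times> nat) set" where
  "adj F = {(x, y). {x, y} \<in> F}"

definition conn :: "nat set \<Rightarrow> nat set set \<Rightarrow> bool" where
  "conn V F \<longleftrightarrow> (\<forall>u\<in>V. \<forall>v\<in>V. (u, v) \<in> (adj F)\<^sup>*)"

abbreviation (input) gr :: "nat set \<Rightarrow> nat set set \<Rightarrow> graph" where
  "gr V F \<equiv> \<lparr>verts = V, edges = F\<rparr>"

text \<open>After a change to a tree, counting edges is easier than excluding cycles. The two
  notions agree by \<open>is_tree_iff_counted\<close>.\<close>

definition counted_tree :: "graph \<Rightarrow> bool" where
  "counted_tree G \<longleftrightarrow> simple_graph G \<and> verts G \<noteq> {} \<and> conn (verts G) (edges G) \<and>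
     card (edges G) + 1 = card (verts G)"

lemma adj_iff: "(x, y) \<in> adj F \<longleftrightarrow> {x, y} \<in> F"
  by (simp add: adj_def)

lemma adj_mono: "F \<subseteq> F' \<Longrightarrow> adj F \<subseteq> adj F'"
  by (auto simp: adj_def)

lemma sym_adj: "sym (adj F)"
  by (auto simp: adj_def sym_def insert_commute)

lemma reach_sym: "(x, y) \<in> (adj F)\<^sup>* \<Longrightarrow> (y, x) \<in> (adj F)\<^sup>*"
  using sym_rtrancl[OF sym_adj] by (auto dest: symD)

lemma simple_graph_edgeD:
  assumes "simple_graph G" "{x, y} \<in> edges G"
  shows "x \<in> verts G" "y \<in> verts G" "x \<noteq> y"
  using assms by (fastforce simp: simple_graph_def doubleton_eq_iff)+

lemma simple_graph_edgeE:
  assumes "simple_graph G" "e \<in> edges G"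
  obtains u v where "e = {u, v}" "u \<in> verts G" "v \<in> verts G" "u \<noteq> v"
  using assms by (auto simp: simple_graph_def)

lemma simple_graph_finite:
  assumes "simple_graph G"
  shows "finite (verts G)" "finite (edges G)"
proof -
  show fin: "finite (verts G)" using assms by (simp add: simple_graph_def)
  have "edges G \<subseteq> Pow (verts G)" using assms by (auto simp: simple_graph_def)
  then show "finite (edges G)" using fin finite_subset by blast
qed

lemma simple_graph_mono:
  assumes "simple_graph G" "V \<subseteq> verts G" "F \<subseteq> edges G" "\<And>e. e \<in> F \<Longrightarrow> e \<subseteq> V"
  shows "simple_graph (gr V F)"
proof -
  have "\<exists>u v. u \<in> V \<and> v \<in> V \<and> u \<noteq> v \<and> e = {u, v}" if "e \<in> F" for e
  proof -
    obtain u v where "e = {u, v}" "u \<noteq> v"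
      using assms(3) \<open>e \<in> F\<close> by (blast elim: simple_graph_edgeE[OF assms(1)])
    then show ?thesis using assms(4)[OF \<open>e \<in> F\<close>] by blast
  qed
  moreover have "finite V" using assms(1,2) finite_subset by (auto simp: simple_graph_def)
  ultimately show ?thesis by (simp add: simple_graph_def)
qed

lemma conn_replace:
  assumes "conn V F" "\<And>x y. {x, y} \<in> F - F' \<Longrightarrow> (x, y) \<in> (adj F')\<^sup>*"
  shows "conn V F'"
proof -
  have "adj F \<subseteq> (adj F')\<^sup>*" using assms(2) by (auto simp: adj_def)
  then have "(adj F)\<^sup>* \<subseteq> (adj F')\<^sup>*" by (rule rtrancl_subset_rtrancl)
  then show ?thesis using assms(1) by (auto simp: conn_def)
qed

text \<open>Every vertex other than a fixed root has an edge towards the root, and these edges are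
  distinct.\<close>

lemma card_verts_le_conn:
  assumes G: "simple_graph G" and c: "conn (verts G) (edges G)"
  shows "card (verts G) \<le> card (edges G) + 1"
proof (cases "verts G = {}")
  case False
  then obtain r where r: "r \<in> verts G" by blast
  define d where "d v = (LEAST k. (r, v) \<in> adj (edges G) ^^ k)" for v
  have dI: "(r, v) \<in> adj (edges G) ^^ d v" if "v \<in> verts G" for v
  proof -
    have "(r, v) \<in> (adj (edges G))\<^sup>*" using c r that by (auto simp: conn_def)
    then obtain k where "(r, v) \<in> adj (edges G) ^^ k" by (auto simp: rtrancl_power)
    then show ?thesis unfolding d_def by (rule LeastI)
  qed
  have "\<exists>w. {w, v} \<in> edges G \<and> d w < d v" if v: "v \<in> verts G - {r}" for v
  proof (cases "d v")
    case 0
    then show ?thesis using dI[of v] v by simp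
  next
    case (Suc k)
    then obtain w where w: "(r, w) \<in> adj (edges G) ^^ k" "(w, v) \<in> adj (edges G)"
      using dI[of v] v by auto
    then have "d w \<le> k" by (auto simp: d_def intro: Least_le)
    then show ?thesis using w Suc by (auto simp: adj_iff)
  qed
  then obtain par where par: "\<And>v. v \<in> verts G - {r} \<Longrightarrow> {par v, v} \<in> edges G \<and> d (par v) < d v"
    by metis
  \<comment> \<open>An edge shared by two different vertices would make each the parent of the
    other, hence each strictly nearer to the root than the other.\<close>
  have "inj_on (\<lambda>v. {par v, v}) (verts G - {r})"
  proof (rule inj_onI)
    fix v w assume "v \<in> verts G - {r}" "w \<in> verts G - {r}" "{par v, v} = {par w, w}"
    then have "d (par v) < d v" "d (par w) < d w" "v = w \<or> par v = w \<and> v = par w"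
      using par[of v] par[of w] by (simp_all add: doubleton_eq_iff) blast
    then show "v = w" by (metis less_asym)
  qed
  moreover have "(\<lambda>v. {par v, v}) ` (verts G - {r}) \<subseteq> edges G" using par by blast
  ultimately have "card (verts G - {r}) \<le> card (edges G)"
    using simple_graph_finite[OF G] by (metis card_inj_on_le)
  then show ?thesis using r simple_graph_finite[OF G] by (simp add: card_Diff_singleton)
qed simp

text \<open>Were the ends still joined, deleting the edge would leave a connected graph with two
  edges fewer than vertices, against \<open>card_verts_le_conn\<close>.\<close>

lemma counted_tree_bridge:
  assumes G: "counted_tree G" and e: "{x, y} \<in> edges G"
  shows "(x, y) \<notin> (adj (edges G - {{x, y}}))\<^sup>*"
proof
  assume reach: "(x, y) \<in> (adj (edges G - {{x, y}}))\<^sup>*"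
  have sg: "simple_graph G" using G by (simp add: counted_tree_def)
  let ?G = "gr (verts G) (edges G - {{x, y}})"
  have "conn (verts G) (edges G - {{x, y}})"
    by (rule conn_replace[of _ "edges G"])
      (use G reach reach_sym[OF reach] in \<open>auto simp: counted_tree_def doubleton_eq_iff\<close>)
  moreover have "simple_graph ?G" using sg by (auto simp: simple_graph_def)
  ultimately have "card (verts G) \<le> card (edges G - {{x, y}}) + 1"
    using card_verts_le_conn[of ?G] by simp
  moreover have "card (edges G - {{x, y}}) < card (edges G)"
    using e simple_graph_finite[OF sg] by (intro psubset_card_mono) auto
  ultimately show False using G by (simp add: counted_tree_def)
qed

section \<open>Paths and their uniqueness\<close>

lemma is_path_Cons:
  "is_path G u (x # p) v \<longleftrightarrow> x = u \<and> u \<in> verts G \<and>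
     (if p = [] then u = v else u \<notin> set p \<and> {u, hd p} \<in> edges G \<and> is_path G (hd p) p v)"
  by (cases p) (auto simp: is_path_def)

lemma is_path_avoid:
  assumes "is_path G x p v" "u \<notin> set p" "u \<in> e"
  shows "(x, v) \<in> (adj (edges G - {e}))\<^sup>*"
  using assms(1,2)
proof (induction p arbitrary: x)
  case (Cons y p)
  show ?case
  proof (cases "p = []")
    case False
    then have p: "{x, hd p} \<in> edges G" "is_path G (hd p) p v" "x \<noteq> u" "hd p \<noteq> u" "y = x"
      using Cons.prems by (auto simp: is_path_Cons dest: hd_in_set)
    then have "(x, hd p) \<in> adj (edges G - {e})" using assms(3) by (auto simp: adj_iff)
    then show ?thesis using Cons.IH[OF p(2)] Cons.prems(2) by (auto intro: converse_rtrancl_into_rtrancl)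
  qed (use Cons.prems in \<open>auto simp: is_path_Cons\<close>)
qed (simp add: is_path_def)

lemma is_path_reach: "is_path G x p v \<Longrightarrow> (x, v) \<in> (adj (edges G))\<^sup>*"
proof (induction p arbitrary: x)
  case (Cons y p)
  then show ?case
    by (cases "p = []") (auto simp: is_path_Cons adj_iff intro: converse_rtrancl_into_rtrancl)
qed (simp add: is_path_def)

lemma is_path_snoc:
  assumes "is_path G u p v" "{v, w} \<in> edges G" "w \<in> verts G" "w \<notin> set p"
  shows "is_path G u (p @ [w]) w"
  using assms by (auto simp: is_path_def successively_append_iff)

text \<open>A walk is made simple on the fly: whenever it returns to a vertex \<open>z\<close> of
  the path so far, the path is cut off at \<open>z\<close>.\<close>

lemma reach_is_path:
  assumes "(u, v) \<in> (adj (edges G))\<^sup>*" "u \<in> verts G" "simple_graph G"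
  shows "\<exists>p. is_path G u p v"
  using assms(1)
proof induction
  case base
  show ?case using assms(2) by (intro exI[of _ "[u]"]) (simp add: is_path_def)
next
  case (step y z)
  then obtain p where p: "is_path G u p y" by blast
  show ?case
  proof (cases "z \<in> set p")
    case True
    then obtain a b where "p = a @ z # b" by (meson split_list)
    then have ab: "p = (a @ [z]) @ b" by simp
    then have "successively (\<lambda>x y. {x, y} \<in> edges G) (a @ [z])"
      using p by (simp only: is_path_def successively_append_iff)
    moreover have "hd (a @ [z]) = u" using p ab by (cases a) (auto simp: is_path_def)
    ultimately have "is_path G u (a @ [z]) z"
      using p ab by (auto simp: is_path_def)
    then show ?thesis by blast
  next
    case False
    then show ?thesis
      using is_path_snoc[OF p, of z] step.hyps(2) simple_graph_edgeD[OF assms(3), of y z]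
      by (auto simp: adj_iff)
  qed
qed

lemma conn_iff_paths:
  assumes "simple_graph G"
  shows "conn (verts G) (edges G) \<longleftrightarrow> (\<forall>u\<in>verts G. \<forall>v\<in>verts G. \<exists>p. is_path G u p v)"
  using reach_is_path[OF _ _ assms] is_path_reach by (fastforce simp: conn_def)

text \<open>If two paths left \<open>u\<close> by different edges, the second one followed by the
  reversed rest of the first would bypass the first edge, which is a bridge.\<close>

lemma counted_tree_path_unique:
  assumes "counted_tree G" "is_path G u p v" "is_path G u q v"
  shows "p = q"
  using assms(2,3)
proof (induction p arbitrary: u q)
  case (Cons u' p)
  obtain u'' q' where q: "q = u'' # q'" using Cons.prems(2) by (cases q) (auto simp: is_path_def)
  show ?case
  proof (cases "p = [] \<or> q' = []")
    case True
    have "v \<in> set p" if "p \<noteq> []" using Cons.prems(1) that by (auto simp: is_path_def)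
    moreover have "v \<in> set q'" if "q' \<noteq> []" using Cons.prems(2) q that by (auto simp: is_path_def)
    ultimately show ?thesis using Cons.prems True q by (auto simp: is_path_Cons split: if_splits)
  next
    case False
    then have p: "{u, hd p} \<in> edges G" "is_path G (hd p) p v" "u \<notin> set p"
      and q': "{u, hd q'} \<in> edges G" "is_path G (hd q') q' v" "u \<notin> set q'"
      using Cons.prems q by (auto simp: is_path_Cons)
    have "hd p = hd q'"
    proof (rule ccontr)
      assume ne: "hd p \<noteq> hd q'"
      let ?R = "adj (edges G - {{u, hd p}})"
      have "(hd p, v) \<in> ?R\<^sup>*" "(hd q', v) \<in> ?R\<^sup>*"
        using is_path_avoid[OF p(2,3)] is_path_avoid[OF q'(2,3)] by auto
      moreover have "(u, hd q') \<in> ?R" using q'(1) ne by (auto simp: adj_iff doubleton_eq_iff)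
      ultimately have "(u, hd p) \<in> ?R\<^sup>*"
        by (meson converse_rtrancl_into_rtrancl reach_sym rtrancl_trans)
      then show False using counted_tree_bridge[OF assms(1) p(1)] by blast
    qed
    then show ?thesis using Cons.IH[OF p(2)] q' q Cons.prems by (auto simp: is_path_Cons)
  qed
qed (simp add: is_path_def)

text \<open>The rest of a cycle connects the ends of its closing edge, which is a bridge.\<close>

lemma counted_tree_acyclic:
  assumes "counted_tree G"
  shows "\<not> is_cycle G c"
proof
  assume c: "is_cycle G c"
  obtain a b c' where c': "c = a # b # c'" "c' \<noteq> []"
    using c by (cases c; cases "tl c"; cases "tl (tl c)") (auto simp: is_cycle_def)
  let ?e = "{a, last c'}" and ?R = "adj (edges G - {{a, last c'}})"
  have e: "?e \<in> edges G" using c c' by (auto simp: is_cycle_def insert_commute)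
  have "is_path G b (b # c') (last c')" using c c' by (auto simp: is_cycle_def is_path_def)
  then have "(b, last c') \<in> ?R\<^sup>*"
    by (rule is_path_avoid[of _ _ _ _ a]) (use c c' in \<open>auto simp: is_cycle_def\<close>)
  moreover have "(a, b) \<in> ?R"
    using c c' last_in_set[of c'] by (auto simp: is_cycle_def adj_iff doubleton_eq_iff)
  ultimately have "(a, last c') \<in> ?R\<^sup>*" by (rule converse_rtrancl_into_rtrancl[rotated])
  then show False using counted_tree_bridge[OF assms e] by blast
qed

section \<open>Degrees and cycles\<close>

definition nbrs :: "graph \<Rightarrow> nat \<Rightarrow> nat set" where
  "nbrs G v = {w. {v, w} \<in> edges G}"

lemma vertex_degree_eq_nbrs:
  assumes "simple_graph G"
  shows "vertex_degree G v = card (nbrs G v)"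
proof -
  have "bij_betw (\<lambda>w. {v, w}) (nbrs G v) {e \<in> edges G. v \<in> e}"
    unfolding bij_betw_def
  proof
    show "inj_on (\<lambda>w. {v, w}) (nbrs G v)" by (auto simp: inj_on_def doubleton_eq_iff)
    show "(\<lambda>w. {v, w}) ` nbrs G v = {e \<in> edges G. v \<in> e}"
    proof (intro equalityI subsetI)
      fix e assume "e \<in> {e \<in> edges G. v \<in> e}"
      then obtain x y where "e = {x, y}" "v \<in> {x, y}" "e \<in> edges G"
        using assms by (auto elim: simple_graph_edgeE)
      then show "e \<in> (\<lambda>w. {v, w}) ` nbrs G v"
        by (auto simp: nbrs_def insert_commute)
    qed (auto simp: nbrs_def)
  qed
  then show ?thesis by (simp add: vertex_degree_def bij_betw_same_card)
qed

lemma nbrs_sub: "simple_graph G \<Longrightarrow> nbrs G v \<subseteq> verts G - {v}"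
  by (auto simp: nbrs_def dest: simple_graph_edgeD)

lemma finite_nbrs: "simple_graph G \<Longrightarrow> finite (nbrs G v)"
  using nbrs_sub simple_graph_finite(1) by (metis finite_Diff finite_subset)

text \<open>An end of a longest path has degree at most one.\<close>

lemma acyclic_low_degree:
  assumes sg: "simple_graph G" and ne: "verts G \<noteq> {}" and ac: "\<nexists>c. is_cycle G c"
  shows "\<exists>v\<in>verts G. vertex_degree G v \<le> 1"
proof -
  define P where "P = (\<lambda>p. p \<noteq> [] \<and> is_path G (hd p) p (last p))"
  have bound: "length p \<le> card (verts G)" if "P p" for p
    using that simple_graph_finite(1)[OF sg]
    by (metis P_def card_mono distinct_card is_path_def)
  obtain v where "v \<in> verts G" using ne by blast
  then have "P [v]" by (simp add: P_def is_path_def)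
  then obtain p where p: "P p" and max: "\<And>q. P q \<Longrightarrow> length q \<le> length p"
    using ex_has_greatest_nat[of P "[v]" length "Suc (card (verts G))"] bound
    by (auto simp: less_Suc_eq_le)
  have v: "hd p \<in> verts G" using p by (auto simp: P_def is_path_def)
  have "card (nbrs G (hd p)) \<le> 1"
  proof (rule ccontr)
    assume "\<not> card (nbrs G (hd p)) \<le> 1"
    then have many: "\<not> nbrs G (hd p) \<subseteq> {x}" for x
      by (metis card_mono finite.emptyI finite_insert card_1_singleton_iff One_nat_def)
    have in_p: "w \<in> set p" if "w \<in> nbrs G (hd p)" for w
    proof (rule ccontr)
      assume "w \<notin> set p"
      moreover have "{w, hd p} \<in> edges G" "w \<in> verts G"
        using that sg by (auto simp: nbrs_def insert_commute dest: simple_graph_edgeD)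
      ultimately have "P (w # p)" using p by (auto simp: P_def is_path_Cons)
      then show False using max by fastforce
    qed
    obtain w where w: "w \<in> nbrs G (hd p)" "w \<noteq> hd (tl p)" using many[of "hd (tl p)"] by blast
    then have "w \<in> set p" "w \<noteq> hd p" using in_p nbrs_sub[OF sg] by blast+
    then obtain j where j: "j < length p" "p ! j = w" by (auto simp: in_set_conv_nth)
    have "j \<noteq> 0" using j \<open>w \<noteq> hd p\<close> by (metis hd_conv_nth length_0_conv less_nat_zero_code)
    moreover have "j \<noteq> 1" using j w(2) by (cases p; cases "tl p") auto
    ultimately have j2: "2 \<le> j" by simp
    \<comment> \<open>The start of the path up to the second neighbour \<open>w\<close> of its end
      closes to a cycle; as \<open>w\<close> has index at least 2, the cycle has at least three
      vertices.\<close>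
    have "is_cycle G (take (Suc j) p)"
      unfolding is_cycle_def
    proof (intro conjI)
      show "3 \<le> length (take (Suc j) p)" using j j2 by simp
      show "distinct (take (Suc j) p)" using p by (simp add: P_def is_path_def)
      show "set (take (Suc j) p) \<subseteq> verts G" using p set_take_subset[of "Suc j" p]
        by (auto simp: P_def is_path_def)
      have "successively (\<lambda>x y. {x, y} \<in> edges G) (take (Suc j) p @ drop (Suc j) p)"
        using p by (simp add: P_def is_path_def)
      then show "successively (\<lambda>x y. {x, y} \<in> edges G) (take (Suc j) p)"
        by (simp only: successively_append_iff)
      have "last (take (Suc j) p) = w" using j by (simp add: take_Suc_conv_app_nth)
      moreover have "hd (take (Suc j) p) = hd p" using j by (cases p) auto
      ultimately show "{last (take (Suc j) p), hd (take (Suc j) p)} \<in> edges G"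
        using w by (simp add: nbrs_def insert_commute)
    qed
    then show False using ac by blast
  qed
  then show ?thesis using v vertex_degree_eq_nbrs[OF sg] by metis
qed

lemma is_cycle_mono:
  assumes "is_cycle G c" "verts G \<subseteq> verts H" "edges G \<subseteq> edges H"
  shows "is_cycle H c"
  using assms unfolding is_cycle_def by (auto intro: successively_mono)

text \<open>Delete a vertex of degree at most 1: one vertex and at most one edge disappear, and no
  cycle can arise.\<close>

lemma acyclic_card_edges:
  assumes "simple_graph G" "verts G \<noteq> {}" "\<nexists>c. is_cycle G c"
  shows "card (edges G) + 1 \<le> card (verts G)"
  using assms
proof (induction "card (verts G)" arbitrary: G)
  case 0
  then show ?case using simple_graph_finite by fastforce
next
  case (Suc n)
  have fin: "finite (verts G)" "finite (edges G)" using simple_graph_finite[OF Suc.prems(1)] by auto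
  obtain v where v: "v \<in> verts G" "vertex_degree G v \<le> 1"
    using acyclic_low_degree[OF Suc.prems] by blast
  let ?F = "{e \<in> edges G. v \<notin> e}" and ?D = "{e \<in> edges G. v \<in> e}"
  let ?H = "gr (verts G - {v}) ?F"
  have split: "card (edges G) = card ?F + card ?D"
    by (subst card_Un_disjoint[symmetric]) (use fin in \<open>auto intro: arg_cong[of _ _ card]\<close>)
  have sub: "e \<subseteq> verts G" if "e \<in> edges G" for e
    using that Suc.prems(1) by (auto elim: simple_graph_edgeE)
  show ?case
  proof (cases "verts G = {v}")
    case True
    then have "edges G = {}" using Suc.prems(1) by (metis equals0I simple_graph_edgeE singletonD)
    then show ?thesis using True by simp
  next
    case False
    have H: "simple_graph ?H"
      by (rule simple_graph_mono[OF Suc.prems(1)]) (use sub in auto)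
    have "\<nexists>c. is_cycle ?H c" using Suc.prems(3) is_cycle_mono[of ?H _ G] by auto
    moreover have "n = card (verts ?H)" using Suc.hyps(2) v by simp
    moreover have "verts ?H \<noteq> {}" using False v by auto
    ultimately have "card (edges ?H) + 1 \<le> card (verts ?H)"
      using Suc.hyps(1)[of ?H] H by blast
    then have "card ?F + 1 \<le> card (verts G - {v})" by simp
    moreover have "card (verts G) = Suc (card (verts G - {v}))"
      using v fin by (intro card.remove)
    ultimately show ?thesis using split v(2) by (simp add: vertex_degree_def)
  qed
qed

lemma is_tree_iff_counted: "is_tree G \<longleftrightarrow> counted_tree G"
proof
  assume G: "is_tree G"
  then have "simple_graph G" "verts G \<noteq> {}" "conn (verts G) (edges G)"
    using conn_iff_paths by (auto simp: is_tree_def)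
  moreover have "card (edges G) + 1 \<le> card (verts G)"
    using G by (intro acyclic_card_edges) (auto simp: is_tree_def)
  ultimately show "counted_tree G"
    using card_verts_le_conn[of G] by (simp add: counted_tree_def)
next
  assume G: "counted_tree G"
  then show "is_tree G"
    using counted_tree_acyclic[OF G] conn_iff_paths[of G]
    by (auto simp: is_tree_def counted_tree_def)
qed

lemma conn_card_tree:
  assumes "simple_graph G" "verts G \<noteq> {}" "conn (verts G) (edges G)" "card (edges G) < card (verts G)"
  shows "is_tree G"
  using assms card_verts_le_conn[OF assms(1,3)]
  by (simp add: is_tree_iff_counted counted_tree_def)

lemma tree_path_eqI: "is_tree G \<Longrightarrow> is_path G u p v \<Longrightarrow> tree_path G u v = p"
  unfolding tree_path_def is_tree_iff_counted
  using counted_tree_path_unique by blast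

lemma is_treeD:
  assumes "is_tree G"
  shows "simple_graph G" "verts G \<noteq> {}" "conn (verts G) (edges G)"
    "card (edges G) + 1 = card (verts G)" "\<nexists>c. is_cycle G c"
  using assms by (simp_all add: is_tree_iff_counted counted_tree_def counted_tree_acyclic)

lemma tree_degree_pos:
  assumes "is_tree G" "v \<in> verts G" "2 \<le> card (verts G)"
  shows "1 \<le> vertex_degree G v"
proof -
  note G = is_treeD[OF assms(1)]
  obtain w where w: "w \<in> verts G" "w \<noteq> v"
    using assms(3) by (metis card_le_Suc0_iff_eq G(1) simple_graph_finite(1) assms(2) not_less_eq_eq numeral_2_eq_2)
  then have "(v, w) \<in> (adj (edges G))\<^sup>*" using G(3) assms(2) by (auto simp: conn_def)
  then obtain x where "(v, x) \<in> adj (edges G)" using w(2) by (metis converse_rtranclE)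
  then have "nbrs G v \<noteq> {}" by (auto simp: nbrs_def adj_iff)
  then show ?thesis using vertex_degree_eq_nbrs[OF G(1)] finite_nbrs[OF G(1)]
    by (simp add: Suc_le_eq card_gt_0_iff)
qed

section \<open>Attaching and removing leaves, exchanging edges\<close>

lemma pendant_tree:
  assumes "is_tree G" "u \<in> verts G" "c \<notin> verts G"
  shows "is_tree (gr (insert c (verts G)) (insert {u, c} (edges G)))"
proof (rule conn_card_tree)
  note G = is_treeD[OF assms(1)]
  note fin = simple_graph_finite[OF G(1)]
  let ?F = "insert {u, c} (edges G)"
  show "simple_graph (gr (insert c (verts G)) ?F)"
    using G(1) assms(2,3) by (fastforce simp: simple_graph_def)
  have mono: "(adj (edges G))\<^sup>* \<subseteq> (adj ?F)\<^sup>*" by (intro rtrancl_mono adj_mono) auto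
  have uc: "(u, c) \<in> (adj ?F)\<^sup>*" by (auto simp: adj_iff)
  have "(u, v) \<in> (adj ?F)\<^sup>*" if "v \<in> insert c (verts G)" for v
    using that uc mono G(3) assms(2) by (auto simp: conn_def)
  then have "conn (insert c (verts G)) ?F"
    unfolding conn_def by (meson reach_sym rtrancl_trans)
  then show "conn (verts (gr (insert c (verts G)) ?F)) (edges (gr (insert c (verts G)) ?F))" by simp
  have "{u, c} \<notin> edges G" using assms(3) G(1) by (auto dest: simple_graph_edgeD)
  then have "card ?F = card (edges G) + 1" using fin(2) by simp
  moreover have "card (insert c (verts G)) = card (verts G) + 1" using fin(1) assms(3) by simp
  ultimately show "card (edges (gr (insert c (verts G)) ?F)) < card (verts (gr (insert c (verts G)) ?F))"
    using G(4) by simp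
qed simp

lemma strip_tree:
  assumes "is_tree G" "u \<in> verts G" "C \<subseteq> verts G - {u}" "\<And>c. c \<in> C \<Longrightarrow> nbrs G c = {u}"
  shows "is_tree (gr (verts G - C) (edges G - (\<lambda>c. {u, c}) ` C))"
proof (rule conn_card_tree)
  note G = is_treeD[OF assms(1)]
  note fin = simple_graph_finite[OF G(1)]
  let ?D = "(\<lambda>c. {u, c}) ` C"
  let ?F = "edges G - ?D"
  have only: "e = {u, c}" if e: "e \<in> edges G" "c \<in> e" and c: "c \<in> C" for e c
  proof -
    obtain x y where "e = {x, y}" using e by (auto elim: simple_graph_edgeE[OF G(1)])
    then obtain x where "e = {c, x}" using e(2) by (metis insertE insert_commute singletonD)
    then have "x \<in> nbrs G c" using e(1) by (simp add: nbrs_def)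
    then show ?thesis using assms(4)[OF c] \<open>e = {c, x}\<close> by (simp add: insert_commute)
  qed
  have D: "?D \<subseteq> edges G" using assms(4) by (fastforce simp: nbrs_def insert_commute)
  show "verts (gr (verts G - C) ?F) \<noteq> {}" using assms(2,3) by auto
  have "e \<subseteq> verts G - C" if "e \<in> ?F" for e
    using that only G(1) by (fastforce elim!: simple_graph_edgeE)
  then show "simple_graph (gr (verts G - C) ?F)"
    by (intro simple_graph_mono[OF G(1)]) auto
  \<comment> \<open>Retracting the removed leaves to \<open>u\<close> turns every walk of
    \<open>G\<close> into a walk that avoids the removed edges.\<close>
  define f where "f = (\<lambda>x. if x \<in> C then u else x)"
  have "(f x, f y) \<in> (adj ?F)\<^sup>*" if "(x, y) \<in> (adj (edges G))\<^sup>*" for x y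
    using that
  proof induction
    case (step y z)
    have e: "{y, z} \<in> edges G" using step.hyps(2) by (simp add: adj_iff)
    have "(f y, f z) \<in> (adj ?F)\<^sup>*"
    proof (cases "y \<in> C \<or> z \<in> C")
      case True
      then obtain c where c: "c \<in> C" "{y, z} = {u, c}" using only[OF e] by blast
      then have "f y = u" "f z = u" using assms(3) by (auto simp: f_def doubleton_eq_iff)
      then show ?thesis by simp
    next
      case False
      then have "{y, z} \<notin> ?D" by (auto simp: doubleton_eq_iff)
      then show ?thesis using e False by (auto simp: f_def adj_iff)
    qed
    then show ?case using step.IH by simp
  qed simp
  then have "conn (verts G - C) ?F"
    using G(3) unfolding conn_def f_def by fastforce
  then show "conn (verts (gr (verts G - C) ?F)) (edges (gr (verts G - C) ?F))" by simp
  have "inj_on (\<lambda>c. {u, c}) C" by (auto simp: inj_on_def doubleton_eq_iff)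
  then have "card ?D = card C" by (rule card_image)
  moreover have "card C \<le> card (edges G)" using \<open>card ?D = card C\<close> card_mono[OF fin(2) D] by simp
  moreover have "card (verts G - C) = card (verts G) - card C"
    using assms(3) finite_subset[OF _ fin(1)] by (intro card_Diff_subset) blast+
  moreover have "card ?F = card (edges G) - card ?D"
    using D finite_subset[OF D fin(2)] by (intro card_Diff_subset)
  ultimately show "card (edges (gr (verts G - C) ?F)) < card (verts (gr (verts G - C) ?F))"
    using G(4) by simp
qed

text \<open>The first edge of the path that leaves \<open>S\<close> does it: all earlier edges lie
  inside \<open>S\<close>, and the later part of the path does not meet \<open>x\<close>
  again.\<close>

lemma crossing_edge:
  assumes "is_path G u p v" "u \<in> S" "v \<notin> S"
  shows "\<exists>x y. x \<in> S \<and> y \<notin> S \<and> {x, y} \<in> edges G \<and>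
    (u, x) \<in> (adj (edges G - {{x, y}}))\<^sup>* \<and> (y, v) \<in> (adj (edges G - {{x, y}}))\<^sup>*"
  using assms(1,2)
proof (induction p arbitrary: u)
  case (Cons u' p)
  have p: "p \<noteq> []" "{u, hd p} \<in> edges G" "is_path G (hd p) p v" "u \<notin> set p"
    using Cons.prems assms(3) by (auto simp: is_path_Cons split: if_splits)
  show ?case
  proof (cases "hd p \<in> S")
    case True
    then obtain x y where xy: "x \<in> S" "y \<notin> S" "{x, y} \<in> edges G"
      "(hd p, x) \<in> (adj (edges G - {{x, y}}))\<^sup>*" "(y, v) \<in> (adj (edges G - {{x, y}}))\<^sup>*"
      using Cons.IH[OF p(3)] by blast
    moreover have "(u, hd p) \<in> adj (edges G - {{x, y}})"
      using p(2) xy True Cons.prems(2) by (auto simp: adj_iff doubleton_eq_iff)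
    ultimately show ?thesis by (meson converse_rtrancl_into_rtrancl)
  next
    case False
    then show ?thesis
      using is_path_avoid[OF p(3,4), of "{u, hd p}"] p Cons.prems(2) by blast
  qed
qed (simp add: is_path_def)

text \<open>The new edge closes a cycle with the path from \<open>u\<close> to \<open>v\<close>.
  That path leaves \<open>S\<close> somewhere, and the edge where it does so is the one to
  drop.\<close>

lemma exchange_tree:
  assumes G: "is_tree G" and uv: "u \<in> S" "v \<notin> S" "u \<in> verts G" "v \<in> verts G" "{u, v} \<notin> edges G"
  obtains x y where "x \<in> S" "y \<notin> S" "{x, y} \<in> edges G"
    "is_tree (gr (verts G) (insert {u, v} (edges G - {{x, y}})))"
proof -
  note GD = is_treeD[OF G]
  note fin = simple_graph_finite[OF GD(1)]
  obtain p where "is_path G u p v" using G uv(3,4) unfolding is_tree_def by blast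
  then obtain x y where xy: "x \<in> S" "y \<notin> S" "{x, y} \<in> edges G"
    "(u, x) \<in> (adj (edges G - {{x, y}}))\<^sup>*" "(y, v) \<in> (adj (edges G - {{x, y}}))\<^sup>*"
    using crossing_edge[of G u p v S] uv by blast
  let ?F = "insert {u, v} (edges G - {{x, y}})"
  have mono: "(adj (edges G - {{x, y}}))\<^sup>* \<subseteq> (adj ?F)\<^sup>*" by (intro rtrancl_mono adj_mono) auto
  have "(u, v) \<in> adj ?F" by (simp add: adj_iff)
  then have reach: "(x, y) \<in> (adj ?F)\<^sup>*"
    using xy(4,5) mono reach_sym by (meson r_into_rtrancl rtrancl_trans subsetD)
  have conn: "conn (verts G) ?F"
  proof (rule conn_replace[OF GD(3)])
    fix a b assume "{a, b} \<in> edges G - ?F"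
    then have "{a, b} = {x, y}" by blast
    then have "a = x \<and> b = y \<or> a = y \<and> b = x" by (simp only: doubleton_eq_iff)
    then show "(a, b) \<in> (adj ?F)\<^sup>*" using reach reach_sym[OF reach] by blast
  qed
  have "is_tree (gr (verts G) ?F)"
  proof (rule conn_card_tree)
    have "u \<noteq> v" using uv(1,2) by blast
    then have "\<exists>a b. a \<in> verts G \<and> b \<in> verts G \<and> a \<noteq> b \<and> e = {a, b}" if "e \<in> ?F" for e
      using GD(1) uv(3,4) that unfolding simple_graph_def by blast
    then show "simple_graph (gr (verts G) ?F)" using fin by (simp add: simple_graph_def)
    show "card (edges (gr (verts G) ?F)) < card (verts (gr (verts G) ?F))"
      using fin uv(5) GD(4) card.remove[OF fin(2) xy(3)] by simp
  qed (use GD conn in auto)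
  then show ?thesis using that xy by blast
qed

section \<open>Trees as sequences of bundles of leaves\<close>

type_synonym bundles = "(nat \<times> nat list) list"

text \<open>A bundle \<open>(u, cs)\<close> stands for leaves \<open>cs\<close> that are attached to \<open>u\<close>; once they are removed, \<open>u\<close>
  is a leaf. Two vertices joined by an edge remain in the end. All weights are defined by recursion
  along such a sequence, starting with the set \<open>L\<close> of leaves.\<close>

fun wf_bundles :: "nat set \<Rightarrow> bundles \<Rightarrow> bool" where
  "wf_bundles L [] \<longleftrightarrow> card L = 2"
| "wf_bundles L ((u, cs) # E) \<longleftrightarrow> distinct cs \<and> 2 \<le> length cs \<and> set cs \<subseteq> L \<and> u \<notin> L \<and>
     set cs \<inter> fst ` set E = {} \<and> wf_bundles (insert u (L - set cs)) E"

fun bundle_edges :: "nat set \<Rightarrow> bundles \<Rightarrow> nat set set" where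
  "bundle_edges L [] = {L}"
| "bundle_edges L ((u, cs) # E) = (\<lambda>c. {u, c}) ` set cs \<union> bundle_edges (insert u (L - set cs)) E"

definition bundle_graph :: "nat set \<Rightarrow> bundles \<Rightarrow> graph" where
  "bundle_graph L E = gr (L \<union> fst ` set E) (bundle_edges L E)"

text \<open>A leaf in \<open>cs\<close> enters the smaller tree at \<open>u\<close>, and the factor
  for passing \<open>u\<close> is 1 / (deg u - 1) = 1 / \<open>length cs\<close>. If both ends lie
  in \<open>cs\<close>, the path turns round at \<open>u\<close> and meets no other internal vertex.
  The field is arbitrary because the algorithm evaluates weights over the rationals.\<close>

fun path_weight :: "bundles \<Rightarrow> nat \<Rightarrow> nat \<Rightarrow> 'a :: field" where
  "path_weight [] a b = 1"
| "path_weight ((u, cs) # E) a b =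
    (if a \<in> set cs then (if b \<in> set cs then 1 else path_weight E u b) / of_nat (length cs)
     else if b \<in> set cs then path_weight E a u / of_nat (length cs) else path_weight E a b)"

text \<open>Every unordered pair is counted twice, which accounts for the factor 2 of \<pi> that
  \<open>path_weight\<close> omits.\<close>

definition bundle_cost :: "nat set \<Rightarrow> (nat \<Rightarrow> nat \<Rightarrow> 'a) \<Rightarrow> bundles \<Rightarrow> 'a :: field" where
  "bundle_cost L d E = (\<Sum>a\<in>L. \<Sum>b\<in>L - {a}. d a b * path_weight E a b)"

lemma wf_bundles_finite: "wf_bundles L E \<Longrightarrow> finite L"
proof (induction L E rule: wf_bundles.induct)
  case (1 L)
  then show ?case by (metis card.infinite zero_neq_numeral wf_bundles.simps(1))
next
  case (2 L u cs E)
  then have "finite (L - set cs)" by simp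
  then show ?case by simp
qed

lemma wf_bundles_fresh: "wf_bundles L E \<Longrightarrow> L \<inter> fst ` set E = {}"
proof (induction L E rule: wf_bundles.induct)
  case (2 L u cs E)
  then have "insert u (L - set cs) \<inter> fst ` set E = {}" by simp
  moreover have "set cs \<inter> fst ` set E = {}" "u \<notin> L" using 2(2) by simp_all
  ultimately show ?case by (simp only: list.set image_insert fst_conv) blast
qed simp

lemma pendants_tree:
  assumes "is_tree G" "u \<in> verts G" "finite C" "C \<inter> verts G = {}"
  shows "is_tree (gr (C \<union> verts G) ((\<lambda>c. {u, c}) ` C \<union> edges G))"
  using assms(3,4)
proof (induction C)
  case (insert c C)
  then have "is_tree (gr (C \<union> verts G) ((\<lambda>c. {u, c}) ` C \<union> edges G))" by blast
  from pendant_tree[OF this, of u c] show ?case using assms(2) insert by simp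
next
  case empty
  have "gr (verts G) (edges G) = G" by (cases G) simp
  then show ?case using assms(1) by (simp only: image_empty Un_empty_left)
qed

lemma edge_tree:
  assumes "card L = 2"
  shows "is_tree (gr L {L})"
proof -
  obtain a b where L: "L = {a, b}" "a \<noteq> b" using assms by (meson card_2_iff)
  have "is_tree (gr {a} {})" by (rule conn_card_tree) (auto simp: simple_graph_def conn_def)
  from pendant_tree[OF this, of a b] show ?thesis using L by (simp add: insert_commute)
qed

lemma bundle_graph_Cons:
  assumes "wf_bundles L ((u, cs) # E)"
  shows "bundle_graph L ((u, cs) # E) = (let G = bundle_graph (insert u (L - set cs)) E in
      gr (set cs \<union> verts G) ((\<lambda>c. {u, c}) ` set cs \<union> edges G))"
    and "set cs \<inter> verts (bundle_graph (insert u (L - set cs)) E) = {}"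
    and "u \<in> verts (bundle_graph (insert u (L - set cs)) E)"
  using assms by (auto simp: bundle_graph_def Let_def)

lemma bundle_graph_tree: "wf_bundles L E \<Longrightarrow> is_tree (bundle_graph L E)"
proof (induction L E rule: wf_bundles.induct)
  case (1 L)
  then show ?case using edge_tree by (simp add: bundle_graph_def)
next
  case (2 L u cs E)
  then have "is_tree (bundle_graph (insert u (L - set cs)) E)" by simp
  from pendants_tree[OF this bundle_graph_Cons(3)[OF 2(2)] _ bundle_graph_Cons(2)[OF 2(2)]]
  show ?case by (simp add: bundle_graph_Cons(1)[OF 2(2)] Let_def)
qed

lemma nbrs_bundle_Cons:
  assumes wf: "wf_bundles L ((u, cs) # E)"
  defines "G \<equiv> bundle_graph L ((u, cs) # E)" and "G' \<equiv> bundle_graph (insert u (L - set cs)) E"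
  shows "c \<in> set cs \<Longrightarrow> nbrs G c = {u}"
    and "nbrs G u = set cs \<union> nbrs G' u"
    and "v \<notin> set cs \<Longrightarrow> v \<noteq> u \<Longrightarrow> nbrs G v = nbrs G' v"
    and "set cs \<inter> nbrs G' v = {}"
proof -
  have G: "edges G = (\<lambda>c. {u, c}) ` set cs \<union> edges G'"
    using bundle_graph_Cons(1)[OF wf] by (simp add: G_def G'_def Let_def)
  have tree: "is_tree G'" using wf bundle_graph_tree by (simp add: G'_def)
  note sg = is_treeD(1)[OF tree]
  have disj: "set cs \<inter> verts G' = {}" using bundle_graph_Cons(2)[OF wf] by (simp add: G'_def)
  have u: "u \<notin> set cs" using wf by auto
  show none: "set cs \<inter> nbrs G' v = {}" for v using disj nbrs_sub[OF sg, of v] by blast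
  have eq: "nbrs G v = {w. \<exists>c\<in>set cs. {v, w} = {u, c}} \<union> nbrs G' v" for v
    unfolding nbrs_def G by blast
  have iff: "{v, w} = {u, c} \<longleftrightarrow> v = u \<and> w = c \<or> v = c \<and> w = u" for v w c
    by (rule doubleton_eq_iff)
  show "nbrs G c = {u}" if "c \<in> set cs" for c
  proof -
    have "nbrs G' c = {}" using that disj simple_graph_edgeD(1)[OF sg] by (auto simp: nbrs_def)
    then show ?thesis unfolding eq iff using that u by auto
  qed
  show "nbrs G u = set cs \<union> nbrs G' u" unfolding eq iff using u by auto
  show "nbrs G v = nbrs G' v" if "v \<notin> set cs" "v \<noteq> u" for v
    unfolding eq iff using that by auto
qed

text \<open>When its bundle is put back, the centre is a leaf of the smaller tree; its degree thus
  grows from 1 to \<open>length cs + 1\<close>.\<close>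

lemma bundle_graph_degree_aux:
  assumes "wf_bundles L E"
  shows "(\<forall>c\<in>L. vertex_degree (bundle_graph L E) c = 1) \<and>
    (\<forall>(u, cs)\<in>set E. vertex_degree (bundle_graph L E) u = length cs + 1)"
  using assms
proof (induction L E rule: wf_bundles.induct)
  case (1 L)
  then obtain a b where ab: "L = {a, b}" "a \<noteq> b" by (meson card_2_iff wf_bundles.simps(1))
  have sg: "simple_graph (bundle_graph L [])" using is_treeD(1)[OF bundle_graph_tree[OF 1]] .
  have "nbrs (bundle_graph L []) c = L - {c}" if "c \<in> L" for c
    using that ab by (auto simp: nbrs_def bundle_graph_def doubleton_eq_iff)
  moreover have "card (L - {c}) = 1" if "c \<in> L" for c
    using that ab by (simp add: card_Diff_singleton)
  ultimately show ?case by (simp add: vertex_degree_eq_nbrs[OF sg])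
next
  case (2 L v ds E)
  note wf = 2(2)
  have wf': "wf_bundles (insert v (L - set ds)) E" using wf by simp
  note IH = 2(1)[OF wf']
  note sg = is_treeD(1)[OF bundle_graph_tree[OF wf]]
    and sg' = is_treeD(1)[OF bundle_graph_tree[OF wf']]
  note nb = nbrs_bundle_Cons[OF wf]
  let ?G = "bundle_graph L ((v, ds) # E)"
  have same: "vertex_degree ?G x = vertex_degree (bundle_graph (insert v (L - set ds)) E) x"
    if "x \<notin> set ds" "x \<noteq> v" for x
    using that by (simp add: vertex_degree_eq_nbrs[OF sg] vertex_degree_eq_nbrs[OF sg'] nb(3))
  have v: "vertex_degree ?G v = length ds + 1"
    using IH wf nb(4)[of v] finite_nbrs[OF sg', of v]
    by (simp add: vertex_degree_eq_nbrs[OF sg] vertex_degree_eq_nbrs[OF sg'] nb(2) card_Un_disjoint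
        distinct_card)
  have "vertex_degree ?G c = 1" if "c \<in> L" for c
  proof (cases "c \<in> set ds")
    case True
    then show ?thesis by (simp add: vertex_degree_eq_nbrs[OF sg] nb(1))
  next
    case False
    then have "c \<noteq> v" "c \<in> insert v (L - set ds)" using that wf by auto
    then show ?thesis using same[OF False] IH by simp
  qed
  moreover have "vertex_degree ?G u = length cs + 1" if "(u, cs) \<in> set ((v, ds) # E)" for u cs
  proof (cases "(u, cs) = (v, ds)")
    case False
    then have u: "(u, cs) \<in> set E" using that by auto
    then have "u \<in> fst ` set E" by force
    then have "u \<notin> set ds" "u \<noteq> v" using wf wf_bundles_fresh[OF wf'] by auto
    then show ?thesis using same IH u by auto
  qed (use v in simp)
  ultimately show ?case by blast
qed

lemma bundle_graph_degree:
  assumes "wf_bundles L E"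
  shows "c \<in> L \<Longrightarrow> vertex_degree (bundle_graph L E) c = 1"
    and "(u, cs) \<in> set E \<Longrightarrow> vertex_degree (bundle_graph L E) u = length cs + 1"
  using bundle_graph_degree_aux[OF assms] by auto

lemma bundle_length: "wf_bundles L E \<Longrightarrow> (u, cs) \<in> set E \<Longrightarrow> 2 \<le> length cs"
  by (induction L E rule: wf_bundles.induct) auto

lemma leaves_bundle_graph:
  assumes "wf_bundles L E"
  shows "leaves (bundle_graph L E) = L" "internal (bundle_graph L E) = fst ` set E"
proof -
  have "vertex_degree (bundle_graph L E) u \<noteq> 1" if "u \<in> fst ` set E" for u
  proof -
    obtain cs where "(u, cs) \<in> set E" using \<open>u \<in> fst ` set E\<close> by force
    then show ?thesis using bundle_graph_degree(2)[OF assms] bundle_length[OF assms] by fastforce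
  qed
  then show "leaves (bundle_graph L E) = L"
    using bundle_graph_degree(1)[OF assms] by (auto simp: leaves_def bundle_graph_def)
  then show "internal (bundle_graph L E) = fst ` set E"
    using wf_bundles_fresh[OF assms] by (auto simp: internal_def bundle_graph_def)
qed

lemma is_path_mono:
  assumes "is_path G u p v" "verts G \<subseteq> verts H" "edges G \<subseteq> edges H"
  shows "is_path H u p v"
  using assms unfolding is_path_def by (auto intro: successively_mono)

text \<open>Path and weight are built together, by prolonging a path of the smaller tree at
  \<open>u\<close> whenever an end lies in \<open>cs\<close>. The claim
  \<open>set p \<inter> L = {a, b}\<close> belongs to the induction: applied to the smaller leaf
  set, it shows that \<open>u\<close> lies on that path only as an end.\<close>

lemma bundle_path:
  assumes "wf_bundles L E" "a \<in> L" "b \<in> L" "a \<noteq> b"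
  shows "\<exists>p. is_path (bundle_graph L E) a p b \<and> set p \<inter> L = {a, b} \<and>
    (\<Prod>u\<in>set p \<inter> fst ` set E. 1 / (real (vertex_degree (bundle_graph L E) u) - 1)) = path_weight E a b"
  using assms
proof (induction L E arbitrary: a b rule: wf_bundles.induct)
  case (1 L)
  then have "L = {a, b}" by (auto simp: card_2_iff)
  then show ?case using 1
    by (intro exI[of _ "[a, b]"]) (auto simp: is_path_def bundle_graph_def)
next
  case (2 L u cs E)
  note wf = 2(2)
  let ?L' = "insert u (L - set cs)"
  let ?G = "bundle_graph L ((u, cs) # E)" and ?G' = "bundle_graph ?L' E"
  have wf': "wf_bundles ?L' E" using wf by simp
  note IH = 2(1)[OF wf']
  note sg = is_treeD(1)[OF bundle_graph_tree[OF wf]]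
    and sg' = is_treeD(1)[OF bundle_graph_tree[OF wf']]
  note disj = bundle_graph_Cons(2)[OF wf]
  have sub: "verts ?G' \<subseteq> verts ?G" "edges ?G' \<subseteq> edges ?G"
    using bundle_graph_Cons(1)[OF wf] by (auto simp: Let_def)
  have csG: "set cs \<subseteq> verts ?G" and ce: "\<And>c. c \<in> set cs \<Longrightarrow> {u, c} \<in> edges ?G"
    using bundle_graph_Cons(1)[OF wf] by (auto simp: Let_def)
  have deg_u: "real (vertex_degree ?G u) - 1 = length cs"
    using bundle_graph_degree(2)[OF wf, of u cs] by simp
  have fresh: "u \<notin> fst ` set E" "u \<notin> L" using wf_bundles_fresh[OF wf'] wf by auto
  have deg: "vertex_degree ?G x = vertex_degree ?G' x" if "x \<in> fst ` set E" for x
  proof -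
    have "x \<notin> set cs" "x \<noteq> u" using that wf fresh by auto
    then show ?thesis
      by (simp add: vertex_degree_eq_nbrs[OF sg] vertex_degree_eq_nbrs[OF sg'] nbrs_bundle_Cons(3)[OF wf])
  qed
  have via: "(\<Prod>x\<in>insert u (set p \<inter> fst ` set E). 1 / (real (vertex_degree ?G x) - 1)) =
      (\<Prod>x\<in>set p \<inter> fst ` set E. 1 / (real (vertex_degree ?G' x) - 1)) / length cs" for p
  proof -
    have "(\<Prod>x\<in>set p \<inter> fst ` set E. 1 / (real (vertex_degree ?G x) - 1)) =
      (\<Prod>x\<in>set p \<inter> fst ` set E. 1 / (real (vertex_degree ?G' x) - 1))"
      by (rule prod.cong) (auto simp: deg)
    then show ?thesis using fresh by (simp add: deg_u)
  qed
  have avoid: "set p \<inter> set cs = {}" if "is_path ?G' x p y" for x y p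
    using that disj by (auto simp: is_path_def)
  show ?case
  proof (cases "a \<in> set cs")
    case a: True
    show ?thesis
    proof (cases "b \<in> set cs")
      case b: True
      have "is_path ?G a [a, u, b] b"
        using a b 2(5) fresh csG ce[OF a] ce[OF b] wf bundle_graph_Cons(3)[OF wf] sub(1)
        by (auto simp: is_path_def insert_commute)
      moreover have "set [a, u, b] \<inter> L = {a, b}" using 2(3,4) fresh by auto
      moreover have "set [a, u, b] \<inter> fst ` set ((u, cs) # E) = {u}"
        using a b wf by auto
      ultimately show ?thesis using a b deg_u
        by (intro exI[of _ "[a, u, b]"]) (simp only:, simp)
    next
      case b: False
      have "u \<noteq> b" using fresh 2(4) by auto
      then obtain p where p: "is_path ?G' u p b" "set p \<inter> ?L' = {u, b}"
        "(\<Prod>x\<in>set p \<inter> fst ` set E. 1 / (real (vertex_degree ?G' x) - 1)) = path_weight E u b"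
        using IH[of u b] 2(4) b by auto
      have "is_path ?G a (a # p) b"
        unfolding is_path_Cons
        using is_path_mono[OF p(1) sub] avoid[OF p(1)] a csG ce[OF a] p(1)
        by (auto simp: is_path_def insert_commute)
      moreover have "set (a # p) \<inter> L = {a, b}" using p(2) 2(3,4) fresh avoid[OF p(1)] b by auto
      moreover have "set (a # p) \<inter> fst ` set ((u, cs) # E) = insert u (set p \<inter> fst ` set E)"
        using a wf p(2) by auto
      ultimately show ?thesis using a b via[of p] p(3)
        by (intro exI[of _ "a # p"]) simp
    qed
  next
    case a: False
    show ?thesis
    proof (cases "b \<in> set cs")
      case b: True
      have "u \<noteq> a" using fresh 2(3) by auto
      then obtain p where p: "is_path ?G' a p u" "set p \<inter> ?L' = {a, u}"
        "(\<Prod>x\<in>set p \<inter> fst ` set E. 1 / (real (vertex_degree ?G' x) - 1)) = path_weight E a u"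
        using IH[of a u] 2(3) a by auto
      have "is_path ?G a (p @ [b]) b"
        by (rule is_path_snoc[OF is_path_mono[OF p(1) sub] ce[OF b]])
          (use avoid[OF p(1)] b csG in auto)
      moreover have "set (p @ [b]) \<inter> L = {a, b}" using p(2) 2(3,4) fresh avoid[OF p(1)] a by auto
      moreover have "set (p @ [b]) \<inter> fst ` set ((u, cs) # E) = insert u (set p \<inter> fst ` set E)"
        using b wf p(2) by auto
      ultimately show ?thesis using a b via[of p] p(3)
        by (intro exI[of _ "p @ [b]"]) simp
    next
      case b: False
      obtain p where p: "is_path ?G' a p b" "set p \<inter> ?L' = {a, b}"
        "(\<Prod>x\<in>set p \<inter> fst ` set E. 1 / (real (vertex_degree ?G' x) - 1)) = path_weight E a b"
        using IH[of a b] 2(3-5) a b by auto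
      have nu: "u \<notin> set p" using p(2) 2(3,4) fresh by auto
      have "set p \<inter> fst ` set ((u, cs) # E) = set p \<inter> fst ` set E" using nu by auto
      moreover have "(\<Prod>x\<in>set p \<inter> fst ` set E. 1 / (real (vertex_degree ?G x) - 1)) =
        (\<Prod>x\<in>set p \<inter> fst ` set E. 1 / (real (vertex_degree ?G' x) - 1))"
        by (rule prod.cong) (auto simp: deg)
      moreover have "set p \<inter> L = {a, b}" using p(2) nu 2(3,4) avoid[OF p(1)] by auto
      ultimately show ?thesis using a b p(3) is_path_mono[OF p(1) sub]
        by (intro exI[of _ p]) simp
    qed
  qed
qed

lemma tree_weight_bundle_graph:
  assumes "wf_bundles L E" "a \<in> L" "b \<in> L" "a \<noteq> b"
  shows "tree_weight (bundle_graph L E) a b = 2 * path_weight E a b"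
  using bundle_path[OF assms] tree_path_eqI[OF bundle_graph_tree[OF assms(1)]]
  by (auto simp: tree_weight_def leaves_bundle_graph[OF assms(1)])

text \<open>A path with d edges has d - 1 internal vertices, each contributing 1/2, and 2 * (1/2)^(d
  - 1) is 2^(2 - d).\<close>

lemma powi_tree_dist_bundle_graph:
  assumes wf: "wf_bundles L E" and ab: "a \<in> L" "b \<in> L" "a \<noteq> b"
    and cubic: "\<And>u cs. (u, cs) \<in> set E \<Longrightarrow> length cs = 2"
  shows "2 powi (2 - int (tree_dist (bundle_graph L E) a b)) = (2 * path_weight E a b :: real)"
proof -
  let ?G = "bundle_graph L E"
  obtain p where p: "is_path ?G a p b" "set p \<inter> L = {a, b}"
    "(\<Prod>u\<in>set p \<inter> fst ` set E. 1 / (real (vertex_degree ?G u) - 1)) = path_weight E a b"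
    using bundle_path[OF wf ab] by blast
  have "real (vertex_degree ?G u) - 1 = 2" if u: "u \<in> fst ` set E" for u
  proof -
    obtain cs where "(u, cs) \<in> set E" using u by force
    then show ?thesis using bundle_graph_degree(2)[OF wf, of u cs] cubic[of u cs] by simp
  qed
  then have "(\<Prod>u\<in>set p \<inter> fst ` set E. 1 / (real (vertex_degree ?G u) - 1)) =
      (\<Prod>u\<in>set p \<inter> fst ` set E. 1 / 2)"
    by (intro prod.cong) auto
  then have w: "path_weight E a b = (1 / 2 :: real) ^ card (set p \<inter> fst ` set E)" using p(3) by simp
  have "set p = {a, b} \<union> (set p \<inter> fst ` set E)"
    using p(1,2) by (auto simp: is_path_def bundle_graph_def)
  moreover have "{a, b} \<inter> (set p \<inter> fst ` set E) = {}" using ab wf_bundles_fresh[OF wf] by auto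
  ultimately have "card (set p) = 2 + card (set p \<inter> fst ` set E)"
    using ab(3) card_Un_disjoint[of "{a, b}" "set p \<inter> fst ` set E"] by simp
  then have len: "length p = 2 + card (set p \<inter> fst ` set E)"
    using p(1) by (simp add: is_path_def distinct_card)
  then have dist: "tree_dist ?G a b = Suc (card (set p \<inter> fst ` set E))"
    using tree_path_eqI[OF bundle_graph_tree[OF wf] p(1)] by (simp add: tree_dist_def)
  show ?thesis unfolding w dist by (simp add: power_int_diff power_one_over divide_simps)
qed

lemma path_weight_sym: "path_weight E a b = (path_weight E b a :: 'a :: field)"
  by (induction E a b rule: path_weight.induct) auto

lemma of_rat_path_weight: "of_rat (path_weight E a b) = (path_weight E a b :: real)"
  by (induction E a b rule: path_weight.induct) (auto simp: of_rat_divide)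

lemma sum_offdiag:
  fixes f :: "nat \<Rightarrow> nat \<Rightarrow> real"
  assumes "\<And>i j. i \<in> {1..n} \<Longrightarrow> j \<in> {1..n} \<Longrightarrow> f i j = f j i"
  shows "(\<Sum>a\<in>{1..n}. \<Sum>b\<in>{1..n} - {a}. f a b) = (\<Sum>j\<in>{1..n}. \<Sum>i\<in>{1..<j}. 2 * f i j)"
proof -
  have "(\<Sum>a\<in>{1..n}. \<Sum>b\<in>{1..n} - {a}. f a b) =
      (\<Sum>a\<in>{1..n}. (\<Sum>b\<in>{1..<a}. f a b) + (\<Sum>b\<in>{a<..n}. f a b))"
  proof (rule sum.cong[OF refl])
    fix a assume a: "a \<in> {1..n}"
    then have "{1..n} - {a} = {1..<a} \<union> {a<..n}" by auto
    moreover have "sum (f a) ({1..<a} \<union> {a<..n}) = sum (f a) {1..<a} + sum (f a) {a<..n}"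
      by (rule sum.union_disjoint) auto
    ultimately show "(\<Sum>b\<in>{1..n} - {a}. f a b) = (\<Sum>b\<in>{1..<a}. f a b) + (\<Sum>b\<in>{a<..n}. f a b)"
      by simp
  qed
  also have "\<dots> = (\<Sum>a\<in>{1..n}. \<Sum>b\<in>{1..<a}. f a b) + (\<Sum>a\<in>{1..n}. \<Sum>b\<in>{a<..n}. f a b)"
    by (rule sum.distrib)
  also have "(\<Sum>a\<in>{1..n}. \<Sum>b\<in>{a<..n}. f a b) = (\<Sum>b\<in>{1..n}. \<Sum>a\<in>{1..<b}. f a b)"
  proof -
    have "(\<Sum>a\<in>{1..n}. \<Sum>b\<in>{a<..n}. f a b) = (\<Sum>a\<in>{1..n}. \<Sum>b | b \<in> {1..n} \<and> a < b. f a b)"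
      by (intro sum.cong refl) auto
    also have "\<dots> = (\<Sum>b\<in>{1..n}. \<Sum>a | a \<in> {1..n} \<and> a < b. f a b)"
      by (rule sum.swap_restrict) auto
    also have "\<dots> = (\<Sum>b\<in>{1..n}. \<Sum>a\<in>{1..<b}. f a b)"
      by (intro sum.cong refl) auto
    finally show ?thesis .
  qed
  also have "(\<Sum>a\<in>{1..n}. \<Sum>b\<in>{1..<a}. f a b) = (\<Sum>j\<in>{1..n}. \<Sum>i\<in>{1..<j}. f i j)"
    by (intro sum.cong refl) (use assms in auto)
  finally show ?thesis by (simp add: sum_distrib_left[symmetric])
qed

lemma general_cost_bundle_graph:
  assumes "wf_bundles {1..n} E" "bme_instance n \<delta>"
  shows "general_cost n \<delta> (bundle_graph {1..n} E) = bundle_cost {1..n} \<delta> E"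
proof -
  have "general_cost n \<delta> (bundle_graph {1..n} E) =
      (\<Sum>j\<in>{1..n}. \<Sum>i\<in>{1..<j}. 2 * (\<delta> i j * path_weight E i j))"
    unfolding general_cost_def
  proof (intro sum.cong refl)
    fix i j assume "j \<in> {1..n}" "i \<in> {1..<j}"
    then have "tree_weight (bundle_graph {1..n} E) i j = 2 * path_weight E i j"
      by (intro tree_weight_bundle_graph[OF assms(1)]) auto
    then show "\<delta> i j * tree_weight (bundle_graph {1..n} E) i j = 2 * (\<delta> i j * path_weight E i j)"
      by simp
  qed
  also have "\<dots> = bundle_cost {1..n} \<delta> E"
    unfolding bundle_cost_def using assms(2)
    by (intro sum_offdiag[symmetric]) (auto simp: bme_instance_def path_weight_sym)
  finally show ?thesis .
qed

section \<open>Cost bounds\<close>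

definition merge :: "(nat \<Rightarrow> nat \<Rightarrow> real) \<Rightarrow> nat \<Rightarrow> nat set \<Rightarrow> nat \<Rightarrow> nat \<Rightarrow> real" where
  "merge d u C x y = (if x = u then (\<Sum>c\<in>C. d c y) / card C
     else if y = u then (\<Sum>c\<in>C. d x c) / card C else d x y)"

text \<open>For a pair with one end in \<open>cs\<close>, the factor 1 / \<open>length cs\<close>
  depends on neither end; summing over that end gives the average that \<open>merge\<close> assigns
  to \<open>u\<close>. Pairs inside \<open>cs\<close> pass only \<open>u\<close> and form the
  separate first term.\<close>

lemma bundle_cost_Cons:
  assumes wf: "wf_bundles L ((u, cs) # E)"
  shows "bundle_cost L d ((u, cs) # E) = (\<Sum>a\<in>set cs. \<Sum>b\<in>set cs - {a}. d a b) / length cs +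
    bundle_cost (insert u (L - set cs)) (merge d u (set cs)) E"
proof -
  let ?C = "set cs" and ?k = "real (length cs)" and ?w = "path_weight ((u, cs) # E) :: nat \<Rightarrow> nat \<Rightarrow> real"
  define R where "R = L - ?C"
  have fin: "finite R" "finite ?C" using wf_bundles_finite[OF wf] by (auto simp: R_def)
  have L: "L = ?C \<union> R" and disj: "?C \<inter> R = {}" and u: "u \<notin> R" "u \<notin> ?C"
    using wf by (auto simp: R_def)
  have k: "card ?C = length cs" using wf by (simp add: distinct_card)
  have ne: "c \<noteq> r" if "c \<in> ?C" "r \<in> R" for c r using disj that by blast
  have inC: "(\<Sum>b\<in>L - {a}. d a b * ?w a b) = (\<Sum>b\<in>?C - {a}. d a b) / ?k + (\<Sum>b\<in>R. d a b * path_weight E u b) / ?k"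
    if a: "a \<in> ?C" for a
  proof -
    have "L - {a} = (?C - {a}) \<union> R" using L disj a by blast
    moreover have "(?C - {a}) \<inter> R = {}" using disj by blast
    ultimately have "(\<Sum>b\<in>L - {a}. d a b * ?w a b) = (\<Sum>b\<in>?C - {a}. d a b * ?w a b) + (\<Sum>b\<in>R. d a b * ?w a b)"
      using fin by (simp only: sum.union_disjoint finite_Diff)
    also have "(\<Sum>b\<in>?C - {a}. d a b * ?w a b) = (\<Sum>b\<in>?C - {a}. d a b) / ?k"
      unfolding sum_divide_distrib by (rule sum.cong) (use a in auto)
    also have "(\<Sum>b\<in>R. d a b * ?w a b) = (\<Sum>b\<in>R. d a b * path_weight E u b) / ?k"
      unfolding sum_divide_distrib by (rule sum.cong) (use a disj in auto)
    finally show ?thesis .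
  qed
  have inR: "(\<Sum>b\<in>L - {a}. d a b * ?w a b) = (\<Sum>b\<in>?C. d a b) * path_weight E a u / ?k + (\<Sum>b\<in>R - {a}. d a b * path_weight E a b)"
    if a: "a \<in> R" for a
  proof -
    have "L - {a} = ?C \<union> (R - {a})" using L disj a by blast
    moreover have "?C \<inter> (R - {a}) = {}" using disj by blast
    ultimately have "(\<Sum>b\<in>L - {a}. d a b * ?w a b) = (\<Sum>b\<in>?C. d a b * ?w a b) + (\<Sum>b\<in>R - {a}. d a b * ?w a b)"
      using fin by (simp only: sum.union_disjoint finite_Diff)
    also have "(\<Sum>b\<in>?C. d a b * ?w a b) = (\<Sum>b\<in>?C. d a b) * path_weight E a u / ?k"
      unfolding sum_divide_distrib sum_distrib_right by (rule sum.cong) (use ne[OF _ a] in auto)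
    also have "(\<Sum>b\<in>R - {a}. d a b * ?w a b) = (\<Sum>b\<in>R - {a}. d a b * path_weight E a b)"
      by (rule sum.cong) (use ne a disj in auto)
    finally show ?thesis .
  qed
  have "bundle_cost L d ((u, cs) # E) = (\<Sum>a\<in>?C. \<Sum>b\<in>L - {a}. d a b * ?w a b) + (\<Sum>a\<in>R. \<Sum>b\<in>L - {a}. d a b * ?w a b)"
    unfolding bundle_cost_def by (subst (1) L, rule sum.union_disjoint) (use fin disj in auto)
  also have "(\<Sum>a\<in>?C. \<Sum>b\<in>L - {a}. d a b * ?w a b) =
      (\<Sum>a\<in>?C. \<Sum>b\<in>?C - {a}. d a b) / ?k + (\<Sum>a\<in>?C. \<Sum>b\<in>R. d a b * path_weight E u b) / ?k"
    using inC by (simp add: sum.distrib sum_divide_distrib)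
  also have "(\<Sum>a\<in>?C. \<Sum>b\<in>R. d a b * path_weight E u b) = (\<Sum>b\<in>R. (\<Sum>a\<in>?C. d a b) * path_weight E u b)"
    by (subst sum.swap) (simp add: sum_distrib_right)
  also have "(\<Sum>a\<in>R. \<Sum>b\<in>L - {a}. d a b * ?w a b) =
      (\<Sum>a\<in>R. (\<Sum>b\<in>?C. d a b) * path_weight E a u / ?k + (\<Sum>b\<in>R - {a}. d a b * path_weight E a b))"
    using inR by simp
  finally have lhs: "bundle_cost L d ((u, cs) # E) =
      (\<Sum>a\<in>?C. \<Sum>b\<in>?C - {a}. d a b) / ?k + (\<Sum>b\<in>R. (\<Sum>a\<in>?C. d a b) * path_weight E u b) / ?k +
      (\<Sum>a\<in>R. (\<Sum>b\<in>?C. d a b) * path_weight E a u / ?k + (\<Sum>b\<in>R - {a}. d a b * path_weight E a b))" .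
  let ?m = "merge d u ?C"
  have "bundle_cost (insert u R) ?m E = (\<Sum>b\<in>R. ?m u b * path_weight E u b) +
      (\<Sum>a\<in>R. \<Sum>b\<in>insert u R - {a}. ?m a b * path_weight E a b)"
    unfolding bundle_cost_def using fin u by simp
  also have "(\<Sum>b\<in>R. ?m u b * path_weight E u b) = (\<Sum>b\<in>R. (\<Sum>a\<in>?C. d a b) * path_weight E u b) / ?k"
    unfolding sum_divide_distrib by (rule sum.cong) (auto simp: merge_def k)
  also have "(\<Sum>a\<in>R. \<Sum>b\<in>insert u R - {a}. ?m a b * path_weight E a b) =
      (\<Sum>a\<in>R. (\<Sum>b\<in>?C. d a b) * path_weight E a u / ?k + (\<Sum>b\<in>R - {a}. d a b * path_weight E a b))"
  proof (rule sum.cong[OF refl])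
    fix a assume a: "a \<in> R"
    then have "insert u R - {a} = insert u (R - {a})" using u by auto
    then have "(\<Sum>b\<in>insert u R - {a}. ?m a b * path_weight E a b) =
        ?m a u * path_weight E a u + (\<Sum>b\<in>R - {a}. ?m a b * path_weight E a b)"
      using fin u by simp
    also have "(\<Sum>b\<in>R - {a}. ?m a b * path_weight E a b) = (\<Sum>b\<in>R - {a}. d a b * path_weight E a b)"
      by (rule sum.cong) (use u a in \<open>auto simp: merge_def\<close>)
    also have "?m a u * path_weight E a u = (\<Sum>b\<in>?C. d a b) * path_weight E a u / ?k"
      using a u by (auto simp: merge_def k)
    finally show "(\<Sum>b\<in>insert u R - {a}. ?m a b * path_weight E a b) =
      (\<Sum>b\<in>?C. d a b) * path_weight E a u / ?k + (\<Sum>b\<in>R - {a}. d a b * path_weight E a b)" .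
  qed
  finally show ?thesis using lhs by (simp add: R_def)
qed

lemma bundle_cost_Nil:
  assumes "a \<noteq> b"
  shows "bundle_cost {a, b} d [] = d a b + d b a"
proof -
  have "{a, b} - {a} = {b}" "{a, b} - {b} = {a}" using assms by auto
  then show ?thesis using assms by (simp add: bundle_cost_def)
qed

lemma exists_le_average:
  fixes f :: "'a \<Rightarrow> 'b :: linordered_field"
  assumes "finite C" "C \<noteq> {}"
  shows "\<exists>c\<in>C. f c \<le> (\<Sum>c\<in>C. f c) / of_nat (card C)"
proof (rule ccontr)
  assume "\<not> ?thesis"
  then have "(\<Sum>c\<in>C. (\<Sum>c\<in>C. f c) / of_nat (card C)) < (\<Sum>c\<in>C. f c)"
    using assms by (intro sum_strict_mono) auto
  then show False using assms by simp
qed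

text \<open>\<open>P\<close> is a set of pairs and not a tree, since pairs may coincide when they
  are moved away from \<open>u\<close>. Connectivity and the bound on the cardinality survive this,
  and they are all that is needed to recognise a tree later.\<close>

lemma spanning_pairs_le_cost:
  fixes d :: "nat \<Rightarrow> nat \<Rightarrow> real"
  assumes "wf_bundles L E" "\<forall>x\<in>L. \<forall>y\<in>L. x \<noteq> y \<longrightarrow> 0 \<le> d x y \<and> d x y = d y x"
  shows "\<exists>P. finite P \<and> P \<subseteq> {(a, b). a \<in> L \<and> b \<in> L \<and> a \<noteq> b} \<and> card P < card L \<and>
    (\<forall>a\<in>L. \<forall>b\<in>L. (a, b) \<in> (P \<union> P\<inverse>)\<^sup>*) \<and> (\<Sum>(a, b)\<in>P. d a b) \<le> bundle_cost L d E"
  using assms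
proof (induction L E arbitrary: d rule: wf_bundles.induct)
  case (1 L)
  then obtain a b where ab: "L = {a, b}" "a \<noteq> b" by (meson card_2_iff wf_bundles.simps(1))
  then have "0 \<le> d b a" using 1(2)[rule_format, of b a] by simp
  then have "(\<Sum>(a, b)\<in>{(a, b)}. d a b) \<le> bundle_cost L d []"
    unfolding ab(1) bundle_cost_Nil[OF ab(2)] by simp
  moreover have "(a, b) \<in> ({(a, b)} \<union> {(a, b)}\<inverse>)\<^sup>*" "(b, a) \<in> ({(a, b)} \<union> {(a, b)}\<inverse>)\<^sup>*"
    by blast+
  then have "\<forall>x\<in>L. \<forall>y\<in>L. (x, y) \<in> ({(a, b)} \<union> {(a, b)}\<inverse>)\<^sup>*"
    unfolding ab(1) by blast
  moreover have "{(a, b)} \<subseteq> {(a, b). a \<in> L \<and> b \<in> L \<and> a \<noteq> b}" "card {(a, b)} < card L"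
    using ab by simp_all
  ultimately show ?case by (intro exI[of _ "{(a, b)}"]) blast
next
  case (2 L u cs E)
  note wf = 2(2) and d = 2(3)[rule_format]
  let ?C = "set cs"
  define R where "R = L - ?C"
  have fin: "finite L" "finite R" using wf_bundles_finite[OF wf] by (auto simp: R_def)
  have CL: "?C \<subseteq> L" and u: "u \<notin> L" and k: "card ?C = length cs" "2 \<le> length cs"
    and wf': "wf_bundles (insert u R) E"
    using wf by (auto simp: R_def distinct_card)
  have Cne: "?C \<noteq> {}" using k(2) by (cases cs) auto
  have CR: "?C \<inter> R = {}" "L = ?C \<union> R" "u \<notin> R" "u \<notin> ?C" using CL u by (auto simp: R_def)
  let ?m = "merge d u ?C"
  have avg: "(\<Sum>c\<in>?C. d y c) = (\<Sum>c\<in>?C. d c y)" "0 \<le> (\<Sum>c\<in>?C. d c y)" if "y \<in> R" for y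
  proof -
    have dy: "0 \<le> d c y" "d c y = d y c" if "c \<in> ?C" for c
      using d[of c y] CL CR \<open>y \<in> R\<close> that by blast+
    show "(\<Sum>c\<in>?C. d y c) = (\<Sum>c\<in>?C. d c y)" by (rule sum.cong) (use dy(2) in auto)
    show "0 \<le> (\<Sum>c\<in>?C. d c y)" by (rule sum_nonneg) (rule dy(1))
  qed
  have "0 \<le> ?m x y \<and> ?m x y = ?m y x" if "x \<in> insert u R" "y \<in> insert u R" "x \<noteq> y" for x y
    using that avg[of x] avg[of y] d[of x y] CR by (auto simp: merge_def)
  then have m: "\<forall>x\<in>insert u R. \<forall>y\<in>insert u R. x \<noteq> y \<longrightarrow> 0 \<le> ?m x y \<and> ?m x y = ?m y x" by blast
  from 2(1)[of ?m, folded R_def, OF wf' m]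
  obtain P where P: "finite P" "P \<subseteq> {(a, b). a \<in> insert u R \<and> b \<in> insert u R \<and> a \<noteq> b}"
    "card P < card (insert u R)"
    "\<forall>a\<in>insert u R. \<forall>b\<in>insert u R. (a, b) \<in> (P \<union> P\<inverse>)\<^sup>*"
    "(\<Sum>(a, b)\<in>P. ?m a b) \<le> bundle_cost (insert u R) ?m E"
    by (elim exE conjE) (rule that)
  \<comment> \<open>\<open>h y\<close> is the vertex of the bundle to which a pair of
    \<open>u\<close> and \<open>y\<close> is moved; its distance to \<open>y\<close> is at most the
    merged one.\<close>
  have "\<exists>c\<in>?C. d c y \<le> (\<Sum>c\<in>?C. d c y) / card ?C" for y
    using Cne by (intro exists_le_average) auto
  then obtain h where h: "\<And>y. h y \<in> ?C \<and> d (h y) y \<le> (\<Sum>c\<in>?C. d c y) / card ?C" by metis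
  \<comment> \<open>The star on the bundle is centred at a \<open>z\<close> of at most average star
    cost, and this average is exactly the first term of \<open>bundle_cost_Cons\<close>.\<close>
  have "\<exists>c\<in>?C. (\<Sum>b\<in>?C - {c}. d c b) \<le> (\<Sum>c\<in>?C. \<Sum>b\<in>?C - {c}. d c b) / card ?C"
    using Cne by (intro exists_le_average) auto
  then obtain z where z: "z \<in> ?C"
    "(\<Sum>b\<in>?C - {z}. d z b) \<le> (\<Sum>c\<in>?C. \<Sum>b\<in>?C - {c}. d c b) / card ?C" by blast
  define g where "g = (\<lambda>(x, y). if x = u then (h y, y) else if y = u then (x, h x) else (x, y))"
  have g_eq: "g (x, y) = (if x = u then (h y, y) else if y = u then (x, h x) else (x, y))" for x y
    by (simp add: g_def)
  define S where "S = Pair z ` (?C - {z})"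
  let ?P = "g ` P \<union> S"
  let ?r = "(?P \<union> ?P\<inverse>)\<^sup>*"
  have gle: "d (fst (g p)) (snd (g p)) \<le> ?m (fst p) (snd p)" if "p \<in> P" for p
  proof -
    obtain x y where p: "p = (x, y)" by (cases p)
    then have xy: "x \<in> insert u R" "y \<in> insert u R" "x \<noteq> y" using P(2) that by auto
    show ?thesis
    proof (cases "x = u \<or> y \<noteq> u")
      case True
      then show ?thesis using h[of y] by (auto simp: p g_def merge_def)
    next
      case False
      then have xR: "x \<in> R" using xy by auto
      moreover have "h x \<in> ?C" using h by blast
      ultimately have "x \<in> L" "h x \<in> L" "x \<noteq> h x" using CR(1,2) by auto
      then have "d x (h x) = d (h x) x" using d[of x "h x"] by simp
      then show ?thesis using h[of x] avg(1)[OF xR] False by (simp add: p g_def merge_def)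
    qed
  qed
  have "finite ?P" using P(1) by (simp add: S_def)
  moreover have subP: "?P \<subseteq> {(a, b). a \<in> L \<and> b \<in> L \<and> a \<noteq> b}"
  proof -
    have gin: "g (x, y) \<in> {(a, b). a \<in> L \<and> b \<in> L \<and> a \<noteq> b}" if "(x, y) \<in> P" for x y
    proof -
      have xy: "x \<in> insert u R" "y \<in> insert u R" "x \<noteq> y" using P(2) that by auto
      have "h x \<in> ?C" "h y \<in> ?C" using h by blast+
      then show ?thesis using xy CR by (auto simp: g_def)
    qed
    have "g ` P \<subseteq> {(a, b). a \<in> L \<and> b \<in> L \<and> a \<noteq> b}"
    proof (rule image_subsetI)
      fix p assume "p \<in> P"
      then show "g p \<in> {(a, b). a \<in> L \<and> b \<in> L \<and> a \<noteq> b}" using gin[of "fst p" "snd p"] by simp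
    qed
    moreover have "S \<subseteq> {(a, b). a \<in> L \<and> b \<in> L \<and> a \<noteq> b}" using z(1) CL by (auto simp: S_def)
    ultimately show ?thesis by (rule Un_least)
  qed
  moreover have "card ?P < card L"
  proof -
    \<comment> \<open>At most \<open>card R\<close> moved pairs and \<open>length cs - 1\<close>
      pairs of the star make fewer than \<open>card L\<close>, which is
      \<open>length cs + card R\<close>.\<close>
    have "card S = length cs - 1" using z(1) k by (simp add: S_def card_image inj_on_def)
    moreover have "card ?P \<le> card (g ` P) + card S" by (rule card_Un_le)
    moreover have "card (g ` P) \<le> card P" using P(1) by (rule card_image_le)
    moreover have "card (insert u R) = card R + 1" using fin CR by simp
    moreover have "card L = length cs + card R"
      using card_Un_disjoint[of ?C R] CR fin k by simp
    ultimately show ?thesis using P(3) k by linarith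
  qed
  moreover have "(a, b) \<in> ?r" if "a \<in> L" "b \<in> L" for a b
  proof -
    have sym: "(y, x) \<in> ?r" if "(x, y) \<in> ?r" for x y
      using that sym_rtrancl[of "?P \<union> ?P\<inverse>"] by (auto simp: sym_Un_converse dest: symD)
    have star: "(z, c) \<in> ?r" if "c \<in> ?C" for c
    proof (cases "c = z")
      case False
      then have "(z, c) \<in> S" using that by (simp add: S_def)
      then show ?thesis by blast
    qed simp
    \<comment> \<open>Connections of the smaller instance are lifted with the star centre
      \<open>z\<close> standing for \<open>u\<close>; the star leads from \<open>z\<close> to
      whichever leaf a pair was moved to.\<close>
    define rep where "rep = (\<lambda>x. if x = u then z else x)"
    have edge: "(rep x, rep y) \<in> ?r" if "(x, y) \<in> P" for x y
    proof -
      have xy: "x \<in> insert u R" "y \<in> insert u R" "x \<noteq> y" using P(2) that by auto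
      have gP: "g (x, y) \<in> ?P" using that by blast
      have hz: "(z, h v) \<in> ?r" for v using star h by blast
      consider "x = u" | "x \<noteq> u" "y = u" | "x \<noteq> u" "y \<noteq> u" by blast
      then show ?thesis
      proof cases
        case 1
        then have "(h y, y) \<in> ?P" using gP by (simp add: g_eq)
        then have "(h y, y) \<in> ?r" by blast
        then show ?thesis using 1 xy(3) hz[of y] by (simp add: rep_def)
      next
        case 2
        then have "(x, h x) \<in> ?P" using gP by (simp add: g_eq)
        then have "(x, h x) \<in> ?r" by blast
        then show ?thesis using 2 sym[OF hz[of x]] by (simp add: rep_def)
      next
        case 3
        then have "(x, y) \<in> ?P" using gP by (simp add: g_eq)
        then have "(x, y) \<in> ?r" by blast
        then show ?thesis using 3 by (simp add: rep_def)
      qed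
    qed
    have reach: "(rep x, rep y) \<in> ?r" if "(x, y) \<in> (P \<union> P\<inverse>)\<^sup>*" for x y
      using that
    proof induction
      case (step y v)
      then have "(rep y, rep v) \<in> ?r" using edge[of y v] sym[OF edge[of v y]] by blast
      then show ?case using step.IH by simp
    qed simp
    have to_u: "(a, z) \<in> ?r" if "a \<in> L" for a
    proof (cases "a \<in> ?C")
      case True
      then show ?thesis using sym[OF star] by blast
    next
      case False
      then have "a \<in> R" using that by (simp add: R_def)
      moreover have "a \<noteq> u" using \<open>a \<in> R\<close> CR(3) by blast
      ultimately show ?thesis using reach[OF P(4)[rule_format, of a u]] by (simp add: rep_def)
    qed
    show ?thesis using to_u[OF that(1)] sym[OF to_u[OF that(2)]] by simp
  qed
  moreover have "(\<Sum>(a, b)\<in>?P. d a b) \<le> bundle_cost L d ((u, cs) # E)"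
  proof -
    let ?f = "\<lambda>p. d (fst p) (snd p)"
    have nonneg: "0 \<le> ?f p" if "p \<in> ?P" for p
    proof -
      have "p \<in> {(a, b). a \<in> L \<and> b \<in> L \<and> a \<noteq> b}" using subP that by (rule subsetD)
      then show ?thesis using d[of "fst p" "snd p"] by (simp add: case_prod_beta)
    qed
    \<comment> \<open>Pairs that coincide after the move are paid once only; as costs are
      nonnegative, this cannot raise the sum.\<close>
    have "sum ?f ?P \<le> sum ?f (g ` P) + sum ?f S"
    proof -
      have "sum ?f ?P = sum ?f (g ` P) + sum ?f S - sum ?f (g ` P \<inter> S)"
        using P(1) by (intro sum_Un) (auto simp: S_def)
      moreover have "0 \<le> sum ?f (g ` P \<inter> S)" using nonneg by (intro sum_nonneg) blast
      ultimately show ?thesis by simp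
    qed
    moreover have "sum ?f (g ` P) \<le> sum (?f \<circ> g) P"
      using P(1) nonneg by (intro sum_image_le) auto
    moreover have "sum (?f \<circ> g) P \<le> (\<Sum>p\<in>P. ?m (fst p) (snd p))"
      using gle by (intro sum_mono) simp
    moreover have "sum ?f S = (\<Sum>b\<in>?C - {z}. d z b)"
      unfolding S_def by (subst sum.reindex) (auto simp: inj_on_def)
    ultimately show ?thesis
      using P(5) z(2) bundle_cost_Cons[OF wf, of d] k by (simp add: case_prod_beta R_def)
  qed
  ultimately show ?case by (intro exI[of _ ?P] conjI ballI)
qed

text \<open>\<open>o' x\<close> bounds the mean distance travelled inside the part already merged
  into \<open>x\<close>. By the triangle inequality for \<open>\<Delta>\<close>, the merged distance
  between \<open>u\<close> and \<open>y\<close> exceeds \<open>\<Delta> u y + o' y\<close> by at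
  most the average of \<open>o' c + \<Delta> u c\<close> over the bundle, and this average becomes
  the offset of \<open>u\<close>. It is used with all offsets 0.\<close>

lemma cost_le_offsets:
  fixes d \<Delta> :: "nat \<Rightarrow> nat \<Rightarrow> real"
  assumes "wf_bundles L E"
    and \<Delta>: "\<And>x y. \<Delta> x y = \<Delta> y x" "\<And>x y z. \<Delta> x z \<le> \<Delta> x y + \<Delta> y z"
    and "\<And>x y. x \<in> L \<Longrightarrow> y \<in> L \<Longrightarrow> x \<noteq> y \<Longrightarrow> d x y \<le> o' x + o' y + \<Delta> x y"
  shows "bundle_cost L d E \<le> 2 * sum o' L + 2 * (\<Sum>e\<in>bundle_edges L E. \<Delta> (Min e) (Max e))"
  using assms(1,4)
proof (induction L E arbitrary: d o' rule: wf_bundles.induct)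
  case (1 L)
  then obtain a b where ab: "L = {a, b}" "a \<noteq> b" by (meson card_2_iff wf_bundles.simps(1))
  have "\<Delta> (min a b) (max a b) = \<Delta> a b" using \<Delta>(1) by (simp add: min_def max_def)
  then show ?case using ab 1(2)[of a b] 1(2)[of b a] \<Delta>(1)[of b a] by (simp add: bundle_cost_Nil)
next
  case (2 L u cs E)
  note wf = 2(2) and d = 2(3)
  let ?C = "set cs" and ?k = "real (length cs)"
  define R where "R = L - ?C"
  have fin: "finite L" "finite R" using wf_bundles_finite[OF wf] by (auto simp: R_def)
  have CL: "?C \<subseteq> L" and u: "u \<notin> L" and k: "card ?C = length cs" "2 \<le> length cs"
    and wf': "wf_bundles (insert u R) E"
    using wf by (auto simp: R_def distinct_card)
  have CR: "?C \<inter> R = {}" "L = ?C \<union> R" "u \<notin> R" "u \<notin> ?C" using CL u by (auto simp: R_def)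
  have k0: "?k > 0" using k(2) by linarith
  let ?m = "merge d u ?C"
  \<comment> \<open>The sum of the offsets of the bundle after its edges to \<open>u\<close> have
    been added to them; \<open>q\<close> gives \<open>u\<close> the average
    \<open>s / ?k\<close>.\<close>
  define s where "s = (\<Sum>c\<in>?C. o' c + \<Delta> u c)"
  define q where "q = (\<lambda>x. if x = u then s / ?k else o' x)"
  have mu: "(\<Sum>c\<in>?C. f c) / ?k \<le> s / ?k + o' y + \<Delta> u y"
    if f: "\<And>c. c \<in> ?C \<Longrightarrow> f c \<le> o' c + o' y + \<Delta> c y" for f y
  proof -
    have "(\<Sum>c\<in>?C. f c) \<le> (\<Sum>c\<in>?C. (o' c + \<Delta> u c) + (o' y + \<Delta> u y))"
    proof (rule sum_mono)
      fix c assume "c \<in> ?C"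
      then show "f c \<le> (o' c + \<Delta> u c) + (o' y + \<Delta> u y)"
        using f[of c] \<Delta>(2)[of c y u] \<Delta>(1)[of c u] by simp
    qed
    also have "\<dots> = s + ?k * (o' y + \<Delta> u y)"
      unfolding s_def sum.distrib[of _ "\<lambda>_. o' y + \<Delta> u y"] using k(1) by simp
    finally show ?thesis using k0 by (simp add: field_simps)
  qed
  have "?m x y \<le> q x + q y + \<Delta> x y" if xy: "x \<in> insert u R" "y \<in> insert u R" "x \<noteq> y" for x y
  proof -
    have inL: "d c y \<le> o' c + o' y + \<Delta> c y" "d y c \<le> o' c + o' y + \<Delta> c y" if "c \<in> ?C" "y \<in> R" for c y
    proof -
      have "c \<noteq> y" "c \<in> L" "y \<in> L" using that CR by auto
      then show "d c y \<le> o' c + o' y + \<Delta> c y" "d y c \<le> o' c + o' y + \<Delta> c y"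
        using d[of c y] d[of y c] \<Delta>(1)[of y c] by simp_all
    qed
    consider "x = u" "y \<in> R" | "x \<in> R" "y = u" | "x \<in> R" "y \<in> R" using xy by blast
    then show ?thesis
    proof cases
      case 1
      then show ?thesis using mu[of "\<lambda>c. d c y" y] inL(1) CR k by (auto simp: merge_def q_def)
    next
      case 2
      then have "x \<noteq> u" using CR by blast
      then show ?thesis using mu[of "\<lambda>c. d x c" x] inL(2) 2 k \<Delta>(1)[of x u] by (auto simp: merge_def q_def)
    next
      case 3
      then have "x \<noteq> u" "y \<noteq> u" using CR by blast+
      then show ?thesis using d[of x y] 3 CR xy(3) by (auto simp: merge_def q_def)
    qed
  qed
  then have IH: "bundle_cost (insert u R) ?m E \<le> 2 * sum q (insert u R) +
      2 * (\<Sum>e\<in>bundle_edges (insert u R) E. \<Delta> (Min e) (Max e))"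
    by (rule 2(1)[of ?m q, folded R_def, OF wf'])
  have "sum q R = sum o' R" by (rule sum.cong) (use CR in \<open>auto simp: q_def\<close>)
  then have q: "sum q (insert u R) = s / ?k + sum o' R" using fin CR by (simp add: q_def)
  have "(\<Sum>a\<in>?C. \<Sum>b\<in>?C - {a}. d a b) \<le>
      (\<Sum>a\<in>?C. \<Sum>b\<in>?C - {a}. (o' a + \<Delta> u a) + (o' b + \<Delta> u b))"
  proof (intro sum_mono)
    fix a b assume "a \<in> ?C" "b \<in> ?C - {a}"
    then show "d a b \<le> (o' a + \<Delta> u a) + (o' b + \<Delta> u b)"
      using d[of a b] CR \<Delta>(2)[of a b u] \<Delta>(1)[of a u] by auto
  qed
  also have "\<dots> = 2 * (?k - 1) * s"
  proof -
    have "(\<Sum>b\<in>?C - {a}. (o' a + \<Delta> u a) + (o' b + \<Delta> u b)) =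
        (?k - 2) * (o' a + \<Delta> u a) + s" if a: "a \<in> ?C" for a
    proof -
      have "(\<Sum>b\<in>?C - {a}. (o' a + \<Delta> u a) + (o' b + \<Delta> u b)) =
        real (card (?C - {a})) * (o' a + \<Delta> u a) + (\<Sum>b\<in>?C - {a}. o' b + \<Delta> u b)"
        by (subst sum.distrib) simp
      also have "(\<Sum>b\<in>?C - {a}. o' b + \<Delta> u b) = s - (o' a + \<Delta> u a)"
        unfolding s_def using a by (simp add: sum_diff1)
      also have "real (card (?C - {a})) = ?k - 1" using a k by (simp add: of_nat_diff)
      finally show ?thesis by (simp add: algebra_simps)
    qed
    then have "(\<Sum>a\<in>?C. \<Sum>b\<in>?C - {a}. (o' a + \<Delta> u a) + (o' b + \<Delta> u b)) =
        (\<Sum>a\<in>?C. (?k - 2) * (o' a + \<Delta> u a) + s)" by (rule sum.cong[OF refl])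
    also have "\<dots> = (\<Sum>a\<in>?C. (?k - 2) * (o' a + \<Delta> u a)) + (\<Sum>a\<in>?C. s)"
      by (rule sum.distrib)
    also have "(\<Sum>a\<in>?C. (?k - 2) * (o' a + \<Delta> u a)) = (?k - 2) * s"
      unfolding s_def by (rule sum_distrib_left[symmetric])
    also have "(\<Sum>a\<in>?C. s) = ?k * s" by (simp add: k(1))
    finally show ?thesis by (simp add: algebra_simps)
  qed
  \<comment> \<open>The new offset of \<open>u\<close> contributes 2 * (s / k) through the induction
    hypothesis. Both together are exactly 2 * s: the old offsets and the edges of the bundle, each
    counted twice.\<close>
  finally have star: "(\<Sum>a\<in>?C. \<Sum>b\<in>?C - {a}. d a b) / ?k \<le> 2 * s - 2 * (s / ?k)"
    using k0 by (simp add: field_simps)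
  have edges: "(\<Sum>e\<in>bundle_edges L ((u, cs) # E). \<Delta> (Min e) (Max e)) =
      (\<Sum>c\<in>?C. \<Delta> u c) + (\<Sum>e\<in>bundle_edges (insert u R) E. \<Delta> (Min e) (Max e))"
  proof -
    let ?G = "bundle_graph (insert u R) E"
    note sg = is_treeD(1)[OF bundle_graph_tree[OF wf']]
    have E: "edges ?G = bundle_edges (insert u R) E" by (simp add: bundle_graph_def)
    have "e \<notin> (\<lambda>c. {u, c}) ` ?C" if "e \<in> edges ?G" for e
      using bundle_graph_Cons(2)[OF wf] that simple_graph_edgeD(2)[OF sg] unfolding R_def by blast
    then have disj: "(\<lambda>c. {u, c}) ` ?C \<inter> bundle_edges (insert u R) E = {}" using E by blast
    have "(\<Sum>e\<in>(\<lambda>c. {u, c}) ` ?C. \<Delta> (Min e) (Max e)) = (\<Sum>c\<in>?C. \<Delta> u c)"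
    proof (subst sum.reindex)
      show "inj_on (\<lambda>c. {u, c}) ?C" by (auto simp: inj_on_def doubleton_eq_iff)
      have "\<Delta> (min u c) (max u c) = \<Delta> u c" for c using \<Delta>(1) by (simp add: min_def max_def)
      then show "(\<Sum>c\<in>?C. ((\<lambda>e. \<Delta> (Min e) (Max e)) \<circ> (\<lambda>c. {u, c})) c) = (\<Sum>c\<in>?C. \<Delta> u c)" by simp
    qed
    moreover have "finite (bundle_edges (insert u R) E)" using simple_graph_finite(2)[OF sg] E by simp
    ultimately show ?thesis using disj by (simp add: sum.union_disjoint R_def)
  qed
  have sL: "sum o' L = sum o' ?C + sum o' R" using CR fin by (simp add: sum.union_disjoint)
  have s: "s = sum o' ?C + (\<Sum>c\<in>?C. \<Delta> u c)" by (simp add: s_def sum.distrib)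
  show ?case
    using IH star bundle_cost_Cons[OF wf, of d] unfolding edges q sL R_def[symmetric] using s by simp
qed

section \<open>Splitting bundles\<close>

text \<open>The bundle of \<open>r\<close> comes first, since \<open>r\<close> must already be a
  leaf when the bundle of \<open>u\<close> is removed.\<close>

definition split_bundle :: "nat \<Rightarrow> nat \<Rightarrow> nat \<times> nat list \<Rightarrow> bundles" where
  "split_bundle r q ucs = [(r, filter (\<lambda>c. c \<noteq> q) (snd ucs)), (fst ucs, [q, r])]"

lemma length_filter_neq:
  assumes "distinct cs" "q \<in> set cs"
  shows "length (filter (\<lambda>c. c \<noteq> q) cs) = length cs - 1"
proof -
  have "length (filter (\<lambda>c. c \<noteq> q) cs) = card (set cs - {q})"
    using distinct_card[OF distinct_filter[OF assms(1)], of "\<lambda>c. c \<noteq> q"] by (simp add: set_diff_eq)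
  then show ?thesis using assms by (simp add: distinct_card)
qed

lemma sum_if_eq:
  fixes A B :: "'a :: field_char_0"
  assumes "finite C" "a \<in> C"
  shows "(\<Sum>q\<in>C. if q = a then A else B) = A + (of_nat (card C) - 1) * B"
proof -
  have "(\<Sum>q\<in>C. if q = a then A else B) = A + (\<Sum>q\<in>C - {a}. if q = a then A else B)"
    using sum.remove[OF assms, of "\<lambda>q. if q = a then A else B"] by simp
  also have "(\<Sum>q\<in>C - {a}. if q = a then A else B) = (\<Sum>q\<in>C - {a}. B)"
    by (rule sum.cong) auto
  also have "\<dots> = (of_nat (card C) - 1) * B"
    using assms card_gt_0_iff[of C] by (auto simp: card_Diff_singleton of_nat_diff Suc_le_eq)
  finally show ?thesis .
qed

text \<open>Detaching a uniformly random child \<open>q\<close> of \<open>u\<close> from its siblings, which are joined at a new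
  vertex \<open>r\<close>, preserves every path weight on average.\<close>

lemma sum_path_weight_split_head:
  assumes wf: "wf_bundles L ((u, cs) # E)" and len: "2 < length cs"
    and r: "r \<notin> L" "r \<noteq> u" and ab: "a \<in> L" "b \<in> L" "a \<noteq> b"
  shows "(\<Sum>q\<in>set cs. path_weight (split_bundle r q (u, cs) @ E) a b :: 'a :: linordered_field) =
    of_nat (length cs) * path_weight ((u, cs) # E) a b"
proof -
  let ?C = "set cs" and ?k = "of_nat (length cs) :: 'a"
  let ?W = "\<lambda>q. path_weight (split_bundle r q (u, cs) @ E) a b :: 'a"
  have dist: "distinct cs" and CL: "?C \<subseteq> L" and u: "u \<notin> L" using wf by auto
  have k: "card ?C = length cs" using dist by (simp add: distinct_card)
  have k1: "of_nat (length cs - 1) = ?k - 1" using len by (simp add: of_nat_diff)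
  have kpos: "?k > 2" using len by (metis of_nat_less_iff of_nat_numeral)
  have cne: "cs \<noteq> []" using len by auto
  have rC: "r \<notin> ?C" and rab: "r \<noteq> a" "r \<noteq> b" using r ab CL by auto
  have W: "?W q = (if a \<in> ?C \<and> a \<noteq> q then (if b \<in> ?C \<and> b \<noteq> q then 1 else path_weight ((u, [q, r]) # E) r b) / (?k - 1)
     else if b \<in> ?C \<and> b \<noteq> q then path_weight ((u, [q, r]) # E) a r / (?k - 1)
     else path_weight ((u, [q, r]) # E) a b)" if "q \<in> ?C" for q
    using length_filter_neq[OF dist that] k1 by (simp add: split_bundle_def)
  consider "a \<notin> ?C" "b \<notin> ?C" | "a \<in> ?C" "b \<notin> ?C" | "a \<notin> ?C" "b \<in> ?C" | "a \<in> ?C" "b \<in> ?C" by blast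
  then show ?thesis
  proof cases
    case 1
    have "sum ?W ?C = (\<Sum>q\<in>?C. path_weight E a b)"
      by (rule sum.cong) (use 1 W rab in auto)
    then show ?thesis using 1 k by simp
  next
    case 2
    let ?X = "path_weight E u b :: 'a"
    \<comment> \<open>The detached child \<open>a\<close> passes \<open>u\<close> only, with factor
      1/2; for each of the k - 1 other choices of \<open>q\<close>, the path also passes
      \<open>r\<close>, with factor 1/(k - 1).\<close>
    have "sum ?W ?C = (\<Sum>q\<in>?C. if q = a then ?X / 2 else ?X / 2 / (?k - 1))"
      by (rule sum.cong) (use 2 W rab rC in auto)
    also have "\<dots> = ?X / 2 + (?k - 1) * (?X / 2 / (?k - 1))"
      using sum_if_eq[of ?C a "?X / 2" "?X / 2 / (?k - 1)"] 2 by (simp add: k)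
    also have "\<dots> = ?X" using kpos by (simp add: field_simps)
    finally show ?thesis using 2 cne by simp
  next
    case 3
    let ?X = "path_weight E a u :: 'a"
    have "sum ?W ?C = (\<Sum>q\<in>?C. if q = b then ?X / 2 else ?X / 2 / (?k - 1))"
      by (rule sum.cong) (use 3 W rab rC in auto)
    also have "\<dots> = ?X / 2 + (?k - 1) * (?X / 2 / (?k - 1))"
      using sum_if_eq[of ?C b "?X / 2" "?X / 2 / (?k - 1)"] 3 by (simp add: k)
    also have "\<dots> = ?X" using kpos by (simp add: field_simps)
    finally show ?thesis using 3 cne by simp
  next
    case 4
    \<comment> \<open>For \<open>q\<close> equal to \<open>a\<close> or \<open>b\<close> the path
      passes both \<open>r\<close> and \<open>u\<close> and has weight 1/(2(k - 1)). For the other k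
      - 2 choices it passes only \<open>r\<close> and has weight 1/(k - 1). The sum is 1.\<close>
    have "sum ?W ?C = ?W a + sum ?W (?C - {a})" using sum.remove[of ?C a ?W] 4 by simp
    also have "sum ?W (?C - {a}) = (\<Sum>q\<in>?C - {a}. if q = b then 1 / 2 / (?k - 1) else 1 / (?k - 1))"
      by (rule sum.cong) (use 4 W rab rC ab(3) in auto)
    also have "\<dots> = 1 / 2 / (?k - 1) + (?k - 2) * (1 / (?k - 1))"
      using sum_if_eq[of "?C - {a}" b "1 / 2 / (?k - 1)" "1 / (?k - 1)"] 4 ab(3) k k1 by simp
    also have "?W a = 1 / 2 / (?k - 1)" using 4 W[of a] ab(3) rab by simp
    also have "1 / 2 / (?k - 1) + (1 / 2 / (?k - 1) + (?k - 2) * (1 / (?k - 1))) =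
        (1 / 2 + (1 / 2 + (?k - 2))) / (?k - 1)"
      by (simp only: add_divide_distrib times_divide_eq_right mult_1_right)
    also have "1 / 2 + (1 / 2 + (?k - 2)) = ?k - 1" by simp
    also have "(?k - 1) / (?k - 1) = 1" using kpos by simp
    finally show ?thesis using 4 cne by simp
  qed
qed

text \<open>Earlier bundles contribute the same factor for every \<open>q\<close>, so the identity
  for the head carries over.\<close>

lemma sum_path_weight_split:
  assumes "wf_bundles L (pre @ (u, cs) # post)" and len: "2 < length cs"
    and "r \<notin> L" "r \<notin> fst ` set (pre @ (u, cs) # post)" "a \<in> L" "b \<in> L" "a \<noteq> b"
  shows "(\<Sum>q\<in>set cs. path_weight (pre @ split_bundle r q (u, cs) @ post) a b :: 'a :: linordered_field) =
    of_nat (length cs) * path_weight (pre @ (u, cs) # post) a b"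
  using assms(1,3-)
proof (induction pre arbitrary: L a b)
  case Nil
  then show ?case using sum_path_weight_split_head[of L u cs post r a b] len by simp
next
  case (Cons e pre)
  obtain v ds where e: "e = (v, ds)" by (cases e)
  let ?L' = "insert v (L - set ds)"
  let ?s = "\<lambda>a b. (\<Sum>q\<in>set cs. path_weight (pre @ split_bundle r q (u, cs) @ post) a b :: 'a)"
  have wf': "wf_bundles ?L' (pre @ (u, cs) # post)" and v: "v \<notin> L" using Cons.prems(1) e by auto
  have r: "r \<notin> ?L'" "r \<notin> fst ` set (pre @ (u, cs) # post)" using Cons.prems e by auto
  note IH = Cons.IH[OF wf' r]
  have ne: "v \<noteq> a" "v \<noteq> b" using Cons.prems v by auto
  consider "a \<in> set ds" "b \<in> set ds" | "a \<in> set ds" "b \<notin> set ds" | "a \<notin> set ds" "b \<in> set ds"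
    | "a \<notin> set ds" "b \<notin> set ds" by blast
  then show ?case
  proof cases
    case 1
    have "card (set cs) = length cs"
      using wf' by (induction pre arbitrary: L v ds) (auto simp: distinct_card)
    then show ?thesis using 1 e by simp
  next
    case 2
    have "?s v b = of_nat (length cs) * path_weight (pre @ (u, cs) # post) v b"
      using IH[of v b] Cons.prems(5) 2 ne by blast
    then show ?thesis using 2 e by (simp add: sum_divide_distrib[symmetric])
  next
    case 3
    have "?s a v = of_nat (length cs) * path_weight (pre @ (u, cs) # post) a v"
      using IH[of a v] Cons.prems(4) 3 ne by blast
    then show ?thesis using 3 e by (simp add: sum_divide_distrib[symmetric])
  next
    case 4
    have "?s a b = of_nat (length cs) * path_weight (pre @ (u, cs) # post) a b"
      using IH[of a b] Cons.prems 4 by blast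
    then show ?thesis using 4 e by simp
  qed
qed

lemma wf_bundles_split:
  assumes "wf_bundles L (pre @ (u, cs) # post)" "2 < length cs" "q \<in> set cs"
    "r \<notin> L" "r \<notin> fst ` set (pre @ (u, cs) # post)"
  shows "wf_bundles L (pre @ split_bundle r q (u, cs) @ post)"
  using assms(1,4,5)
proof (induction pre arbitrary: L)
  case Nil
  let ?ds = "filter (\<lambda>c. c \<noteq> q) cs"
  have wf: "wf_bundles L ((u, cs) # post)" and r: "r \<notin> L" "r \<noteq> u" "r \<notin> fst ` set post" using Nil by auto
  have CL: "set cs \<subseteq> L" and u: "u \<notin> L" and dist: "distinct cs" and cp: "set cs \<inter> fst ` set post = {}"
    using wf by auto
  have rq: "r \<notin> set cs" "q \<noteq> r" "q \<in> L" "q \<noteq> u" using r CL u assms(3) by auto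
  let ?L1 = "insert r (L - set ?ds)"
  have "insert u (?L1 - set [q, r]) = insert u (L - set cs)"
    using r(1,2) rq assms(3) CL by auto
  then have "wf_bundles ?L1 ((u, [q, r]) # post)"
    using wf rq u r assms(3) cp by auto
  moreover have "2 \<le> length ?ds" using length_filter_neq[OF dist assms(3)] assms(2) by simp
  moreover have "set ?ds \<inter> fst ` set ((u, [q, r]) # post) = {}" using cp CL u by auto
  ultimately show ?case using dist CL r(1) by (auto simp: split_bundle_def)
next
  case (Cons e pre)
  obtain v ds where e: "e = (v, ds)" by (cases e)
  have IH: "wf_bundles (insert v (L - set ds)) (pre @ split_bundle r q (u, cs) @ post)"
    by (rule Cons.IH) (use Cons.prems e in auto)
  have "fst ` set (pre @ split_bundle r q (u, cs) @ post) = insert r (fst ` set (pre @ (u, cs) # post))"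
    by (auto simp: split_bundle_def)
  moreover have "set ds \<inter> fst ` set (pre @ (u, cs) # post) = {}" "r \<notin> set ds" "set ds \<subseteq> L"
    using Cons.prems(1,2) e by auto
  ultimately have "set ds \<inter> fst ` set (pre @ split_bundle r q (u, cs) @ post) = {}" by simp
  then show ?case using IH Cons.prems(1) e by simp
qed

lemma sum_bundle_cost_split:
  assumes "wf_bundles L (pre @ (u, cs) # post)" "2 < length cs"
    "r \<notin> L" "r \<notin> fst ` set (pre @ (u, cs) # post)"
  shows "(\<Sum>q\<in>set cs. bundle_cost L d (pre @ split_bundle r q (u, cs) @ post) :: 'a :: linordered_field) =
    of_nat (length cs) * bundle_cost L d (pre @ (u, cs) # post)"
proof -
  have "(\<Sum>q\<in>set cs. bundle_cost L d (pre @ split_bundle r q (u, cs) @ post)) =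
    (\<Sum>a\<in>L. \<Sum>b\<in>L - {a}. \<Sum>q\<in>set cs. d a b * path_weight (pre @ split_bundle r q (u, cs) @ post) a b)"
    unfolding bundle_cost_def by (subst sum.swap, rule sum.cong[OF refl], rule sum.swap)
  also have "\<dots> = (\<Sum>a\<in>L. \<Sum>b\<in>L - {a}. of_nat (length cs) * (d a b * path_weight (pre @ (u, cs) # post) a b))"
  proof (intro sum.cong refl)
    fix a b assume "a \<in> L" "b \<in> L - {a}"
    then have "(\<Sum>q\<in>set cs. path_weight (pre @ split_bundle r q (u, cs) @ post) a b :: 'a) =
      of_nat (length cs) * path_weight (pre @ (u, cs) # post) a b"
      by (intro sum_path_weight_split[OF assms]) auto
    then show "(\<Sum>q\<in>set cs. d a b * path_weight (pre @ split_bundle r q (u, cs) @ post) a b) =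
      of_nat (length cs) * (d a b * path_weight (pre @ (u, cs) # post) a b)"
      unfolding sum_distrib_left[symmetric] by simp
  qed
  finally show ?thesis by (simp add: bundle_cost_def sum_distrib_left)
qed

lemma exists_split_le:
  fixes d :: "nat \<Rightarrow> nat \<Rightarrow> 'a :: linordered_field"
  assumes "wf_bundles L (pre @ (u, cs) # post)" "2 < length cs"
    "r \<notin> L" "r \<notin> fst ` set (pre @ (u, cs) # post)"
  shows "\<exists>q\<in>set cs. bundle_cost L d (pre @ split_bundle r q (u, cs) @ post) \<le>
    bundle_cost L d (pre @ (u, cs) # post)"
proof -
  have "distinct cs" using assms(1) by (induction pre arbitrary: L) auto
  then have k: "card (set cs) = length cs" by (rule distinct_card)
  have "set cs \<noteq> {}" using assms(2) by (cases cs) auto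
  from exists_le_average[OF _ this, of "\<lambda>q. bundle_cost L d (pre @ split_bundle r q (u, cs) @ post)"]
  show ?thesis
    unfolding sum_bundle_cost_split[OF assms] k using \<open>set cs \<noteq> {}\<close> by simp
qed

text \<open>The number of splits still to be made on the way to a cubic tree.\<close>

definition excess :: "bundles \<Rightarrow> nat" where
  "excess E = sum_list (map (\<lambda>e. length (snd e) - 2) E)"

lemma excess_split:
  assumes "wf_bundles L (pre @ (u, cs) # post)" "2 < length cs" "q \<in> set cs"
  shows "excess (pre @ (u, cs) # post) = Suc (excess (pre @ split_bundle r q (u, cs) @ post))"
proof -
  have "distinct cs" using assms(1) by (induction pre arbitrary: L) auto
  then show ?thesis
    using length_filter_neq[OF _ assms(3)] assms(2) by (simp add: excess_def split_bundle_def)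
qed

lemma excess_0_iff:
  assumes "wf_bundles L E"
  shows "excess E = 0 \<longleftrightarrow> (\<forall>(u, cs)\<in>set E. length cs = 2)"
  using bundle_length[OF assms] by (fastforce simp: excess_def)

text \<open>Removing a bundle of k leaves lowers the number of leaves by k - 1, and two remain in
  the end. It guarantees that n rounds of splitting are enough.\<close>

lemma excess_le: "wf_bundles L E \<Longrightarrow> excess E + 2 \<le> card L"
proof (induction L E rule: wf_bundles.induct)
  case (2 L u cs E)
  have fin: "finite L" using wf_bundles_finite[OF 2(2)] .
  have "card (insert u (L - set cs)) = Suc (card L - length cs)"
    using 2(2) fin by (simp add: card_Diff_subset distinct_card)
  moreover have "length cs \<le> card L" using 2(2) card_mono[OF fin, of "set cs"] by (simp add: distinct_card)
  moreover have "2 \<le> length cs" "wf_bundles (insert u (L - set cs)) E" using 2(2) by simp_all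
  ultimately show ?case using 2(1) by (simp add: excess_def)
qed (simp add: excess_def)

text \<open>Mere existence, over any ordered field: this supplies outputs of the algorithm for real
  matrices, which the machine cannot read.\<close>

lemma cubic_refinement:
  fixes d :: "nat \<Rightarrow> nat \<Rightarrow> 'a :: linordered_field"
  assumes "wf_bundles L E"
  shows "\<exists>E'. wf_bundles L E' \<and> excess E' = 0 \<and> bundle_cost L d E' \<le> bundle_cost L d E"
  using assms
proof (induction "excess E" arbitrary: E)
  case (Suc m)
  then obtain u cs where "(u, cs) \<in> set E" "length cs \<noteq> 2"
    using excess_0_iff[OF Suc.prems] by auto
  then obtain pre post where E: "E = pre @ (u, cs) # post" and len: "2 < length cs"
    using bundle_length[OF Suc.prems, of u cs] by (metis split_list le_neq_implies_less)
  obtain r where r: "r \<notin> L \<union> fst ` set E"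
    using ex_new_if_finite[of "L \<union> fst ` set E"] wf_bundles_finite[OF Suc.prems] by auto
  obtain q where q: "q \<in> set cs" "bundle_cost L d (pre @ split_bundle r q (u, cs) @ post) \<le> bundle_cost L d E"
    using exists_split_le[of L pre u cs post r d] Suc.prems len r E by auto
  let ?E = "pre @ split_bundle r q (u, cs) @ post"
  have "wf_bundles L ?E" using wf_bundles_split[of L pre u cs post q r] Suc.prems len r E q by auto
  moreover have "m = excess ?E" using excess_split[of L pre u cs post q r] Suc len E q by simp
  ultimately obtain E' where "wf_bundles L E'" "excess E' = 0" "bundle_cost L d E' \<le> bundle_cost L d ?E"
    using Suc.hyps(1)[of ?E] by blast
  then show ?case using q(2) by (intro exI[of _ E']) simp
next
  case 0
  then show ?case by (intro exI[of _ E]) simp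
qed

section \<open>Every tree is a sequence of bundles\<close>

text \<open>One round of peeling and its inverse. The first facts carry the assumptions over to the
  smaller tree; the last one prepends the bundle to a sequence that describes the smaller
  tree.\<close>

lemma strip_bundle:
  assumes G: "is_tree G" and u: "u \<in> internal G" and cs: "distinct cs" "set cs \<subseteq> nbrs G u \<inter> leaves G"
    and len: "length cs + 1 = vertex_degree G u" "2 \<le> length cs"
  defines "G' \<equiv> gr (verts G - set cs) {e \<in> edges G. e \<inter> set cs = {}}"
  shows "is_tree G'" "leaves G' = insert u (leaves G - set cs)" "internal G' = internal G - {u}"
    and "\<And>v. v \<in> internal G' \<Longrightarrow> vertex_degree G' v = vertex_degree G v"
    and "wf_bundles (leaves G') E \<Longrightarrow> bundle_graph (leaves G') E = G' \<Longrightarrow>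
      wf_bundles (leaves G) ((u, cs) # E) \<and> bundle_graph (leaves G) ((u, cs) # E) = G"
proof -
  note GD = is_treeD[OF G]
  have uG: "u \<in> verts G" "u \<notin> leaves G" using u by (auto simp: internal_def)
  have csV: "set cs \<subseteq> verts G - {u}" using cs(2) nbrs_sub[OF GD(1)] by auto
  have nb: "nbrs G c = {u}" if "c \<in> set cs" for c
  proof -
    have "card (nbrs G c) = 1"
      using that cs(2) by (auto simp: leaves_def vertex_degree_eq_nbrs[OF GD(1)])
    moreover have "u \<in> nbrs G c" using that cs(2) by (auto simp: nbrs_def insert_commute)
    ultimately show ?thesis by (metis card_1_singletonE singletonD)
  qed
  have only: "e = {u, c}" if "e \<in> edges G" "c \<in> e" "c \<in> set cs" for e c
  proof -
    obtain x y where xy: "e = {x, y}" using \<open>e \<in> edges G\<close> by (auto elim: simple_graph_edgeE[OF GD(1)])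
    then obtain w where w: "e = {c, w}" using \<open>c \<in> e\<close> by (metis insertE insert_commute singletonD)
    then have "w \<in> nbrs G c" using \<open>e \<in> edges G\<close> by (simp add: nbrs_def)
    then show ?thesis using nb[OF \<open>c \<in> set cs\<close>] w by (simp add: insert_commute)
  qed
  have ce: "{u, c} \<in> edges G" if "c \<in> set cs" for c using cs(2) that by (auto simp: nbrs_def)
  have E': "{e \<in> edges G. e \<inter> set cs = {}} = edges G - (\<lambda>c. {u, c}) ` set cs"
  proof (intro equalityI subsetI)
    fix e assume e: "e \<in> edges G - (\<lambda>c. {u, c}) ` set cs"
    have "e \<inter> set cs = {}" using only[of e] e by blast
    then show "e \<in> {e \<in> edges G. e \<inter> set cs = {}}" using e by blast
  qed auto
  show G': "is_tree G'" unfolding G'_def E' by (rule strip_tree[OF G uG(1) csV nb])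
  note sg = GD(1) and sg' = is_treeD(1)[OF G']
  have nbrs': "nbrs G' v = nbrs G v - set cs" if "v \<notin> set cs" for v
    using that by (auto simp: nbrs_def G'_def)
  have degv: "vertex_degree G' v = vertex_degree G v" if "v \<notin> set cs" "v \<noteq> u" for v
  proof -
    have "nbrs G v \<inter> set cs = {}"
      using nb that by (auto simp: nbrs_def insert_commute)
    then have "nbrs G' v = nbrs G v" using nbrs'[OF that(1)] by blast
    then show ?thesis by (simp add: vertex_degree_eq_nbrs[OF sg] vertex_degree_eq_nbrs[OF sg'])
  qed
  have "u \<notin> set cs" using csV by blast
  then have "vertex_degree G' u = card (nbrs G u - set cs)"
    using nbrs' by (simp add: vertex_degree_eq_nbrs[OF sg'])
  also have "\<dots> = card (nbrs G u) - card (set cs)"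
    using cs(2) by (intro card_Diff_subset) auto
  finally have degu: "vertex_degree G' u = 1"
    using len cs(1) by (simp add: vertex_degree_eq_nbrs[OF sg] distinct_card)
  have V': "verts G' = verts G - set cs" by (simp add: G'_def)
  have leaf_iff: "v \<in> leaves G' \<longleftrightarrow> v = u \<or> v \<in> leaves G \<and> v \<notin> set cs" for v
  proof (cases "v = u")
    case True
    then show ?thesis using degu uG(1) \<open>u \<notin> set cs\<close> by (simp add: leaves_def V')
  next
    case False
    then show ?thesis using degv[of v] by (auto simp: leaves_def V')
  qed
  then show L': "leaves G' = insert u (leaves G - set cs)" by blast
  show I': "internal G' = internal G - {u}"
    using L' cs(2) by (auto simp: internal_def V')
  show "vertex_degree G' v = vertex_degree G v" if "v \<in> internal G'" for v
    using that I' degv[of v] cs(2) by (auto simp: internal_def)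
  show "wf_bundles (leaves G) ((u, cs) # E) \<and> bundle_graph (leaves G) ((u, cs) # E) = G"
    if wf: "wf_bundles (leaves G') E" and g: "bundle_graph (leaves G') E = G'"
  proof
    have "fst ` set E \<subseteq> verts (bundle_graph (leaves G') E)" by (simp add: bundle_graph_def)
    then have "fst ` set E \<subseteq> verts G'" unfolding g .
    then show wf2: "wf_bundles (leaves G) ((u, cs) # E)"
      using wf uG(2) cs len(2) by (auto simp: L' V')
    have "set cs \<union> verts G' = verts G" using csV V' by blast
    moreover have "(\<lambda>c. {u, c}) ` set cs \<union> edges G' = edges G"
      using E' ce by (auto simp: G'_def)
    ultimately have "gr (set cs \<union> verts G') ((\<lambda>c. {u, c}) ` set cs \<union> edges G') = G"
      by (metis graph.surjective old.unit.exhaust)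
    then show "bundle_graph (leaves G) ((u, cs) # E) = G"
      unfolding bundle_graph_Cons(1)[OF wf2] L'[symmetric] g Let_def .
  qed
qed

text \<open>Every vertex has a single neighbour, so nothing but \<open>u\<close> and its neighbour
  can be reached from \<open>u\<close>.\<close>

lemma tree_no_internal:
  assumes G: "is_tree G" and none: "internal G = {}"
  shows "card (leaves G) = 2" "bundle_graph (leaves G) [] = G"
proof -
  note GD = is_treeD[OF G]
  have L: "leaves G = verts G" using none by (auto simp: internal_def leaves_def)
  have one: "\<exists>w. nbrs G v = {w}" if "v \<in> verts G" for v
  proof -
    have "v \<in> leaves G" using that L by simp
    then have "card (nbrs G v) = 1" by (simp add: leaves_def vertex_degree_eq_nbrs[OF GD(1)])
    then show ?thesis by (metis card_1_singletonE)
  qed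
  obtain u where u: "u \<in> verts G" using GD(2) by blast
  obtain w where w: "nbrs G u = {w}" using one[OF u] by blast
  then have uw: "{u, w} \<in> edges G" by (auto simp: nbrs_def)
  note uwV = simple_graph_edgeD[OF GD(1) uw]
  obtain w' where "nbrs G w = {w'}" using one[OF uwV(2)] by blast
  moreover have "u \<in> nbrs G w" using uw by (simp add: nbrs_def insert_commute)
  ultimately have w': "nbrs G w = {u}" by (metis singletonD)
  have "x \<in> {u, w}" if "(u, x) \<in> (adj (edges G))\<^sup>*" for x
    using that
  proof induction
    case (step y z)
    then have "z \<in> nbrs G y" by (simp add: adj_iff nbrs_def)
    then show ?case using step.IH w w' by auto
  qed simp
  then have V: "verts G = {u, w}" using GD(3) u uwV by (auto simp: conn_def)
  then show "card (leaves G) = 2" using L uwV(3) by simp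
  have "card (edges G) = 1" using GD(4) V uwV(3) by simp
  then have "edges G = {{u, w}}" using uw by (metis card_1_singletonE singletonD)
  then show "bundle_graph (leaves G) [] = G" using V L by (cases G) (simp add: bundle_graph_def)
qed

text \<open>The internal vertices induce a forest. A vertex of degree at most 1 in this forest has
  only leaves as neighbours, with at most one exception.\<close>

lemma exists_outer_internal:
  assumes G: "is_tree G" and ne: "internal G \<noteq> {}"
  shows "\<exists>u\<in>internal G. card (nbrs G u \<inter> internal G) \<le> 1"
proof -
  note GD = is_treeD[OF G]
  define H where "H = gr (internal G) {e \<in> edges G. e \<subseteq> internal G}"
  have sg: "simple_graph H" unfolding H_def
    by (rule simple_graph_mono[OF GD(1)]) (auto simp: internal_def)
  have "\<not> is_cycle H c" for c
    using GD(5) is_cycle_mono[of H c G] by (auto simp: H_def internal_def)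
  then obtain u where u: "u \<in> internal G" "vertex_degree H u \<le> 1"
    using acyclic_low_degree[OF sg] ne by (auto simp: H_def)
  have "nbrs H u = nbrs G u \<inter> internal G" using u(1) by (auto simp: nbrs_def H_def)
  then show ?thesis using u by (auto simp: vertex_degree_eq_nbrs[OF sg])
qed

section \<open>Peeling off bundles, as functions on lists\<close>

definition adjacent :: "(nat \<times> nat) list \<Rightarrow> nat \<Rightarrow> nat \<Rightarrow> bool" where
  "adjacent es u v \<longleftrightarrow> (u, v) \<in> set es \<or> (v, u) \<in> set es"

definition neighbours :: "(nat \<times> nat) list \<Rightarrow> nat list \<Rightarrow> nat \<Rightarrow> nat list" where
  "neighbours es R u = filter (adjacent es u) R"

definition inner_neighbours :: "(nat \<times> nat) list \<Rightarrow> nat list \<Rightarrow> nat \<Rightarrow> nat list" where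
  "inner_neighbours es R u = filter (\<lambda>v. length (neighbours es R v) \<noteq> 1) (neighbours es R u)"

definition outer :: "(nat \<times> nat) list \<Rightarrow> nat list \<Rightarrow> nat \<Rightarrow> bool" where
  "outer es R u \<longleftrightarrow> length (neighbours es R u) \<noteq> 1 \<and> length (inner_neighbours es R u) < 2"

text \<open>If no neighbour is inner, the tree is a star around \<open>u\<close>; one of its leaves
  has to stay behind to form the final edge with \<open>u\<close>.\<close>

definition leaf_bundle :: "(nat \<times> nat) list \<Rightarrow> nat list \<Rightarrow> nat \<Rightarrow> nat \<times> nat list" where
  "leaf_bundle es R u = (u, if inner_neighbours es R u = [] then drop 1 (neighbours es R u)
     else filter (\<lambda>v. length (neighbours es R v) = 1) (neighbours es R u))"

text \<open>The bundles found so far determine the current tree, so they are the only state that the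
  loop has to carry.\<close>

definition remaining :: "nat list \<Rightarrow> bundles \<Rightarrow> nat list" where
  "remaining vs E = filter (\<lambda>v. v \<notin> set (concat (map snd E))) vs"

definition peel :: "nat list \<Rightarrow> (nat \<times> nat) list \<Rightarrow> bundles \<Rightarrow> bundles" where
  "peel vs es E = (if filter (outer es (remaining vs E)) (remaining vs E) = [] then E
     else E @ [leaf_bundle es (remaining vs E)
       (nth_default 0 (filter (outer es (remaining vs E)) (remaining vs E)) 0)])"

definition induced :: "(nat \<times> nat) list \<Rightarrow> nat list \<Rightarrow> graph" where
  "induced es R = gr (set R) {{u, v} | u v. u \<in> set R \<and> v \<in> set R \<and> adjacent es u v}"

lemma adjacent_sym: "adjacent es u v \<longleftrightarrow> adjacent es v u"
  by (auto simp: adjacent_def)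

lemma set_neighbours:
  assumes "u \<in> set R"
  shows "set (neighbours es R u) = nbrs (induced es R) u"
proof -
  have "{u, v} \<in> edges (induced es R) \<longleftrightarrow> v \<in> set R \<and> adjacent es u v" for v
    using assms adjacent_sym by (fastforce simp: induced_def doubleton_eq_iff)
  then show ?thesis by (auto simp: neighbours_def nbrs_def)
qed

lemma peel_step:
  fixes vs es E
  defines "R \<equiv> remaining vs E" and "G \<equiv> induced es (remaining vs E)"
  assumes dist: "distinct vs" and G: "is_tree G" and deg: "\<And>v. v \<in> internal G \<Longrightarrow> 3 \<le> vertex_degree G v"
    and ne: "internal G \<noteq> {}"
  obtains u cs where "peel vs es E = E @ [(u, cs)]" "u \<in> internal G" "distinct cs"
    "set cs \<subseteq> nbrs G u \<inter> leaves G" "length cs + 1 = vertex_degree G u" "2 \<le> length cs"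
    "induced es (remaining vs (peel vs es E)) = gr (verts G - set cs) {e \<in> edges G. e \<inter> set cs = {}}"
proof -
  note GD = is_treeD[OF G]
  have dR: "distinct R" using dist by (simp add: R_def remaining_def)
  have VG: "verts G = set R" by (simp add: G_def R_def induced_def)
  have len: "length (neighbours es R u) = vertex_degree G u" if "u \<in> set R" for u
  proof -
    have "distinct (neighbours es R u)" using dR by (simp add: neighbours_def)
    then show ?thesis
      using set_neighbours[OF that, of es] vertex_degree_eq_nbrs[OF GD(1)]
      by (simp add: G_def R_def flip: distinct_card)
  qed
  have leaf: "length (neighbours es R u) = 1 \<longleftrightarrow> u \<in> leaves G" if "u \<in> set R" for u
    using len[OF that] that by (simp add: leaves_def VG)
  have nbR: "set (neighbours es R u) \<subseteq> set R" for u by (auto simp: neighbours_def)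
  have snb: "set (neighbours es R u) = nbrs G u" if "u \<in> set R" for u
    using set_neighbours[OF that, of es] by (simp add: G_def R_def)
  have inner: "set (inner_neighbours es R u) = nbrs G u \<inter> internal G" if "u \<in> set R" for u
    using snb[OF that] leaf nbR[of u] by (auto simp: inner_neighbours_def internal_def VG)
  have outer: "outer es R u \<longleftrightarrow> u \<in> internal G \<and> card (nbrs G u \<inter> internal G) \<le> 1" if "u \<in> set R" for u
  proof -
    have "distinct (inner_neighbours es R u)" using dR by (simp add: inner_neighbours_def neighbours_def)
    then have "length (inner_neighbours es R u) = card (nbrs G u \<inter> internal G)"
      using inner[OF that] by (metis distinct_card)
    then show ?thesis using leaf[OF that] that by (auto simp: outer_def internal_def VG)
  qed
  have "set (filter (outer es R) R) \<noteq> {}"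
    using exists_outer_internal[OF G ne] outer by (auto simp: internal_def VG)
  then have C: "filter (outer es R) R \<noteq> []" by (metis set_empty)
  define u where "u = nth_default 0 (filter (outer es R) R) 0"
  define cs where "cs = snd (leaf_bundle es R u)"
  have lb: "leaf_bundle es R u = (u, cs)" by (simp add: cs_def leaf_bundle_def)
  have "u \<in> set (filter (outer es R) R)"
    using C by (simp add: u_def nth_default_def del: set_filter)
  then have uR: "u \<in> set R" and uI: "u \<in> internal G" "card (nbrs G u \<inter> internal G) \<le> 1" and uo: "outer es R u"
    using outer by auto
  have eq: "peel vs es E = E @ [(u, cs)]"
    using C lb by (simp add: peel_def u_def R_def)
  note nb = snb[OF uR]
  have dn: "distinct (neighbours es R u)" using dR by (simp add: neighbours_def)
  have "distinct cs \<and> set cs \<subseteq> nbrs G u \<inter> leaves G \<and> length cs + 1 = length (neighbours es R u)"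
  proof (cases "inner_neighbours es R u = []")
    case True
    then have "nbrs G u \<inter> internal G = {}" using inner[OF uR] by simp
    then have "nbrs G u \<subseteq> leaves G" using nbrs_sub[OF GD(1), of u] by (auto simp: internal_def)
    moreover have "cs = drop 1 (neighbours es R u)" using True by (simp add: cs_def leaf_bundle_def)
    moreover have "3 \<le> length (neighbours es R u)" using len[OF uR] deg[OF uI(1)] by simp
    ultimately show ?thesis using dn nb set_drop_subset[of 1 "neighbours es R u"] by auto
  next
    \<comment> \<open>Exactly one neighbour is inner, and it is the only one that stays outside the
      bundle.\<close>
    case False
    then have "cs = filter (\<lambda>v. length (neighbours es R v) = 1) (neighbours es R u)"
      by (simp add: cs_def leaf_bundle_def)
    moreover have "length (inner_neighbours es R u) = 1"
      using False uo by (cases "inner_neighbours es R u") (auto simp: outer_def)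
    moreover have "length (filter (\<lambda>v. length (neighbours es R v) = 1) (neighbours es R u)) +
        length (inner_neighbours es R u) = length (neighbours es R u)"
      unfolding inner_neighbours_def by (rule sum_length_filter_compl)
    moreover have "v \<in> nbrs G u \<inter> leaves G"
      if "v \<in> set (filter (\<lambda>v. length (neighbours es R v) = 1) (neighbours es R u))" for v
      using that nb nbR[of u] leaf[of v] by auto
    ultimately show ?thesis using dn by (simp add: subset_iff)
  qed
  then have cs: "distinct cs" "set cs \<subseteq> nbrs G u \<inter> leaves G" "length cs + 1 = vertex_degree G u"
    using len[OF uR] by auto
  have "2 \<le> length cs" using cs(3) deg[OF uI(1)] by simp
  moreover have "set (remaining vs (E @ [(u, cs)])) = verts G - set cs"
    by (auto simp: VG R_def remaining_def)
  then have "induced es (remaining vs (E @ [(u, cs)])) = gr (verts G - set cs) {e \<in> edges G. e \<inter> set cs = {}}"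
    unfolding induced_def[of es "remaining vs (E @ [(u, cs)])"] G_def induced_def[of es "remaining vs E"]
    by auto
  ultimately show ?thesis using that[OF eq uI(1) cs] eq by simp
qed

text \<open>Each round removes one internal vertex. Once none is left, no vertex is
  \<open>outer\<close> and \<open>peel\<close> changes nothing, so surplus rounds do no
  harm.\<close>

lemma peel_correct:
  assumes "distinct vs" "is_tree (induced es (remaining vs E))"
    and "\<And>v. v \<in> internal (induced es (remaining vs E)) \<Longrightarrow> 3 \<le> vertex_degree (induced es (remaining vs E)) v"
    and "card (internal (induced es (remaining vs E))) \<le> m"
  shows "\<exists>E'. (peel vs es ^^ m) E = E @ E' \<and> wf_bundles (leaves (induced es (remaining vs E))) E' \<and>
    bundle_graph (leaves (induced es (remaining vs E))) E' = induced es (remaining vs E)"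
  using assms(2-)
proof (induction m arbitrary: E)
  case 0
  let ?G = "induced es (remaining vs E)"
  have "finite (internal ?G)" by (simp add: internal_def induced_def)
  then have "internal ?G = {}" using 0(3) by simp
  then show ?case using tree_no_internal[OF 0(1)] by (intro exI[of _ "[]"]) simp
next
  case (Suc m)
  let ?G = "induced es (remaining vs E)"
  have fin: "finite (internal ?G)" by (simp add: internal_def induced_def)
  show ?case
  proof (cases "internal ?G = {}")
    case True
    have "outer es (remaining vs E) v = False" if v: "v \<in> set (remaining vs E)" for v
    proof -
      have "v \<in> leaves ?G" using True v by (auto simp: internal_def induced_def)
      then have "card (nbrs ?G v) = 1"
        by (simp add: leaves_def vertex_degree_eq_nbrs[OF is_treeD(1)[OF Suc.prems(1)]])
      moreover have "distinct (neighbours es (remaining vs E) v)"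
        using assms(1) by (simp add: neighbours_def remaining_def)
      ultimately have "length (neighbours es (remaining vs E) v) = 1"
        using set_neighbours[OF v, of es] by (metis distinct_card)
      then show ?thesis by (simp add: outer_def)
    qed
    then have "filter (outer es (remaining vs E)) (remaining vs E) = []"
      by (simp add: filter_empty_conv)
    then have "peel vs es E = E" unfolding peel_def by (simp only: if_True simp_thms)
    then have "(peel vs es ^^ Suc m) E = (peel vs es ^^ m) E" by (simp only: funpow_Suc_right comp_apply)
    then show ?thesis using Suc.IH[OF Suc.prems(1,2)] True by simp
  next
    case False
    obtain u cs where p: "peel vs es E = E @ [(u, cs)]" "u \<in> internal ?G" "distinct cs"
      "set cs \<subseteq> nbrs ?G u \<inter> leaves ?G" "length cs + 1 = vertex_degree ?G u" "2 \<le> length cs"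
      "induced es (remaining vs (peel vs es E)) = gr (verts ?G - set cs) {e \<in> edges ?G. e \<inter> set cs = {}}"
      by (rule peel_step[OF assms(1) Suc.prems(1,2) False])
    note strip = strip_bundle[OF Suc.prems(1) p(2-6), folded p(7)]
    let ?G' = "induced es (remaining vs (peel vs es E))"
    have "card (internal ?G') \<le> m"
      using Suc.prems(3) p(2) fin strip(3) by (simp add: card_Diff_singleton)
    moreover have "3 \<le> vertex_degree ?G' v" if "v \<in> internal ?G'" for v
      using that strip(3) strip(4)[OF that] Suc.prems(2)[of v] by auto
    ultimately obtain E' where E': "(peel vs es ^^ m) (peel vs es E) = peel vs es E @ E'"
        "wf_bundles (leaves ?G') E'" "bundle_graph (leaves ?G') E' = ?G'"
      using Suc.IH[OF strip(1)] by blast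
    have "(peel vs es ^^ Suc m) E = E @ ((u, cs) # E')"
      using E'(1) p(1) by (simp only: funpow_Suc_right comp_apply) simp
    then show ?thesis using strip(5)[OF E'(2,3)] by blast
  qed
qed

lemma induced_lists_graph:
  assumes "lists_graph vs es G" "simple_graph G"
  shows "induced es vs = G"
proof -
  have im: "edges G = (\<lambda>(u, v). {u, v}) ` set es" and V: "set vs = verts G"
    using assms(1) by (simp_all add: lists_graph_def)
  have edges: "edges G = {{u, v} | u v. (u, v) \<in> set es}" unfolding im by force
  have "{{u, v} | u v. u \<in> set vs \<and> v \<in> set vs \<and> adjacent es u v} = edges G"
  proof (intro equalityI subsetI)
    fix e assume e: "e \<in> edges G"
    then obtain u v where uv: "e = {u, v}" "(u, v) \<in> set es" unfolding edges by blast
    then have "u \<in> verts G" "v \<in> verts G" using simple_graph_edgeD[OF assms(2)] e by blast+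
    then show "e \<in> {{u, v} | u v. u \<in> set vs \<and> v \<in> set vs \<and> adjacent es u v}"
      using uv unfolding adjacent_def V by blast
  next
    fix e assume "e \<in> {{u, v} | u v. u \<in> set vs \<and> v \<in> set vs \<and> adjacent es u v}"
    then obtain u v where "e = {u, v}" "adjacent es u v" by blast
    then have "e = {u, v} \<and> (u, v) \<in> set es \<or> e = {v, u} \<and> (v, u) \<in> set es"
      unfolding adjacent_def by (metis insert_commute)
    then show "e \<in> edges G" unfolding edges by blast
  qed
  then show ?thesis using V by (cases G) (simp add: induced_def)
qed

text \<open>Folding over \<open>vs\<close> merely counts the rounds: one for each vertex, at least
  as many as there are internal vertices.\<close>

definition decompose :: "nat list \<Rightarrow> (nat \<times> nat) list \<Rightarrow> bundles" where
  "decompose vs es = fold (\<lambda>_. peel vs es) vs []"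

lemma decompose_correct:
  assumes "lists_graph vs es G" "is_tree G" "\<And>v. v \<in> internal G \<Longrightarrow> 3 \<le> vertex_degree G v"
  shows "wf_bundles (leaves G) (decompose vs es)" "bundle_graph (leaves G) (decompose vs es) = G"
proof -
  have G: "induced es (remaining vs []) = G"
    using induced_lists_graph[OF assms(1) is_treeD(1)[OF assms(2)]] by (simp add: remaining_def)
  have d: "distinct vs" using assms(1) by (simp add: lists_graph_def)
  have "internal G \<subseteq> set vs" using assms(1) by (auto simp: lists_graph_def internal_def)
  then have "card (internal G) \<le> length vs"
    using card_mono[of "set vs" "internal G"] card_length[of vs] by simp
  then obtain E where "(peel vs es ^^ length vs) [] = E" "wf_bundles (leaves G) E" "bundle_graph (leaves G) E = G"
    using peel_correct[of vs es "[]" "length vs"] d assms(2,3) unfolding G by auto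
  moreover have "fold (\<lambda>_. peel vs es) xs E = (peel vs es ^^ length xs) E" for xs :: "nat list" and E
    by (induction xs arbitrary: E) (auto simp: funpow_swap1)
  ultimately show "wf_bundles (leaves G) (decompose vs es)" "bundle_graph (leaves G) (decompose vs es) = G"
    by (auto simp: decompose_def)
qed

lemma exists_lists_graph:
  assumes "simple_graph G"
  shows "\<exists>vs es. lists_graph vs es G"
proof -
  note fin = simple_graph_finite[OF assms]
  obtain vs where vs: "set vs = verts G" "distinct vs" using finite_distinct_list[OF fin(1)] by blast
  obtain fs where fs: "set fs = edges G" "distinct fs" using finite_distinct_list[OF fin(2)] by blast
  have "\<exists>p. (case p of (u, v) \<Rightarrow> {u, v}) = e" if e: "e \<in> edges G" for e
  proof -
    obtain u v where "e = {u, v}" using e by (auto elim: simple_graph_edgeE[OF assms])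
    then show ?thesis by (intro exI[of _ "(u, v)"]) simp
  qed
  then obtain h where h: "\<And>e. e \<in> edges G \<Longrightarrow> (case h e of (u, v) \<Rightarrow> {u, v}) = e" by metis
  have "map (\<lambda>(u, v). {u, v}) (map h fs) = map id fs"
    unfolding map_map by (rule map_cong) (use h fs in auto)
  then have "lists_graph vs (map h fs) G"
    using vs fs by (simp add: lists_graph_def del: map_map)
  then show ?thesis by blast
qed

text \<open>The sequence is the one that the list algorithm computes from any listing of the
  tree.\<close>

lemma exists_bundles:
  assumes "is_tree G" "\<And>v. v \<in> internal G \<Longrightarrow> 3 \<le> vertex_degree G v"
  shows "\<exists>E. wf_bundles (leaves G) E \<and> bundle_graph (leaves G) E = G"
  using exists_lists_graph[OF is_treeD(1)[OF assms(1)]] decompose_correct[OF _ assms] by blast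

section \<open>Spanning trees and the optimum\<close>

text \<open>Edges are unordered, and \<open>Min\<close> and \<open>Max\<close> choose an order of
  the ends; for symmetric \<open>\<delta>\<close> the choice is immaterial.\<close>

definition edge_cost :: "(nat \<Rightarrow> nat \<Rightarrow> 'a) \<Rightarrow> nat set \<Rightarrow> 'a" where
  "edge_cost \<delta> e = \<delta> (Min e) (Max e)"

lemma edge_cost_pair: "\<delta> x y = \<delta> y x \<Longrightarrow> edge_cost \<delta> {x, y} = \<delta> x y"
  by (simp add: edge_cost_def min_def max_def)

lemma spanning_cost_eq:
  assumes "simple_graph G" "verts G = {1..n}"
  shows "spanning_cost n \<delta> G = sum (edge_cost \<delta>) (edges G)"
proof -
  let ?S = "{(i, j). i \<in> {1..n} \<and> j \<in> {1..n} \<and> i < j \<and> {i, j} \<in> edges G}"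
  have "bij_betw (\<lambda>(i, j). {i, j}) ?S (edges G)"
    unfolding bij_betw_def
  proof
    show "inj_on (\<lambda>(i, j). {i, j}) ?S"
      by (auto simp: inj_on_def doubleton_eq_iff)
    have "e \<in> (\<lambda>(i, j). {i, j}) ` ?S" if e: "e \<in> edges G" for e
    proof -
      obtain u v where uv: "e = {u, v}" "u \<in> {1..n}" "v \<in> {1..n}" "u \<noteq> v"
        using e assms(2) by (auto elim: simple_graph_edgeE[OF assms(1)])
      then have "e = {min u v, max u v}" by (auto simp: min_def max_def)
      moreover have "(min u v, max u v) \<in> ?S"
        using uv e calculation by (auto simp: min_def max_def split: if_splits)
      ultimately show ?thesis by (intro image_eqI[of _ _ "(min u v, max u v)"]) simp_all
    qed
    then show "(\<lambda>(i, j). {i, j}) ` ?S = edges G" by auto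
  qed
  from sum.reindex_bij_betw[OF this, of "edge_cost \<delta>"]
  have "sum (edge_cost \<delta>) (edges G) = (\<Sum>p\<in>?S. edge_cost \<delta> (case p of (i, j) \<Rightarrow> {i, j}))" ..
  also have "\<dots> = (\<Sum>(i, j)\<in>?S. \<delta> i j)"
    by (rule sum.cong) (auto simp: edge_cost_def min_def max_def)
  finally show ?thesis by (simp add: spanning_cost_def)
qed

text \<open>\<open>\<delta>\<close> is pulled back to the leaves along the labelling. The pairs from
  \<open>spanning_pairs_le_cost\<close>, carried over to the species, connect all of them and number
  fewer than n, and therefore form a spanning tree.\<close>

lemma spanning_tree_le_bme_cost:
  assumes feas: "feasible n G \<phi>" and \<delta>: "bme_instance n \<delta>"
  shows "\<exists>T. spanning_tree n T \<and> spanning_cost n \<delta> T \<le> bme_cost n \<delta> G \<phi>"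
proof -
  have G: "is_tree G" and deg3: "\<And>v. v \<in> internal G \<Longrightarrow> vertex_degree G v = 3"
    and bij: "bij_betw \<phi> {1..n} (leaves G)" using feas by (auto simp: feasible_def)
  define L where "L = leaves G"
  obtain E where wf: "wf_bundles L E" and GE: "bundle_graph L E = G"
    using exists_bundles[OF G] deg3 unfolding L_def by force
  have cubic: "length cs = 2" if E: "(u, cs) \<in> set E" for u cs
  proof -
    have "u \<in> fst ` set E" using E by force
    then have "vertex_degree G u = 3" using deg3 leaves_bundle_graph(2)[OF wf] GE by simp
    then show ?thesis using bundle_graph_degree(2)[OF wf E] GE by simp
  qed
  define \<psi> where "\<psi> = inv_into {1..n} \<phi>"
  have \<psi>\<phi>: "\<psi> (\<phi> i) = i" "\<phi> i \<in> L" if "i \<in> {1..n}" for i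
    using bij that unfolding \<psi>_def L_def by (auto simp: bij_betw_def)
  have \<psi>: "\<psi> a \<in> {1..n}" "\<phi> (\<psi> a) = a" if "a \<in> L" for a
  proof -
    have im: "a \<in> \<phi> ` {1..n}" using bij that by (simp add: L_def bij_betw_def)
    show "\<psi> a \<in> {1..n}" unfolding \<psi>_def by (rule inv_into_into[OF im])
    show "\<phi> (\<psi> a) = a" unfolding \<psi>_def by (rule f_inv_into_f[OF im])
  qed
  have \<psi>_inj: "\<psi> a \<noteq> \<psi> b" if "a \<in> L" "b \<in> L" "a \<noteq> b" for a b
    using \<psi>(2) that by metis
  have cardL: "card L = n" using bij_betw_same_card[OF bij] by (simp add: L_def)
  define d where "d = (\<lambda>a b. \<delta> (\<psi> a) (\<psi> b))"
  have dsym: "0 \<le> d x y \<and> d x y = d y x" if "x \<in> L" "y \<in> L" for x y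
    using \<psi>(1)[OF that(1)] \<psi>(1)[OF that(2)] \<delta> unfolding d_def bme_instance_def by blast
  have "bme_cost n \<delta> G \<phi> = (\<Sum>j\<in>{1..n}. \<Sum>i\<in>{1..<j}. 2 * (\<delta> i j * path_weight E (\<phi> i) (\<phi> j)))"
    unfolding bme_cost_def
  proof (intro sum.cong refl)
    fix i j assume ij: "j \<in> {1..n}" "i \<in> {1..<j}"
    then have "i \<in> {1..n}" "i \<noteq> j" by auto
    then have "\<phi> i \<in> L" "\<phi> j \<in> L" "\<phi> i \<noteq> \<phi> j" using \<psi>\<phi> ij(1) by metis+
    from powi_tree_dist_bundle_graph[OF wf this] cubic GE
    show "\<delta> i j * 2 powi (2 - int (tree_dist G (\<phi> i) (\<phi> j))) = 2 * (\<delta> i j * path_weight E (\<phi> i) (\<phi> j))"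
      by simp
  qed
  also have "\<dots> = (\<Sum>a\<in>{1..n}. \<Sum>b\<in>{1..n} - {a}. \<delta> a b * path_weight E (\<phi> a) (\<phi> b))"
  proof (rule sum_offdiag[symmetric])
    fix i j assume "i \<in> {1..n}" "j \<in> {1..n}"
    then have "\<delta> i j = \<delta> j i" using \<delta> unfolding bme_instance_def by blast
    then show "\<delta> i j * path_weight E (\<phi> i) (\<phi> j) = \<delta> j i * path_weight E (\<phi> j) (\<phi> i)"
      using path_weight_sym[of E "\<phi> i" "\<phi> j", where 'a = real] by simp
  qed
  also have "\<dots> = (\<Sum>a\<in>{1..n}. \<Sum>b\<in>L - {\<phi> a}. d (\<phi> a) b * path_weight E (\<phi> a) b)"
  proof (rule sum.cong[OF refl])
    fix a assume a: "a \<in> {1..n}"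
    have b: "bij_betw \<phi> ({1..n} - {a}) (L - {\<phi> a})"
      using bij_betw_DiffI[OF bij bij_betw_singletonI[of \<phi> a "\<phi> a"]] a \<psi>\<phi>(2)[OF a] by (simp add: L_def)
    have "(\<Sum>b\<in>{1..n} - {a}. \<delta> a b * path_weight E (\<phi> a) (\<phi> b)) =
      (\<Sum>b\<in>{1..n} - {a}. d (\<phi> a) (\<phi> b) * path_weight E (\<phi> a) (\<phi> b))"
      by (rule sum.cong) (use a \<psi>\<phi>(1) in \<open>auto simp: d_def\<close>)
    also have "\<dots> = (\<Sum>b\<in>L - {\<phi> a}. d (\<phi> a) b * path_weight E (\<phi> a) b)"
      by (rule sum.reindex_bij_betw[OF b])
    finally show "(\<Sum>b\<in>{1..n} - {a}. \<delta> a b * path_weight E (\<phi> a) (\<phi> b)) =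
      (\<Sum>b\<in>L - {\<phi> a}. d (\<phi> a) b * path_weight E (\<phi> a) b)" .
  qed
  also have "\<dots> = bundle_cost L d E"
    unfolding bundle_cost_def
    by (rule sum.reindex_bij_betw[OF bij[folded L_def], of "\<lambda>a. \<Sum>b\<in>L - {a}. d a b * path_weight E a b"])
  finally have cost: "bme_cost n \<delta> G \<phi> = bundle_cost L d E" .
  have "\<forall>x\<in>L. \<forall>y\<in>L. x \<noteq> y \<longrightarrow> 0 \<le> d x y \<and> d x y = d y x" using dsym by blast
  from spanning_pairs_le_cost[OF wf this]
  obtain P where P: "finite P" "P \<subseteq> {(a, b). a \<in> L \<and> b \<in> L \<and> a \<noteq> b}" "card P < card L"
    "\<forall>a\<in>L. \<forall>b\<in>L. (a, b) \<in> (P \<union> P\<inverse>)\<^sup>*" "(\<Sum>(a, b)\<in>P. d a b) \<le> bundle_cost L d E"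
    by (elim exE conjE) (rule that)
  have PL: "fst p \<in> L \<and> snd p \<in> L \<and> fst p \<noteq> snd p" if "p \<in> P" for p
    using subsetD[OF P(2) that] by (simp add: case_prod_beta)
  define f where "f = (\<lambda>p. {\<psi> (fst p), \<psi> (snd p)})"
  define T where "T = gr {1..n} (f ` P)"
  have "simple_graph T"
    unfolding simple_graph_def T_def graph.select_convs
  proof (intro conjI ballI finite_atLeastAtMost)
    fix e assume "e \<in> f ` P"
    then obtain p where "p \<in> P" "e = f p" by blast
    then show "\<exists>u v. u \<in> {1..n} \<and> v \<in> {1..n} \<and> u \<noteq> v \<and> e = {u, v}"
      using PL[of p] \<psi>(1) \<psi>_inj unfolding f_def by blast
  qed
  moreover have "conn {1..n} (f ` P)"
    unfolding conn_def
  proof (intro ballI)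
    have reach: "(\<psi> a, \<psi> b) \<in> (adj (f ` P))\<^sup>*" if "(a, b) \<in> (P \<union> P\<inverse>)\<^sup>*" for a b
      using that
    proof induction
      case (step b c)
      have "{\<psi> b, \<psi> c} \<in> f ` P"
      proof (cases "(b, c) \<in> P")
        case True
        then show ?thesis by (intro image_eqI[of _ _ "(b, c)"]) (simp_all add: f_def)
      next
        case False
        then have "(c, b) \<in> P" using step.hyps(2) by simp
        then show ?thesis by (intro image_eqI[of _ _ "(c, b)"]) (simp_all add: f_def insert_commute)
      qed
      then have "(\<psi> b, \<psi> c) \<in> adj (f ` P)" by (simp add: adj_iff)
      then show ?case using step.IH by (rule rtrancl_into_rtrancl[rotated])
    qed simp
    fix i j assume ij: "i \<in> {1..n}" "j \<in> {1..n}"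
    then have "(\<phi> i, \<phi> j) \<in> (P \<union> P\<inverse>)\<^sup>*" using P(4) \<psi>\<phi>(2) by blast
    from reach[OF this] show "(i, j) \<in> (adj (f ` P))\<^sup>*" using \<psi>\<phi>(1) ij by simp
  qed
  moreover have "{1..n} \<noteq> {}"
  proof -
    have "n \<noteq> 0" using P(3) cardL by simp
    then show ?thesis by simp
  qed
  moreover have "card (f ` P) < n" using card_image_le[OF P(1), of f] P(3) cardL by simp
  ultimately have tree: "is_tree T" by (intro conn_card_tree) (simp_all add: T_def)
  have fd: "edge_cost \<delta> (f p) = d (fst p) (snd p)" if "p \<in> P" for p
  proof -
    have "d (fst p) (snd p) = d (snd p) (fst p)" using dsym PL[OF that] by blast
    then show ?thesis using edge_cost_pair[of \<delta> "\<psi> (fst p)" "\<psi> (snd p)"] by (simp add: f_def d_def)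
  qed
  have "spanning_cost n \<delta> T = sum (edge_cost \<delta>) (f ` P)"
    using spanning_cost_eq[OF is_treeD(1)[OF tree]] by (simp add: T_def)
  also have "\<dots> \<le> sum (edge_cost \<delta> \<circ> f) P"
  proof (rule sum_image_le[OF P(1)])
    fix p assume "p \<in> P"
    then show "0 \<le> edge_cost \<delta> (f p)" using fd dsym PL by simp
  qed
  also have "\<dots> = (\<Sum>(a, b)\<in>P. d a b)"
    by (rule sum.cong) (simp_all add: fd case_prod_beta)
  finally have "spanning_cost n \<delta> T \<le> bme_cost n \<delta> G \<phi>" using P(5) cost by simp
  then show ?thesis using tree by (intro exI[of _ T]) (simp add: spanning_tree_def T_def)
qed

lemma exists_spanning_tree:
  assumes "1 \<le> n"
  shows "\<exists>G. spanning_tree n G"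
proof -
  have "is_tree (gr {1} {})" by (rule conn_card_tree) (auto simp: simple_graph_def conn_def)
  from pendants_tree[OF this, of 1 "{2..n}"]
  have "is_tree (gr ({2..n} \<union> {1}) ((\<lambda>c. {1, c}) ` {2..n}))" by simp
  moreover have "{2..n} \<union> {1} = {1..n}" using assms by auto
  ultimately show ?thesis by (auto simp: spanning_tree_def)
qed

lemma exists_minimum_spanning_tree:
  assumes "1 \<le> n"
  shows "\<exists>G. minimum_spanning_tree n \<delta> G"
proof -
  have "{G. spanning_tree n G} \<subseteq> gr {1..n} ` Pow (Pow {1..n})"
  proof
    fix G assume "G \<in> {G. spanning_tree n G}"
    then have G: "simple_graph G" "verts G = {1..n}"
      using is_treeD(1) by (auto simp: spanning_tree_def)
    have "e \<subseteq> {1..n}" if "e \<in> edges G" for e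
      using G(2) that by (auto elim!: simple_graph_edgeE[OF G(1)])
    then have "edges G \<in> Pow (Pow {1..n})" by blast
    moreover have "G = gr {1..n} (edges G)" using G(2) by (cases G) simp
    ultimately show "G \<in> gr {1..n} ` Pow (Pow {1..n})" by blast
  qed
  then have fin: "finite {G. spanning_tree n G}" by (rule finite_subset) simp
  obtain G where "G \<in> {G. spanning_tree n G}"
    "\<And>H. H \<in> {G. spanning_tree n G} \<Longrightarrow> spanning_cost n \<delta> G \<le> spanning_cost n \<delta> H"
    using ex_is_arg_min_if_finite[OF fin, of "spanning_cost n \<delta>"] exists_spanning_tree[OF assms]
    unfolding is_arg_min_linorder by blast
  then show ?thesis by (auto simp: minimum_spanning_tree_def)
qed

section \<open>Attaching leaves\<close>

definition relabel :: "nat \<Rightarrow> nat set \<Rightarrow> nat \<Rightarrow> nat" where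
  "relabel n I i = (if i \<in> I then n + i else i)"

text \<open>A closed form for the tree after the species in \<open>I\<close> have been treated; it
  turns the invariant of the fold \<open>attach_leaves\<close> into an equation.\<close>

definition attached :: "nat \<Rightarrow> nat set \<Rightarrow> graph \<Rightarrow> graph" where
  "attached n I G = gr ({1..n} \<union> (+) n ` I) ((`) (relabel n I) ` edges G \<union> (\<lambda>i. {i, n + i}) ` I)"

lemma spanning_tree_edge_subset:
  assumes "spanning_tree n G" "e \<in> edges G"
  shows "e \<subseteq> {1..n}"
  using assms is_treeD(1)[of G] by (auto simp: spanning_tree_def elim!: simple_graph_edgeE)

lemma relabel_inj: "I \<subseteq> {1..n} \<Longrightarrow> inj_on (relabel n I) {1..n}"
  by (auto simp: inj_on_def relabel_def)

text \<open>Treating smaller species renames neighbours of \<open>k\<close> but leaves its degree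
  alone. Hence the test on the current tree gives the same answer as on the original one.\<close>

lemma attach_leaves_step:
  assumes T: "spanning_tree n G" and k: "k \<in> {1..n}"
  defines "J \<equiv> {i \<in> internal G. i < k}" and "J' \<equiv> {i \<in> internal G. i < Suc k}"
  shows "(if k \<in> internal (attached n J G) then attach_leaf n k (attached n J G) else attached n J G) =
    attached n J' G"
proof -
  have V: "verts G = {1..n}" using T by (simp add: spanning_tree_def)
  have IV: "internal G \<subseteq> {1..n}" using V by (auto simp: internal_def)
  have J: "J \<subseteq> {1..n}" "k \<notin> J" using IV by (auto simp: J_def)
  have inj: "inj_on (relabel n J) {1..n}" by (rule relabel_inj[OF J(1)])
  note sub = spanning_tree_edge_subset[OF T]
  have mem: "k \<in> relabel n J ` e \<longleftrightarrow> k \<in> e" if "e \<subseteq> {1..n}" for e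
    using that k J by (force simp: relabel_def split: if_splits)
  have "{e \<in> edges (attached n J G). k \<in> e} = (`) (relabel n J) ` {e \<in> edges G. k \<in> e}"
    using mem sub J k by (auto simp: attached_def)
  moreover have "inj_on ((`) (relabel n J)) {e \<in> edges G. k \<in> e}"
    by (rule inj_on_subset[OF inj_on_image_Pow[OF inj]]) (use sub in auto)
  ultimately have "vertex_degree (attached n J G) k = vertex_degree G k"
    by (simp add: vertex_degree_def card_image)
  then have int: "k \<in> internal (attached n J G) \<longleftrightarrow> k \<in> internal G"
    using k V by (auto simp: internal_def leaves_def attached_def)
  show ?thesis
  proof (cases "k \<in> internal G")
    case False
    then have "J' = J" by (auto simp: J_def J'_def less_Suc_eq)
    then show ?thesis using int False by simp
  next
    case True
    then have J': "J' = insert k J" by (auto simp: J_def J'_def less_Suc_eq)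
    define r where "r = (\<lambda>v. if v = k then n + k else v)"
    have rV: "insert k (r ` ({1..n} \<union> (+) n ` J)) = {1..n} \<union> (+) n ` J'"
    proof -
      have "r ` ((+) n ` J) = (+) n ` J"
        unfolding image_image by (rule image_cong) (use k J in \<open>auto simp: r_def\<close>)
      moreover have "insert k (r ` {1..n}) = insert (n + k) {1..n}" using k by (auto simp: r_def)
      moreover have "insert k (r ` ({1..n} \<union> (+) n ` J)) = insert k (r ` {1..n}) \<union> r ` ((+) n ` J)"
        by (simp add: image_Un)
      ultimately show ?thesis by (simp add: J')
    qed
    have "(`) r ` (`) (relabel n J) ` edges G = (`) (relabel n J') ` edges G"
      unfolding image_image
    proof (rule image_cong[OF refl])
      fix e assume "e \<in> edges G"
      then have e: "e \<subseteq> {1..n}" by (rule sub)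
      show "(\<lambda>x. r (relabel n J x)) ` e = relabel n J' ` e"
        by (rule image_cong) (use e k J in \<open>auto simp: r_def relabel_def J'\<close>)
    qed
    moreover have "(`) r ` (\<lambda>i. {i, n + i}) ` J = (\<lambda>i. {i, n + i}) ` J"
      unfolding image_image by (rule image_cong[OF refl]) (use k J in \<open>auto simp: r_def\<close>)
    ultimately have rE: "insert {k, n + k} ((`) r ` ((`) (relabel n J) ` edges G \<union> (\<lambda>i. {i, n + i}) ` J)) =
        (`) (relabel n J') ` edges G \<union> (\<lambda>i. {i, n + i}) ` J'"
      unfolding image_Un by (simp add: J')
    have "attach_leaf n k (attached n J G) = attached n J' G"
      unfolding attach_leaf_def Let_def attached_def graph.select_convs r_def[symmetric] rV rE by (rule refl)
    then show ?thesis using int True by simp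
  qed
qed

lemma attach_leaves_eq:
  assumes T: "spanning_tree n G"
  shows "attach_leaves n G = attached n (internal G) G"
proof -
  have IV: "internal G \<subseteq> {1..n}" using T by (auto simp: internal_def spanning_tree_def)
  have "fold (\<lambda>i H. if i \<in> internal H then attach_leaf n i H else H) [1..<Suc k] G =
      attached n {i \<in> internal G. i < Suc k} G" if "k \<le> n" for k
    using that
  proof (induction k)
    case 0
    have e: "{i \<in> internal G. i < Suc 0} = {}" using IV by auto
    have "relabel n {} = id" by (auto simp: relabel_def)
    moreover have "gr {1..n} (edges G) = G" using T by (cases G) (simp add: spanning_tree_def)
    ultimately show ?case unfolding e by (simp add: attached_def)
  next
    case (Suc k)
    have "[1..<Suc (Suc k)] = [1..<Suc k] @ [Suc k]" by simp
    then show ?case using Suc attach_leaves_step[OF T, of "Suc k"]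
      by (simp only: fold_append fold_simps comp_apply Suc_leD) simp
  qed
  from this[of n] have "attach_leaves n G = attached n {i \<in> internal G. i < Suc n} G"
    by (simp add: attach_leaves_def)
  moreover have "{i \<in> internal G. i < Suc n} = internal G" using IV by auto
  ultimately show ?thesis by simp
qed

text \<open>The renamed vertex \<open>n + i\<close> inherits the neighbours of \<open>i\<close>, at
  least two of them since \<open>2 \<le> n\<close> excludes an isolated vertex, and gains
  \<open>i\<close> itself. This yields the degree 3 that the decomposition into bundles asks
  for.\<close>

lemma attach_leaves_tree:
  assumes T: "spanning_tree n G" and n: "2 \<le> n"
  shows "is_tree (attach_leaves n G)" "leaves (attach_leaves n G) = {1..n}"
    "\<And>v. v \<in> internal (attach_leaves n G) \<Longrightarrow> 3 \<le> vertex_degree (attach_leaves n G) v"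
proof -
  define I where "I = internal G"
  define r where "r = relabel n I"
  define H where "H = attach_leaves n G"
  have G: "is_tree G" and V: "verts G = {1..n}" using T by (auto simp: spanning_tree_def)
  note GD = is_treeD[OF G]
  note fin = simple_graph_finite[OF GD(1)]
  have I: "I \<subseteq> {1..n}" using V by (auto simp: I_def internal_def)
  have finI: "finite I" using I finite_subset by blast
  have H: "verts H = {1..n} \<union> (+) n ` I" "edges H = (`) r ` edges G \<union> (\<lambda>i. {i, n + i}) ` I"
    using attach_leaves_eq[OF T] by (simp_all add: H_def attached_def I_def r_def)
  have r: "inj_on r {1..n}" unfolding r_def by (rule relabel_inj[OF I])
  have rI: "r i = n + i" if "i \<in> I" for i using that by (simp add: r_def relabel_def)
  have rN: "r i = i" if "i \<notin> I" for i using that by (simp add: r_def relabel_def)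
  have rV: "r i \<in> verts H" if "i \<in> {1..n}" for i using that by (cases "i \<in> I") (auto simp: H rI rN)
  have rnotI: "r i \<notin> I" if "i \<in> {1..n}" for i using that I by (cases "i \<in> I") (auto simp: rI rN)
  have sg: "simple_graph H"
    unfolding simple_graph_def
  proof (intro conjI ballI)
    show "finite (verts H)" using finI by (simp add: H)
    fix e assume "e \<in> edges H"
    then consider f where "f \<in> edges G" "e = r ` f" | i where "i \<in> I" "e = {i, n + i}" using H by auto
    then show "\<exists>u v. u \<in> verts H \<and> v \<in> verts H \<and> u \<noteq> v \<and> e = {u, v}"
    proof cases
      case 1
      obtain x y where xy: "f = {x, y}" "x \<in> {1..n}" "y \<in> {1..n}" "x \<noteq> y"
        using 1(1) V by (auto elim: simple_graph_edgeE[OF GD(1)])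
      then have "r x \<noteq> r y" using inj_onD[OF r, of x y] by blast
      then show ?thesis using xy 1(2) rV by (intro exI[of _ "r x"] exI[of _ "r y"]) simp
    next
      case 2
      then have "i \<in> verts H" "n + i \<in> verts H" "i \<noteq> n + i" using I n by (auto simp: H)
      then show ?thesis using 2(2) by blast
    qed
  qed
  have edge: "{r x, r y} \<in> edges H" if "{x, y} \<in> edges G" for x y
  proof -
    have "r ` {x, y} \<in> (`) r ` edges G" using that by (rule imageI)
    then show ?thesis by (simp add: H)
  qed
  have pend: "{i, n + i} \<in> edges H" if "i \<in> I" for i using that by (simp add: H)
  have reach: "(r x, r y) \<in> (adj (edges H))\<^sup>*" if "(x, y) \<in> (adj (edges G))\<^sup>*" for x y
    using that
  proof induction
    case (step y z)
    then have "(r y, r z) \<in> adj (edges H)" using edge by (simp add: adj_iff)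
    then show ?case using step.IH by (rule rtrancl_into_rtrancl[rotated])
  qed simp
  \<comment> \<open>Every vertex is, or is adjacent to, the image of an original vertex, and these
    images are connected as in \<open>G\<close>.\<close>
  have toR: "\<exists>x\<in>{1..n}. (v, r x) \<in> (adj (edges H))\<^sup>*" if v: "v \<in> verts H" for v
  proof -
    consider "v \<in> I" | "v \<in> {1..n}" "v \<notin> I" | i where "i \<in> I" "v = n + i" using v H by auto
    then show ?thesis
    proof cases
      case 1
      then have "(v, r v) \<in> adj (edges H)" using pend rI by (simp add: adj_iff)
      then show ?thesis using 1 I by blast
    next
      case 2
      then have "v = r v" by (simp add: rN)
      then show ?thesis using 2(1) by (metis rtrancl.rtrancl_refl)
    next
      case 3
      then have "v = r i" by (simp add: rI)
      then show ?thesis using 3(1) I by blast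
    qed
  qed
  have "conn (verts H) (edges H)"
    unfolding conn_def
  proof (intro ballI)
    fix u v assume "u \<in> verts H" "v \<in> verts H"
    then obtain x y where "x \<in> {1..n}" "(u, r x) \<in> (adj (edges H))\<^sup>*" "y \<in> {1..n}" "(v, r y) \<in> (adj (edges H))\<^sup>*"
      using toR by meson
    moreover have "(r x, r y) \<in> (adj (edges H))\<^sup>*"
      using reach GD(3) V calculation(1,3) by (simp add: conn_def)
    ultimately show "(u, v) \<in> (adj (edges H))\<^sup>*" using reach_sym by (meson rtrancl_trans)
  qed
  moreover have "card (edges H) < card (verts H)"
  proof -
    have "card (edges H) \<le> card ((`) r ` edges G) + card ((\<lambda>i. {i, n + i}) ` I)"
      unfolding H by (rule card_Un_le)
    also have "\<dots> \<le> card (edges G) + card I"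
      using card_image_le[OF fin(2)] card_image_le[OF finI] by (rule add_mono)
    finally have "card (edges H) \<le> card (edges G) + card I" .
    moreover have "card (verts H) = n + card I"
    proof -
      have "{1..n} \<inter> (+) n ` I = {}" using I by auto
      then have "card (verts H) = card {1..n} + card ((+) n ` I)"
        unfolding H using finI by (intro card_Un_disjoint) auto
      then show ?thesis by (simp add: card_image)
    qed
    ultimately show ?thesis using GD(4) V by simp
  qed
  moreover have "verts H \<noteq> {}" using n by (simp add: H)
  ultimately show tree: "is_tree (attach_leaves n G)" using sg conn_card_tree unfolding H_def by blast
  have nbrs_r: "nbrs H (r x) = r ` nbrs G x \<union> (if x \<in> I then {x} else {})" if x: "x \<in> {1..n}" for x
  proof (intro equalityI subsetI)
    fix w assume "w \<in> nbrs H (r x)"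
    then have "{r x, w} \<in> (`) r ` edges G \<or> (\<exists>i\<in>I. {r x, w} = {i, n + i})" using H by (auto simp: nbrs_def)
    then show "w \<in> r ` nbrs G x \<union> (if x \<in> I then {x} else {})"
    proof
      assume "{r x, w} \<in> (`) r ` edges G"
      then obtain f where f: "f \<in> edges G" "{r x, w} = r ` f" by auto
      obtain a b where ab: "f = {a, b}" "a \<in> {1..n}" "b \<in> {1..n}"
        using f(1) V by (auto elim: simple_graph_edgeE[OF GD(1)])
      have "{r x, w} = {r a, r b}" using f(2) ab(1) by simp
      then have "r x = r a \<and> w = r b \<or> r x = r b \<and> w = r a" by (simp only: doubleton_eq_iff)
      then have "x = a \<and> w = r b \<or> x = b \<and> w = r a" using r x ab(2,3) by (metis inj_onD)
      then show ?thesis using f(1) ab(1) by (auto simp: nbrs_def insert_commute)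
    next
      assume "\<exists>i\<in>I. {r x, w} = {i, n + i}"
      then obtain i where i: "i \<in> I" "{r x, w} = {i, n + i}" by blast
      then have "r x = n + i \<and> w = i" using rnotI[OF x] by (auto simp: doubleton_eq_iff)
      moreover have "r x = n + i \<longrightarrow> x = i \<and> x \<in> I" using x I i(1) by (cases "x \<in> I") (auto simp: rI rN)
      ultimately show ?thesis using i(1) by simp
    qed
  next
    fix w assume w: "w \<in> r ` nbrs G x \<union> (if x \<in> I then {x} else {})"
    show "w \<in> nbrs H (r x)"
    proof (cases "w \<in> r ` nbrs G x")
      case True
      then show ?thesis using edge by (auto simp: nbrs_def)
    next
      case False
      then have "x \<in> I" "w = x" using w by (auto split: if_splits)
      then show ?thesis using pend[of x] rI[of x] by (simp add: nbrs_def insert_commute)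
    qed
  qed
  have nbG: "nbrs G x \<subseteq> {1..n}" for x using nbrs_sub[OF GD(1)] V by blast
  have card_r: "card (r ` nbrs G x) = vertex_degree G x" for x
    using card_image[OF inj_on_subset[OF r nbG]] by (simp add: vertex_degree_eq_nbrs[OF GD(1)])
  have degI: "vertex_degree H i = 1" if i: "i \<in> I" for i
  proof -
    have "nbrs H i = {n + i}"
    proof (intro equalityI subsetI)
      fix w assume "w \<in> nbrs H i"
      then have "{i, w} \<in> (`) r ` edges G \<or> (\<exists>j\<in>I. {i, w} = {j, n + j})" using H by (auto simp: nbrs_def)
      moreover have "{i, w} \<notin> (`) r ` edges G"
      proof
        assume "{i, w} \<in> (`) r ` edges G"
        then obtain f where "f \<in> edges G" "{i, w} = r ` f" by auto
        then have "i \<in> r ` {1..n}" using spanning_tree_edge_subset[OF T, of f] by blast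
        then show False using rnotI i by blast
      qed
      ultimately obtain j where "j \<in> I" "{i, w} = {j, n + j}" by blast
      then have "j \<in> {1..n}" "i \<in> {1..n}" "i = j \<and> w = n + j \<or> i = n + j \<and> w = j"
        using i I by (auto simp only: doubleton_eq_iff)
      then show "w \<in> {n + i}" by auto
    qed (use pend[OF i] in \<open>simp add: nbrs_def\<close>)
    then show ?thesis by (simp add: vertex_degree_eq_nbrs[OF sg])
  qed
  have degN: "vertex_degree H i = 1" if "i \<in> {1..n}" "i \<notin> I" for i
  proof -
    have "i \<in> leaves G" using that V by (simp add: I_def internal_def)
    then have "vertex_degree G i = 1" by (simp add: leaves_def)
    then show ?thesis using nbrs_r[OF that(1)] that(2) card_r[of i] rN
      by (simp add: vertex_degree_eq_nbrs[OF sg])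
  qed
  have degR: "3 \<le> vertex_degree H (n + i)" if i: "i \<in> I" for i
  proof -
    have iV: "i \<in> {1..n}" using i I by blast
    have "i \<notin> leaves G" "i \<in> verts G" using i by (auto simp: I_def internal_def)
    then have "vertex_degree G i \<noteq> 1" by (auto simp: leaves_def)
    moreover have "1 \<le> vertex_degree G i"
      using tree_degree_pos[OF G, of i] iV V n by simp
    ultimately have "2 \<le> vertex_degree G i" by simp
    moreover have "i \<notin> r ` nbrs G i" using rnotI nbG i by blast
    moreover have "finite (r ` nbrs G i)" using finite_nbrs[OF GD(1)] by simp
    ultimately show ?thesis using nbrs_r[OF iV] i rI[OF i] card_r[of i]
      by (simp add: vertex_degree_eq_nbrs[OF sg])
  qed
  have "v \<in> leaves H \<longleftrightarrow> v \<in> {1..n}" for v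
  proof (cases "v \<in> {1..n}")
    case True
    then show ?thesis using degI degN by (cases "v \<in> I") (simp_all add: leaves_def H)
  next
    case False
    then have "v \<notin> leaves H" using degR by (force simp: leaves_def H)
    then show ?thesis using False by blast
  qed
  then show L: "leaves (attach_leaves n G) = {1..n}" unfolding H_def by blast
  show "3 \<le> vertex_degree (attach_leaves n G) v" if "v \<in> internal (attach_leaves n G)" for v
  proof -
    have "v \<in> verts H" "v \<notin> {1..n}" using that L by (auto simp: internal_def H_def)
    then obtain i where "i \<in> I" "v = n + i" using H by auto
    then show ?thesis using degR by (simp add: H_def)
  qed
qed

section \<open>The approximation guarantee\<close>

lemma general_cost_attach_leaves:
  assumes T: "spanning_tree n G" and n: "2 \<le> n" and \<delta>: "metric_instance n \<delta>"
  shows "general_cost n \<delta> (attach_leaves n G) \<le> 2 * spanning_cost n \<delta> G"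
proof -
  let ?H = "attach_leaves n G" and ?I = "internal G"
  have bme: "bme_instance n \<delta>" using \<delta> by (simp add: metric_instance_def)
  have V: "verts G = {1..n}" and sg: "simple_graph G"
    using T is_treeD(1) by (auto simp: spanning_tree_def)
  have I: "?I \<subseteq> {1..n}" using V by (auto simp: internal_def)
  have d0: "\<delta> i j = \<delta> j i" "0 \<le> \<delta> i j" "\<delta> i i = 0" if "i \<in> {1..n}" "j \<in> {1..n}" for i j
    using bme that unfolding bme_instance_def by blast+
  have tri: "\<delta> i k \<le> \<delta> i j + \<delta> j k" if "i \<in> {1..n}" "j \<in> {1..n}" "k \<in> {1..n}" for i j k
  proof (cases "i \<noteq> j \<and> j \<noteq> k \<and> i \<noteq> k")
    case True
    then show ?thesis using \<delta> that unfolding metric_instance_def by blast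
  next
    case False
    then show ?thesis using d0[OF that(1,2)] d0[OF that(2,3)] by auto
  qed
  \<comment> \<open>\<open>\<sigma>\<close> sends each vertex back to its species, so
    \<open>\<Delta>\<close> is \<open>\<delta>\<close> read through the renaming. The value 1 for
    all other numbers makes symmetry and the triangle inequality hold for all naturals, as
    \<open>cost_le_offsets\<close> demands.\<close>
  define \<sigma> where "\<sigma> = (\<lambda>v. if v \<in> {1..n} then v else if v - n \<in> {1..n} then v - n else 1)"
  define \<Delta> where "\<Delta> = (\<lambda>x y. \<delta> (\<sigma> x) (\<sigma> y))"
  have \<sigma>: "\<sigma> v \<in> {1..n}" for v using n by (auto simp: \<sigma>_def)
  have \<sigma>r: "\<sigma> (relabel n ?I i) = i" if "i \<in> {1..n}" for i using that by (auto simp: \<sigma>_def relabel_def)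
  have \<Delta>sym: "\<Delta> x y = \<Delta> y x" for x y unfolding \<Delta>_def using d0(1) \<sigma> by blast
  have \<Delta>tri: "\<Delta> x z \<le> \<Delta> x y + \<Delta> y z" for x y z unfolding \<Delta>_def using tri \<sigma> by blast
  have \<Delta>0: "0 \<le> \<Delta> x y" for x y unfolding \<Delta>_def using d0(2) \<sigma> by blast
  note H = attach_leaves_tree[OF T n]
  obtain E where wf: "wf_bundles {1..n} E" and HE: "bundle_graph {1..n} E = ?H"
    using exists_bundles[OF H(1,3)] unfolding H(2) by blast
  have E: "bundle_edges {1..n} E = edges ?H" using HE by (metis bundle_graph_def graph.select_convs(2))
  \<comment> \<open>On the species themselves \<open>\<Delta>\<close> is \<open>\<delta>\<close>, so
    the induction starts with offsets 0.\<close>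
  have "bundle_cost {1..n} \<delta> E \<le> 2 * sum (\<lambda>_. 0) {1..n} + 2 * (\<Sum>e\<in>bundle_edges {1..n} E. \<Delta> (Min e) (Max e))"
  proof (rule cost_le_offsets[OF wf \<Delta>sym \<Delta>tri])
    fix x y assume "x \<in> {1..n}" "y \<in> {1..n}"
    then show "\<delta> x y \<le> 0 + 0 + \<Delta> x y" by (simp add: \<Delta>_def \<sigma>_def)
  qed
  then have le: "general_cost n \<delta> ?H \<le> 2 * sum (edge_cost \<Delta>) (edges ?H)"
    using general_cost_bundle_graph[OF wf bme] unfolding HE E edge_cost_def by simp
  let ?A = "(`) (relabel n ?I) ` edges G" and ?B = "(\<lambda>i. {i, n + i}) ` ?I"
  have eH: "edges ?H = ?A \<union> ?B" using attach_leaves_eq[OF T] by (simp add: attached_def)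
  have finG: "finite (edges G)" "finite ?I" using simple_graph_finite[OF sg] by (auto simp: internal_def)
  have pos: "0 \<le> edge_cost \<Delta> e" for e by (simp add: edge_cost_def \<Delta>0)
  have "sum (edge_cost \<Delta>) (edges ?H) = sum (edge_cost \<Delta>) ?A + sum (edge_cost \<Delta>) ?B - sum (edge_cost \<Delta>) (?A \<inter> ?B)"
    unfolding eH using finG by (intro sum_Un) auto
  also have "\<dots> \<le> sum (edge_cost \<Delta>) ?A + sum (edge_cost \<Delta>) ?B"
    using sum_nonneg[of "?A \<inter> ?B" "edge_cost \<Delta>"] pos by simp
  \<comment> \<open>A new edge joins \<open>i\<close> with its renamed copy, which
    \<open>\<sigma>\<close> identifies: this is the cost 0 of attached edges.\<close>
  also have "sum (edge_cost \<Delta>) ?B = 0"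
  proof (rule sum.neutral, rule ballI)
    fix e assume "e \<in> ?B"
    then obtain i where i: "i \<in> ?I" "e = {i, n + i}" by blast
    then have "i \<in> {1..n}" using I by blast
    then have "\<sigma> i = i" "\<sigma> (n + i) = i" by (auto simp: \<sigma>_def)
    then show "edge_cost \<Delta> e = 0"
      using edge_cost_pair[of \<Delta> i "n + i", OF \<Delta>sym] i(2) d0(3)[OF \<open>i \<in> {1..n}\<close> \<open>i \<in> {1..n}\<close>]
      by (simp add: \<Delta>_def)
  qed
  also have "sum (edge_cost \<Delta>) ?A \<le> sum (edge_cost \<Delta> \<circ> (`) (relabel n ?I)) (edges G)"
    by (rule sum_image_le[OF finG(1)]) (rule pos)
  also have "\<dots> = sum (edge_cost \<delta>) (edges G)"
  proof (rule sum.cong[OF refl])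
    fix e assume "e \<in> edges G"
    then obtain x y where xy: "e = {x, y}" "x \<in> {1..n}" "y \<in> {1..n}"
      using V by (auto elim: simple_graph_edgeE[OF sg])
    then show "(edge_cost \<Delta> \<circ> (`) (relabel n ?I)) e = edge_cost \<delta> e"
      using edge_cost_pair[of \<Delta> "relabel n ?I x" "relabel n ?I y", OF \<Delta>sym]
        edge_cost_pair[of \<delta> x y, OF d0(1)[OF xy(2,3)]] by (simp add: \<Delta>_def \<sigma>r)
  qed
  also have "sum (edge_cost \<delta>) (edges G) = spanning_cost n \<delta> G"
    using spanning_cost_eq[OF sg V] by simp
  finally show ?thesis using le by simp
qed

lemma cubic_bundles_solution:
  assumes wf: "wf_bundles {1..n} E" and ex: "excess E = 0" and \<delta>: "bme_instance n \<delta>"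
  shows "feasible n (bundle_graph {1..n} E) (\<lambda>i. i)"
    "bme_cost n \<delta> (bundle_graph {1..n} E) (\<lambda>i. i) = bundle_cost {1..n} \<delta> E"
proof -
  let ?G = "bundle_graph {1..n} E"
  have cubic: "length cs = 2" if "(u, cs) \<in> set E" for u cs
    using ex that unfolding excess_0_iff[OF wf] by blast
  have "vertex_degree ?G v = 3" if v: "v \<in> internal ?G" for v
  proof -
    obtain cs where "(v, cs) \<in> set E" using v leaves_bundle_graph(2)[OF wf] by force
    then show ?thesis using bundle_graph_degree(2)[OF wf] cubic by fastforce
  qed
  then show "feasible n ?G (\<lambda>i. i)"
    using bundle_graph_tree[OF wf] leaves_bundle_graph(1)[OF wf]
    by (simp add: feasible_def bij_betw_def inj_on_def)
  have "bme_cost n \<delta> ?G (\<lambda>i. i) = general_cost n \<delta> ?G"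
    unfolding bme_cost_def general_cost_def
  proof (intro sum.cong refl)
    fix i j assume "j \<in> {1..n}" "i \<in> {1..<j}"
    then have ij: "i \<in> {1..n}" "j \<in> {1..n}" "i \<noteq> j" by auto
    show "\<delta> i j * 2 powi (2 - int (tree_dist ?G i j)) = \<delta> i j * tree_weight ?G i j"
      using powi_tree_dist_bundle_graph[OF wf ij] tree_weight_bundle_graph[OF wf ij] cubic by simp
  qed
  then show "bme_cost n \<delta> ?G (\<lambda>i. i) = bundle_cost {1..n} \<delta> E"
    using general_cost_bundle_graph[OF wf \<delta>] by simp
qed

lemma exists_algorithm_output:
  assumes T: "minimum_spanning_tree n \<delta> T\<^sub>0" and n: "2 \<le> n" and \<delta>: "metric_instance n \<delta>"
  shows "\<exists>T' \<phi>. algorithm_output n \<delta> T\<^sub>0 T' \<phi>"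
proof -
  have bme: "bme_instance n \<delta>" using \<delta> by (simp add: metric_instance_def)
  have "spanning_tree n T\<^sub>0" using T by (simp add: minimum_spanning_tree_def)
  note H = attach_leaves_tree[OF this n]
  obtain E where wf: "wf_bundles {1..n} E" and HE: "bundle_graph {1..n} E = attach_leaves n T\<^sub>0"
    using exists_bundles[OF H(1,3)] unfolding H(2) by blast
  obtain E' where E': "wf_bundles {1..n} E'" "excess E' = 0" "bundle_cost {1..n} \<delta> E' \<le> bundle_cost {1..n} \<delta> E"
    using cubic_refinement[OF wf] by blast
  show ?thesis
    using cubic_bundles_solution[OF E'(1,2) bme] E'(3) T general_cost_bundle_graph[OF wf bme] HE
    unfolding algorithm_output_def by (intro exI[of _ "bundle_graph {1..n} E'"] exI[of _ "\<lambda>i. i"]) simp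
qed

text \<open>The chain is f(T') \<le> f(T) \<le> 2 MST \<le> 2 OPT. As OPT is an infimum, a lower
  bound on every feasible cost is enough, and T' witnesses that there is a feasible
  solution.\<close>

lemma algorithm_output_le:
  assumes out: "algorithm_output n \<delta> T\<^sub>0 T' \<phi>" and n: "2 \<le> n" and \<delta>: "metric_instance n \<delta>"
  shows "bme_cost n \<delta> T' \<phi> \<le> 2 * bme_opt n \<delta>"
proof -
  have T: "minimum_spanning_tree n \<delta> T\<^sub>0" and feas: "feasible n T' \<phi>"
    and cost: "bme_cost n \<delta> T' \<phi> \<le> general_cost n \<delta> (attach_leaves n T\<^sub>0)"
    using out by (auto simp: algorithm_output_def)
  have bme: "bme_instance n \<delta>" using \<delta> by (simp add: metric_instance_def)
  have "spanning_cost n \<delta> T\<^sub>0 \<le> bme_opt n \<delta>"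
    unfolding bme_opt_def
  proof (rule cInf_greatest)
    show "{bme_cost n \<delta> G \<phi> | G \<phi>. feasible n G \<phi>} \<noteq> {}" using feas by blast
    fix x assume "x \<in> {bme_cost n \<delta> G \<phi> | G \<phi>. feasible n G \<phi>}"
    then obtain G \<phi> where G: "x = bme_cost n \<delta> G \<phi>" "feasible n G \<phi>" by blast
    from spanning_tree_le_bme_cost[OF G(2) bme]
    obtain T where "spanning_tree n T" "spanning_cost n \<delta> T \<le> x" using G(1) by blast
    then show "spanning_cost n \<delta> T\<^sub>0 \<le> x" using T unfolding minimum_spanning_tree_def by fastforce
  qed
  moreover have "general_cost n \<delta> (attach_leaves n T\<^sub>0) \<le> 2 * spanning_cost n \<delta> T\<^sub>0"
    using general_cost_attach_leaves[OF _ n \<delta>] T by (simp add: minimum_spanning_tree_def)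
  ultimately show ?thesis using cost by simp
qed

section \<open>Prim's algorithm\<close>

text \<open>The cut property. If the minimum tree \<open>M\<close> lacks the cheapest edge out of
  \<open>S\<close>, that edge is exchanged for an edge of \<open>M\<close> leaving \<open>S\<close>,
  which is no cheaper and cannot belong to \<open>A\<close>, whose edges stay inside
  \<open>S\<close>.\<close>

lemma minimum_spanning_tree_extend:
  assumes M: "minimum_spanning_tree n \<delta> M"
    and sym: "\<And>i j. i \<in> {1..n} \<Longrightarrow> j \<in> {1..n} \<Longrightarrow> \<delta> i j = \<delta> j i"
    and A: "A \<subseteq> edges M" "\<And>e. e \<in> A \<Longrightarrow> e \<subseteq> S"
    and uv: "u \<in> S" "u \<in> {1..n}" "v \<in> {1..n}" "v \<notin> S"
    and least: "\<And>x y. x \<in> S \<Longrightarrow> x \<in> {1..n} \<Longrightarrow> y \<in> {1..n} \<Longrightarrow> y \<notin> S \<Longrightarrow> \<delta> u v \<le> \<delta> x y"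
  shows "\<exists>M'. minimum_spanning_tree n \<delta> M' \<and> insert {u, v} A \<subseteq> edges M'"
proof (cases "{u, v} \<in> edges M")
  case True
  then show ?thesis using M A(1) by blast
next
  case False
  have T: "is_tree M" and V: "verts M = {1..n}"
    using M by (auto simp: minimum_spanning_tree_def spanning_tree_def)
  note sg = is_treeD(1)[OF T]
  obtain x y where xy: "x \<in> S" "y \<notin> S" "{x, y} \<in> edges M"
    and T': "is_tree (gr (verts M) (insert {u, v} (edges M - {{x, y}})))"
    using exchange_tree[OF T uv(1,4) _ _ False] uv(2,3) V by metis
  let ?M = "gr {1..n} (insert {u, v} (edges M - {{x, y}}))"
  have M': "is_tree ?M" using T' V by simp
  have xyV: "x \<in> {1..n}" "y \<in> {1..n}" using simple_graph_edgeD[OF sg xy(3)] V by auto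
  note fin = simple_graph_finite(2)[OF sg]
  have "spanning_cost n \<delta> ?M = edge_cost \<delta> {u, v} + sum (edge_cost \<delta>) (edges M - {{x, y}})"
    using spanning_cost_eq[OF is_treeD(1)[OF M'], of n \<delta>] fin False by simp
  also have "edge_cost \<delta> {u, v} \<le> edge_cost \<delta> {x, y}"
    using edge_cost_pair[of \<delta>, OF sym[OF uv(2,3)]] edge_cost_pair[of \<delta>, OF sym[OF xyV]] least[OF xy(1) xyV xy(2)]
    by simp
  also have "edge_cost \<delta> {x, y} + sum (edge_cost \<delta>) (edges M - {{x, y}}) = spanning_cost n \<delta> M"
    using spanning_cost_eq[OF sg V, of \<delta>] sum.remove[OF fin xy(3), of "edge_cost \<delta>"] by simp
  finally have "spanning_cost n \<delta> ?M \<le> spanning_cost n \<delta> M" by simp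
  moreover have "\<forall>G'. spanning_tree n G' \<longrightarrow> spanning_cost n \<delta> M \<le> spanning_cost n \<delta> G'"
    using M by (simp add: minimum_spanning_tree_def)
  ultimately have "\<forall>G'. spanning_tree n G' \<longrightarrow> spanning_cost n \<delta> ?M \<le> spanning_cost n \<delta> G'"
    by (meson order_trans)
  moreover have "spanning_tree n ?M" using M' by (simp add: spanning_tree_def)
  ultimately have "minimum_spanning_tree n \<delta> ?M" by (simp only: minimum_spanning_tree_def)
  moreover have "{x, y} \<notin> A" using A(2) xy(2) by blast
  then have "insert {u, v} A \<subseteq> edges ?M" using A(1) by auto
  ultimately show ?thesis by blast
qed

definition pairs :: "nat list \<Rightarrow> (nat \<times> nat) list" where
  "pairs V = concat (map (\<lambda>u. map (\<lambda>v. (u, v)) V) V)"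

definition crossing :: "nat list \<Rightarrow> nat list \<Rightarrow> (nat \<times> nat) list" where
  "crossing V S = filter (\<lambda>p. fst p \<in> set S \<and> \<not> snd p \<in> set S) (pairs V)"

definition cheapest_crossing :: "(nat \<Rightarrow> nat \<Rightarrow> rat) \<Rightarrow> nat list \<Rightarrow> nat list \<Rightarrow> nat \<times> nat" where
  "cheapest_crossing d V S =
    best (\<lambda>p. d (fst p) (snd p)) (crossing V S) (nth_default (0, 0) (crossing V S) 0)"

definition prim_step :: "(nat \<Rightarrow> nat \<Rightarrow> rat) \<Rightarrow> nat list \<Rightarrow> nat list \<times> (nat \<times> nat) list \<Rightarrow> nat list \<times> (nat \<times> nat) list" where
  "prim_step d V s = (if crossing V (fst s) = [] then s
     else (snd (cheapest_crossing d V (fst s)) # fst s, cheapest_crossing d V (fst s) # snd s))"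

text \<open>There is one round for each species, while n - 1 edges complete the tree from species 1;
  the last round finds no crossing edge and is idle.\<close>

definition prim :: "(nat \<Rightarrow> nat \<Rightarrow> rat) \<Rightarrow> nat list \<Rightarrow> (nat \<times> nat) list" where
  "prim d V = snd (fold (\<lambda>_. prim_step d V) V ([1], []))"

definition edge_set :: "(nat \<times> nat) list \<Rightarrow> nat set set" where
  "edge_set es = set (map (\<lambda>(u, v). {u, v}) es)"

text \<open>Besides some minimum spanning tree above the chosen edges, it records that these are
  distinct and how many there are, so that in the end they can be shown to exhaust that
  tree.\<close>

definition prim_invariant :: "nat \<Rightarrow> (nat \<Rightarrow> nat \<Rightarrow> real) \<Rightarrow> nat list \<times> (nat \<times> nat) list \<Rightarrow> bool" where
  "prim_invariant n \<delta> s \<longleftrightarrow> distinct (fst s) \<and> set (fst s) \<subseteq> {1..n} \<and> 1 \<in> set (fst s) \<and>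
     length (fst s) = Suc (length (snd s)) \<and> distinct (map (\<lambda>(u, v). {u, v}) (snd s)) \<and>
     (\<forall>e\<in>edge_set (snd s). e \<subseteq> set (fst s)) \<and>
     (\<exists>M. minimum_spanning_tree n \<delta> M \<and> edge_set (snd s) \<subseteq> edges M)"

lemma set_pairs: "set (pairs V) = set V \<times> set V"
  by (auto simp: pairs_def)

lemma set_crossing: "set (crossing V S) = {(u, v). u \<in> set V \<inter> set S \<and> v \<in> set V - set S}"
  by (auto simp: crossing_def set_pairs)

lemma prim_step_invariant:
  assumes inv: "prim_invariant n \<delta> s" and V: "V = [1..<Suc n]"
    and \<delta>: "bme_instance n \<delta>" and d: "\<forall>i\<in>{1..n}. \<forall>j\<in>{1..n}. of_rat (d i j) = \<delta> i j"
  shows "prim_invariant n \<delta> (prim_step d V s)"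
    "length (fst s) < n \<Longrightarrow> length (fst (prim_step d V s)) = Suc (length (fst s))"
    "length (fst s) \<ge> n \<Longrightarrow> prim_step d V s = s"
proof -
  obtain S A where s: "s = (S, A)" by (cases s)
  have S: "distinct S" "set S \<subseteq> {1..n}" "1 \<in> set S" "length S = Suc (length A)"
    and A: "distinct (map (\<lambda>(u, v). {u, v}) A)" "\<And>e. e \<in> edge_set A \<Longrightarrow> e \<subseteq> set S"
    using inv by (auto simp: prim_invariant_def s)
  obtain M where M: "minimum_spanning_tree n \<delta> M" "edge_set A \<subseteq> edges M"
    using inv by (auto simp: prim_invariant_def s)
  have sV: "set V = {1..n}" using V by auto
  have cr: "set (crossing V S) = {(u, v). u \<in> set S \<and> v \<in> {1..n} - set S}"
    using set_crossing[of V S] sV S(2) by blast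
  have step: "prim_invariant n \<delta> (prim_step d V s) \<and> length (fst (prim_step d V s)) = Suc (length S)"
    if ne: "crossing V S \<noteq> []"
  proof -
    let ?c = "\<lambda>p. d (fst p) (snd p)"
    obtain u v where uv: "cheapest_crossing d V S = (u, v)" by (cases "cheapest_crossing d V S")
    have hd: "nth_default (0, 0) (crossing V S) 0 \<in> set (crossing V S)"
      using ne by (simp add: nth_default_def)
    then have "cheapest_crossing d V S \<in> set (crossing V S)"
      unfolding cheapest_crossing_def using best_cases[of ?c "crossing V S" "nth_default (0, 0) (crossing V S) 0"] by auto
    then have uvS: "u \<in> set S" "v \<in> {1..n}" "v \<notin> set S" using uv cr by auto
    then have uV: "u \<in> {1..n}" using S(2) by blast
    have "\<delta> u v \<le> \<delta> x y" if "x \<in> set S" "x \<in> {1..n}" "y \<in> {1..n}" "y \<notin> set S" for x y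
    proof -
      have "(x, y) \<in> set (crossing V S)" using that cr by blast
      then have "?c (cheapest_crossing d V S) \<le> ?c (x, y)"
        unfolding cheapest_crossing_def by (intro best_le) blast
      then have "d u v \<le> d x y" using uv by simp
      then have "real_of_rat (d u v) \<le> of_rat (d x y)" by (simp add: of_rat_less_eq)
      then show ?thesis using d uV uvS that by simp
    qed
    moreover have "\<delta> i j = \<delta> j i" if "i \<in> {1..n}" "j \<in> {1..n}" for i j
      using \<delta> that unfolding bme_instance_def by blast
    ultimately obtain M' where M': "minimum_spanning_tree n \<delta> M'" "insert {u, v} (edge_set A) \<subseteq> edges M'"
      using minimum_spanning_tree_extend[OF M(1) _ M(2) A(2) uvS(1) uV uvS(2,3)] by metis
    have eq: "prim_step d V s = (v # S, (u, v) # A)" using ne uv by (simp add: prim_step_def s)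
    have "{u, v} \<notin> edge_set A" using A(2)[of "{u, v}"] uvS(3) by blast
    then have "prim_invariant n \<delta> (v # S, (u, v) # A)"
      unfolding prim_invariant_def using S A uvS M' by (auto simp: edge_set_def)
    then show ?thesis unfolding eq by simp
  qed
  then show "prim_invariant n \<delta> (prim_step d V s)"
    using inv by (cases "crossing V S = []") (simp_all add: prim_step_def s)
  have cardS: "card (set S) = length S" using S(1) by (rule distinct_card)
  show "length (fst (prim_step d V s)) = Suc (length (fst s))" if "length (fst s) < n"
  proof -
    have "set S \<noteq> {1..n}" using that cardS s by auto
    then obtain y where "y \<in> {1..n} - set S" using S(2) by blast
    then have "(1, y) \<in> set (crossing V S)" using cr S(3) by blast
    then have "crossing V S \<noteq> []" by auto
    then show ?thesis using step s by simp
  qed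
  show "prim_step d V s = s" if "length (fst s) \<ge> n"
  proof -
    have "set S = {1..n}" using that cardS s S(2) by (intro card_subset_eq) (auto intro: le_antisym dest: card_mono[rotated])
    then have "set (crossing V S) = {}" using cr by auto
    then show ?thesis by (simp add: prim_step_def s)
  qed
qed

text \<open>The n - 1 distinct edges chosen lie in a minimum spanning tree, which has only n - 1
  edges, so they are all of it.\<close>

lemma prim_correct:
  assumes n: "1 \<le> n" and V: "V = [1..<Suc n]" and \<delta>: "bme_instance n \<delta>"
    and d: "\<forall>i\<in>{1..n}. \<forall>j\<in>{1..n}. of_rat (d i j) = \<delta> i j"
  shows "\<exists>T. minimum_spanning_tree n \<delta> T \<and> lists_graph V (prim d V) T"
proof -
  note step = prim_step_invariant[OF _ V \<delta> d]
  have run: "prim_invariant n \<delta> (fold (\<lambda>_. prim_step d V) xs s) \<and> length (fst (fold (\<lambda>_. prim_step d V) xs s)) = n"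
    if "prim_invariant n \<delta> s" "length (fst s) \<le> n" "n \<le> length (fst s) + length xs" for xs :: "nat list" and s
    using that
  proof (induction xs arbitrary: s)
    case (Cons x xs)
    show ?case
    proof (cases "length (fst s) < n")
      case True
      have "length (fst (prim_step d V s)) = Suc (length (fst s))" by (rule step(2)[OF Cons.prems(1) True])
      then show ?thesis using Cons.IH[OF step(1)[OF Cons.prems(1)]] Cons.prems True by simp
    next
      case False
      then have "prim_step d V s = s" using step(3)[OF Cons.prems(1)] by simp
      then show ?thesis using Cons.IH[OF Cons.prems(1)] Cons.prems False by simp
    qed
  qed simp
  have "prim_invariant n \<delta> ([1], [])"
    using exists_minimum_spanning_tree[OF n] n by (simp add: prim_invariant_def edge_set_def)
  moreover have "length V = n" using V by simp
  ultimately have "prim_invariant n \<delta> (fold (\<lambda>_. prim_step d V) V ([1], [])) \<and>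
      length (fst (fold (\<lambda>_. prim_step d V) V ([1], []))) = n"
    using run[of "([1], [])" V] n by simp
  then obtain T where T: "minimum_spanning_tree n \<delta> T" "edge_set (prim d V) \<subseteq> edges T"
    and dist: "distinct (map (\<lambda>(u, v). {u, v}) (prim d V))" and len: "Suc (length (prim d V)) = n"
    unfolding prim_invariant_def prim_def by auto
  have tree: "is_tree T" and VT: "verts T = {1..n}"
    using T(1) by (auto simp: minimum_spanning_tree_def spanning_tree_def)
  have "card (edge_set (prim d V)) = length (prim d V)"
    unfolding edge_set_def distinct_card[OF dist] by simp
  then have "card (edge_set (prim d V)) = card (edges T)"
    using is_treeD(4)[OF tree] VT len by simp
  then have "edge_set (prim d V) = edges T"
    by (rule card_subset_eq[OF simple_graph_finite(2)[OF is_treeD(1)[OF tree]] T(2)])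
  then have "lists_graph V (prim d V) T"
    using dist VT V by (auto simp: lists_graph_def edge_set_def)
  then show ?thesis using T(1) by blast
qed

section \<open>Resolution into a cubic tree\<close>

text \<open>This is \<open>path_weight\<close> as a loop: the state holds the two current ends and
  the product so far. When both ends meet at \<open>u\<close> they become equal, which marks the
  product as complete.\<close>

definition climb_step :: "nat \<times> nat list \<Rightarrow> nat \<times> nat \<times> rat \<Rightarrow> nat \<times> nat \<times> rat" where
  "climb_step e s = (if fst s = fst (snd s) then s
     else if fst s \<in> set (snd e)
       then (fst e, if fst (snd s) \<in> set (snd e) then fst e else fst (snd s), snd (snd s) / of_nat (length (snd e)))
     else if fst (snd s) \<in> set (snd e)
       then (fst s, fst e, snd (snd s) / of_nat (length (snd e)))
     else s)"

definition climb :: "bundles \<Rightarrow> nat \<Rightarrow> nat \<Rightarrow> rat" where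
  "climb E a b = snd (snd (fold climb_step E (a, b, 1)))"

lemma fold_climb_step:
  assumes "wf_bundles L E" "a \<in> L" "b \<in> L" "a \<noteq> b"
  shows "snd (snd (fold climb_step E (a, b, w))) = w * path_weight E a b"
  using assms
proof (induction L E arbitrary: a b w rule: wf_bundles.induct)
  case (2 L u cs E)
  have wf': "wf_bundles (insert u (L - set cs)) E" and u: "u \<noteq> a" "u \<noteq> b" using 2(2-4) by auto
  note IH = 2(1)[OF wf']
  have step: "climb_step (u, cs) (a, b, w) = (if a = b then (a, b, w)
     else if a \<in> set cs then (u, if b \<in> set cs then u else b, w / of_nat (length cs))
     else if b \<in> set cs then (a, u, w / of_nat (length cs)) else (a, b, w))"
    by (simp add: climb_step_def)
  have stop: "fold climb_step E (x, x, v) = (x, x, v)" for E x v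
    by (induction E) (simp_all add: climb_step_def)
  consider "a \<in> set cs" "b \<in> set cs" | "a \<in> set cs" "b \<notin> set cs" | "a \<notin> set cs" "b \<in> set cs"
    | "a \<notin> set cs" "b \<notin> set cs" by blast
  then show ?case
  proof cases
    case 1
    then show ?thesis using 2(5) by (simp add: step stop)
  next
    case 2
    then show ?thesis using IH[of u b] "2.prems" u by (auto simp: step)
  next
    case 3
    then show ?thesis using IH[of a u] "2.prems" u by (auto simp: step)
  next
    case 4
    then show ?thesis using IH[of a b] "2.prems" by (simp add: step)
  qed
qed simp

definition list_cost :: "(nat \<Rightarrow> nat \<Rightarrow> rat) \<Rightarrow> nat list \<Rightarrow> bundles \<Rightarrow> rat" where
  "list_cost d V E = sum_list (map (\<lambda>p. if fst p = snd p then 0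
     else d (fst p) (snd p) * climb E (fst p) (snd p)) (pairs V))"

lemma sum_list_concat: "sum_list (concat xss) = (sum_list (map sum_list xss) :: 'a :: monoid_add)"
  by (induction xss) auto

lemma list_cost_eq:
  assumes "wf_bundles (set V) E" "distinct V"
  shows "list_cost d V E = bundle_cost (set V) d E"
proof -
  let ?f = "\<lambda>u v. if u = v then 0 else d u v * climb E u v"
  have "list_cost d V E = sum_list (map (\<lambda>u. sum_list (map (?f u) V)) V)"
    by (simp add: list_cost_def pairs_def map_concat sum_list_concat o_def cong: if_cong)
  also have "\<dots> = (\<Sum>u\<in>set V. \<Sum>v\<in>set V. ?f u v)"
    using assms(2) by (simp add: sum_list_distinct_conv_sum_set)
  also have "\<dots> = bundle_cost (set V) d E"
    unfolding bundle_cost_def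
  proof (rule sum.cong[OF refl])
    fix u assume u: "u \<in> set V"
    have "(\<Sum>v\<in>set V. ?f u v) = ?f u u + (\<Sum>v\<in>set V - {u}. ?f u v)"
      using u by (intro sum.remove) auto
    also have "(\<Sum>v\<in>set V - {u}. ?f u v) = (\<Sum>v\<in>set V - {u}. d u v * path_weight E u v)"
    proof (rule sum.cong[OF refl])
      fix v assume "v \<in> set V - {u}"
      then have v: "v \<in> set V" "u \<noteq> v" by auto
      show "?f u v = d u v * path_weight E u v"
        using fold_climb_step[OF assms(1) u v, of 1] v(2) by (simp add: climb_def)
    qed
    finally show "(\<Sum>v\<in>set V. ?f u v) = (\<Sum>v\<in>set V - {u}. d u v * path_weight E u v)" by simp
  qed
  finally show ?thesis .
qed

definition split_candidates :: "nat \<Rightarrow> bundles \<Rightarrow> bundles list" where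
  "split_candidates r E = concat (map (\<lambda>i.
     if 2 < length (snd (nth_default (0, []) E i))
     then map (\<lambda>q. take i E @ split_bundle r q (nth_default (0, []) E i) @ drop (Suc i) E)
       (snd (nth_default (0, []) E i))
     else []) [0..<length E])"

definition resolve_step :: "(bundles \<Rightarrow> rat) \<Rightarrow> nat \<Rightarrow> bundles \<Rightarrow> bundles" where
  "resolve_step f r E = (if split_candidates r E = [] then E
     else best f (split_candidates r E) (nth_default [] (split_candidates r E) 0))"

lemma split_candidates_iff:
  "E' \<in> set (split_candidates r E) \<longleftrightarrow> (\<exists>pre u cs post q. E = pre @ (u, cs) # post \<and>
     2 < length cs \<and> q \<in> set cs \<and> E' = pre @ split_bundle r q (u, cs) @ post)" (is "_ \<longleftrightarrow> ?R")
proof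
  assume "E' \<in> set (split_candidates r E)"
  then obtain i q where i: "i < length E" "2 < length (snd (E ! i))" "q \<in> set (snd (E ! i))"
    "E' = take i E @ split_bundle r q (E ! i) @ drop (Suc i) E"
    by (auto simp: split_candidates_def nth_default_def split: if_splits)
  have "E = take i E @ (fst (E ! i), snd (E ! i)) # drop (Suc i) E"
    using id_take_nth_drop[OF i(1)] by simp
  moreover have "E' = take i E @ split_bundle r q (fst (E ! i), snd (E ! i)) @ drop (Suc i) E"
    using i(4) by simp
  ultimately show ?R using i(2,3) by blast
next
  assume ?R
  then obtain pre u cs post q where E: "E = pre @ (u, cs) # post" "2 < length cs" "q \<in> set cs"
    "E' = pre @ split_bundle r q (u, cs) @ post" by blast
  let ?i = "length pre"
  have "?i \<in> set [0..<length E]" "nth_default (0, []) E ?i = (u, cs)" "take ?i E = pre" "drop (Suc ?i) E = post"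
    using E(1) by (simp_all add: nth_default_def)
  then show "E' \<in> set (split_candidates r E)"
    unfolding split_candidates_def set_concat set_map using E(2-4)
    by (intro UN_I[of "map _ _"] image_eqI[of _ _ ?i]) auto
qed

text \<open>For any bundle that is too large, \<open>exists_split_le\<close> provides one candidate
  that does not raise the cost, and the best candidate is no worse. If there are no candidates, the
  tree is already cubic.\<close>

lemma resolve_step_correct:
  assumes wf: "wf_bundles L E" and r: "r \<notin> L" "r \<notin> fst ` set E"
    and f: "\<And>E. wf_bundles L E \<Longrightarrow> f E = bundle_cost L d E"
  shows "wf_bundles L (resolve_step f r E)" "excess (resolve_step f r E) = excess E - 1"
    "bundle_cost L d (resolve_step f r E) \<le> bundle_cost L d E"
    "fst ` set (resolve_step f r E) \<subseteq> insert r (fst ` set E)"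
proof -
  let ?C = "split_candidates r E"
  have cand: "wf_bundles L E' \<and> excess E' = excess E - 1 \<and> fst ` set E' \<subseteq> insert r (fst ` set E)"
    if E': "E' \<in> set ?C" for E'
  proof -
    obtain pre u cs post q where E: "E = pre @ (u, cs) # post" "2 < length cs" "q \<in> set cs"
      "E' = pre @ split_bundle r q (u, cs) @ post" using E' unfolding split_candidates_iff by blast
    then show ?thesis
      using wf_bundles_split[of L pre u cs post q r] excess_split[of L pre u cs post q r] wf r
      by (auto simp: split_bundle_def)
  qed
  have "wf_bundles L (resolve_step f r E) \<and> excess (resolve_step f r E) = excess E - 1 \<and>
    bundle_cost L d (resolve_step f r E) \<le> bundle_cost L d E \<and>
    fst ` set (resolve_step f r E) \<subseteq> insert r (fst ` set E)"
  proof (cases "?C = []")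
    case True
    have "excess E = 0"
    proof (rule ccontr)
      assume "excess E \<noteq> 0"
      then obtain u cs where ucs: "(u, cs) \<in> set E" "length cs \<noteq> 2" using excess_0_iff[OF wf] by auto
      then have len: "2 < length cs" using bundle_length[OF wf ucs(1)] by simp
      then obtain q where "q \<in> set cs" by (metis length_pos_if_in_set list.set_intros(1) neq_Nil_conv not_less_zero length_0_conv)
      moreover obtain pre post where "E = pre @ (u, cs) # post" using split_list[OF ucs(1)] by blast
      ultimately have "pre @ split_bundle r q (u, cs) @ post \<in> set ?C"
        using len unfolding split_candidates_iff by blast
      then show False using True by simp
    qed
    then show ?thesis using True wf by (auto simp: resolve_step_def)
  next
    case False
    let ?b = "best f ?C (nth_default [] ?C 0)"
    have hd: "nth_default [] ?C 0 \<in> set ?C" using False by (simp add: nth_default_def)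
    then have b: "?b \<in> set ?C" using best_cases[of f ?C "nth_default [] ?C 0"] by auto
    obtain pre u cs post where E: "E = pre @ (u, cs) # post" "2 < length cs"
      using hd unfolding split_candidates_iff by blast
    obtain q where q: "q \<in> set cs"
      "bundle_cost L d (pre @ split_bundle r q (u, cs) @ post) \<le> bundle_cost L d E"
      using exists_split_le[of L pre u cs post r d] wf r E by blast
    let ?E = "pre @ split_bundle r q (u, cs) @ post"
    have E': "?E \<in> set ?C" using E q(1) unfolding split_candidates_iff by blast
    have "f ?b \<le> f ?E" using E' by (intro best_le) blast
    then have "bundle_cost L d ?b \<le> bundle_cost L d ?E" using f cand[OF b] cand[OF E'] by simp
    then show ?thesis using cand[OF b] q(2) False by (simp add: resolve_step_def)
  qed
  then show "wf_bundles L (resolve_step f r E)" "excess (resolve_step f r E) = excess E - 1"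
    "bundle_cost L d (resolve_step f r E) \<le> bundle_cost L d E"
    "fst ` set (resolve_step f r E) \<subseteq> insert r (fst ` set E)" by blast+
qed

text \<open>Names left over when the tree has become cubic are ignored, as the truncated subtraction
  expresses.\<close>

lemma fold_resolve_correct:
  assumes f: "\<And>E. wf_bundles L E \<Longrightarrow> f E = bundle_cost L d E"
    and "wf_bundles L E" "distinct rs" "set rs \<inter> (L \<union> fst ` set E) = {}"
  shows "wf_bundles L (fold (resolve_step f) rs E) \<and>
    excess (fold (resolve_step f) rs E) = excess E - length rs \<and>
    bundle_cost L d (fold (resolve_step f) rs E) \<le> bundle_cost L d E"
  using assms(2-)
proof (induction rs arbitrary: E)
  case (Cons r rs)
  have r: "r \<notin> L" "r \<notin> fst ` set E" using Cons.prems(3) by auto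
  note step = resolve_step_correct[OF Cons.prems(1) r f]
  have "set rs \<inter> (L \<union> fst ` set (resolve_step f r E)) = {}"
    using step(4) Cons.prems(2,3) by auto
  then have "wf_bundles L (fold (resolve_step f) rs (resolve_step f r E)) \<and>
    excess (fold (resolve_step f) rs (resolve_step f r E)) = excess (resolve_step f r E) - length rs \<and>
    bundle_cost L d (fold (resolve_step f) rs (resolve_step f r E)) \<le> bundle_cost L d (resolve_step f r E)"
    using Cons.IH[OF step(1)] Cons.prems(2) by simp
  then show ?case using step(2,3) by simp
qed simp

section \<open>The algorithm on lists\<close>

definition edge_list :: "bundles \<Rightarrow> (nat \<times> nat) list" where
  "edge_list E = concat (map (\<lambda>e. map (\<lambda>c. (fst e, c)) (snd e)) E)"

text \<open>Two vertices are removed by no bundle; they span the last edge, which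
  \<open>edge_list\<close> does not contain.\<close>

definition output_lists :: "nat list \<Rightarrow> bundles \<Rightarrow> (nat list \<times> (nat \<times> nat) list) \<times> nat list" where
  "output_lists V E = ((V @ map fst E, edge_list E @
     [(nth_default 0 (remaining (V @ map fst E) E) 0, nth_default 0 (remaining (V @ map fst E) E) 1)]), V)"

text \<open>The pair at which the recursion \<open>bundle_edges\<close> stops consists of the
  vertices that occur in no bundle as a child. The length is computed for the distinctness argument
  in \<open>output_lists_correct\<close>.\<close>

lemma bundle_edges_eq:
  assumes "wf_bundles L E"
  shows "bundle_edges L E = edge_set (edge_list E) \<union> {(L \<union> fst ` set E) - set (concat (map snd E))}"
    "card ((L \<union> fst ` set E) - set (concat (map snd E))) = 2"
    "length (edge_list E) + 2 = card L + length E" "distinct (map fst E)"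
proof -
  have "bundle_edges L E = edge_set (edge_list E) \<union> {(L \<union> fst ` set E) - set (concat (map snd E))} \<and>
    card ((L \<union> fst ` set E) - set (concat (map snd E))) = 2 \<and>
    length (edge_list E) + 2 = card L + length E \<and> distinct (map fst E)"
    using assms
  proof (induction L E rule: wf_bundles.induct)
    case (1 L)
    then show ?case by (simp add: edge_set_def edge_list_def)
  next
    case (2 L u cs E)
    have wf': "wf_bundles (insert u (L - set cs)) E" and cs: "distinct cs" "set cs \<subseteq> L" "u \<notin> L"
      "set cs \<inter> fst ` set E = {}" using 2(2) by simp_all
    note IH = 2(1)[OF wf']
    have fin: "finite L" using wf_bundles_finite[OF 2(2)] .
    have u: "u \<notin> fst ` set E" using wf_bundles_fresh[OF wf'] by blast
    have F: "(insert u (L - set cs) \<union> fst ` set E) - set (concat (map snd E)) =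
      (L \<union> fst ` set ((u, cs) # E)) - set (concat (map snd ((u, cs) # E)))"
      using cs by auto
    have "edge_set (edge_list ((u, cs) # E)) = (\<lambda>c. {u, c}) ` set cs \<union> edge_set (edge_list E)"
      by (simp add: edge_set_def edge_list_def image_Un image_image)
    then have edges: "bundle_edges L ((u, cs) # E) = edge_set (edge_list ((u, cs) # E)) \<union>
      {(L \<union> fst ` set ((u, cs) # E)) - set (concat (map snd ((u, cs) # E)))}"
      using IH F by auto
    have card': "card (insert u (L - set cs)) = Suc (card L - length cs)"
      using cs fin by (simp add: card_Diff_subset distinct_card)
    have "length (edge_list E) + 2 = card (insert u (L - set cs)) + length E" using IH by blast
    moreover have "length cs \<le> card L" using card_mono[OF fin cs(2)] cs(1) by (simp add: distinct_card)
    moreover have "length (edge_list ((u, cs) # E)) = length cs + length (edge_list E)"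
      by (simp add: edge_list_def)
    ultimately have "length (edge_list ((u, cs) # E)) + 2 = card L + length ((u, cs) # E)" using card' by simp
    then show ?case using edges IH u F by simp
  qed
  then show "bundle_edges L E = edge_set (edge_list E) \<union> {(L \<union> fst ` set E) - set (concat (map snd E))}"
    "card ((L \<union> fst ` set E) - set (concat (map snd E))) = 2"
    "length (edge_list E) + 2 = card L + length E" "distinct (map fst E)" by blast+
qed

text \<open>That no edge is listed twice follows by counting: the list is as long as the tree has
  edges.\<close>

lemma output_lists_correct:
  assumes wf: "wf_bundles (set V) E" and V: "distinct V"
  shows "lists_graph (fst (fst (output_lists V E))) (snd (fst (output_lists V E))) (bundle_graph (set V) E)"
proof -
  let ?R = "remaining (V @ map fst E) E" and ?G = "bundle_graph (set V) E"
  let ?es = "snd (fst (output_lists V E))"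
  note eq = bundle_edges_eq[OF wf]
  have dist: "distinct (V @ map fst E)" using V eq(4) wf_bundles_fresh[OF wf] by simp
  have R: "set ?R = (set V \<union> fst ` set E) - set (concat (map snd E))"
    by (auto simp: remaining_def)
  have "distinct ?R" using dist unfolding remaining_def by (rule distinct_filter)
  then have "length ?R = 2" using eq(2) R distinct_card by metis
  then obtain x y where xy: "?R = [x, y]" by (auto simp: length_Suc_conv numeral_2_eq_2)
  have es: "?es = edge_list E @ [(x, y)]" by (simp add: output_lists_def xy nth_default_def)
  have "set ?R = {x, y}" using xy by simp
  then have set: "edge_set ?es = edges ?G"
    unfolding es bundle_graph_def graph.select_convs eq(1) R[symmetric] by (simp add: edge_set_def)
  have "card (edges ?G) + 1 = card (verts ?G)" by (rule is_treeD(4)[OF bundle_graph_tree[OF wf]])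
  moreover have "card (verts ?G) = length (V @ map fst E)"
    using distinct_card[OF dist] by (simp add: bundle_graph_def)
  ultimately have "card (edge_set ?es) = length ?es"
    using eq(3) distinct_card[OF V] set es by simp
  then have "distinct (map (\<lambda>(u, v). {u, v}) ?es)"
    unfolding edge_set_def by (intro card_distinct) simp
  then show ?thesis using set dist by (simp add: lists_graph_def edge_set_def output_lists_def bundle_graph_def)
qed

definition multiple :: "(nat \<times> nat) list \<Rightarrow> nat list \<Rightarrow> nat list" where
  "multiple A V = filter (\<lambda>i. length (filter (\<lambda>p. fst p = i \<or> snd p = i) A) \<noteq> 1) V"

definition rename :: "nat \<Rightarrow> nat list \<Rightarrow> nat \<Rightarrow> nat" where
  "rename n I i = (if i \<in> set I then n + i else i)"

definition attach_lists :: "nat list \<Rightarrow> (nat \<times> nat) list \<Rightarrow> nat list \<times> (nat \<times> nat) list" where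
  "attach_lists V A = (V @ map (\<lambda>i. length V + i) (multiple A V),
     map (\<lambda>p. (rename (length V) (multiple A V) (fst p), rename (length V) (multiple A V) (snd p))) A @
     map (\<lambda>i. (i, length V + i)) (multiple A V))"

lemma attach_lists_correct:
  assumes T: "spanning_tree n G" and n: "2 \<le> n" and V: "V = [1..<Suc n]" and A: "lists_graph V A G"
  shows "lists_graph (fst (attach_lists V A)) (snd (attach_lists V A)) (attach_leaves n G)"
proof -
  let ?I = "internal G" and ?H = "attach_leaves n G" and ?es = "snd (attach_lists V A)"
  have VG: "verts G = {1..n}" and G: "is_tree G" using T by (auto simp: spanning_tree_def)
  have sV: "set V = {1..n}" "distinct V" "length V = n" using V by auto
  have dA: "distinct (map (\<lambda>(u, v). {u, v}) A)" and eA: "set (map (\<lambda>(u, v). {u, v}) A) = edges G"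
    using A by (simp_all add: lists_graph_def)
  have deg: "length (filter (\<lambda>p. fst p = i \<or> snd p = i) A) = vertex_degree G i" for i
  proof -
    have "(\<lambda>p. fst p = i \<or> snd p = i) = (\<lambda>e. i \<in> e) \<circ> (\<lambda>(u, v). {u, v})" by (auto simp: fun_eq_iff)
    then have "length (filter (\<lambda>p. fst p = i \<or> snd p = i) A) = length (filter (\<lambda>e. i \<in> e) (map (\<lambda>(u, v). {u, v}) A))"
      by (simp add: filter_map)
    also have "\<dots> = card ({e. i \<in> e} \<inter> edges G)" using distinct_length_filter[OF dA] eA by simp
    also have "{e. i \<in> e} \<inter> edges G = {e \<in> edges G. i \<in> e}" by blast
    finally show ?thesis by (simp add: vertex_degree_def)
  qed
  have I: "set (multiple A V) = ?I"
    unfolding multiple_def deg by (auto simp: internal_def leaves_def VG sV)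
  have dI: "distinct (multiple A V)" using sV by (simp add: multiple_def)
  have IV: "?I \<subseteq> {1..n}" using VG by (auto simp: internal_def)
  have ren: "rename n (multiple A V) = relabel n ?I" by (auto simp: rename_def relabel_def I)
  have H: "?H = attached n ?I G" by (rule attach_leaves_eq[OF T])
  have es: "?es = map (\<lambda>p. (relabel n ?I (fst p), relabel n ?I (snd p))) A @ map (\<lambda>i. (i, n + i)) (multiple A V)"
    by (simp add: attach_lists_def sV ren)
  have "edge_set ?es = (\<lambda>p. {relabel n ?I (fst p), relabel n ?I (snd p)}) ` set A \<union> (\<lambda>i. {i, n + i}) ` ?I"
    by (simp add: edge_set_def es image_Un image_image I)
  also have "(\<lambda>p. {relabel n ?I (fst p), relabel n ?I (snd p)}) ` set A = (`) (relabel n ?I) ` edges G"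
    unfolding eA[symmetric] set_map image_image by (rule image_cong) auto
  finally have set: "edge_set ?es = edges ?H" by (simp add: H attached_def)
  have dV: "distinct (fst (attach_lists V A))"
    using sV dI I IV by (auto simp: attach_lists_def distinct_map)
  have VH: "set (fst (attach_lists V A)) = verts ?H"
    by (simp add: attach_lists_def sV H attached_def I)
  have "length A = card (edges G)" using distinct_card[OF dA] eA by simp
  then have "length ?es + 1 = length (fst (attach_lists V A))"
    using is_treeD(4)[OF G] VG by (simp add: attach_lists_def sV)
  also have "\<dots> = card (verts ?H)" using distinct_card[OF dV] VH by simp
  also have "\<dots> = card (edge_set ?es) + 1"
    using is_treeD(4)[OF attach_leaves_tree(1)[OF T n]] set by simp
  finally have "distinct (map (\<lambda>(u, v). {u, v}) ?es)"
    unfolding edge_set_def by (intro card_distinct) simp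
  then show ?thesis using set dV VH by (simp add: lists_graph_def edge_set_def)
qed

text \<open>Species are numbered from 1 but lists from 0; the dummy row and the dummy entry in front
  shift the indices.\<close>

definition entry :: "rat list list \<Rightarrow> nat \<Rightarrow> nat \<Rightarrow> rat" where
  "entry M i j = nth_default 0 (0 # nth_default [] ([] # M) i) j"

definition species :: "rat list list \<Rightarrow> nat list" where
  "species M = map Suc [0..<length M]"

text \<open>The vertices of the tree with attached leaves are at most 2n, so the names from 2n + 1
  to 3n are free. By \<open>excess_le\<close>, n of them suffice.\<close>

definition fresh_names :: "rat list list \<Rightarrow> nat list" where
  "fresh_names M = map (\<lambda>i. Suc (length M + length M + i)) [0..<length M]"

definition resolve :: "rat list list \<Rightarrow> bundles \<Rightarrow> bundles" where
  "resolve M E = fold (resolve_step (list_cost (entry M) (species M))) (fresh_names M) E"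

text \<open>The tree is passed as arbitrary lists, since the refinement has to work for whichever
  minimum spanning tree was computed, and in any order of listing.\<close>

definition solve_tree ::
    "rat list list \<Rightarrow> nat list \<Rightarrow> (nat \<times> nat) list \<Rightarrow> (nat list \<times> (nat \<times> nat) list) \<times> nat list" where
  "solve_tree M vs es = output_lists (species M) (resolve M (decompose vs es))"

definition mst_tree :: "rat list list \<Rightarrow> nat list \<times> (nat \<times> nat) list" where
  "mst_tree M = attach_lists (species M) (prim (entry M) (species M))"

definition matrix :: "nat \<Rightarrow> (nat \<Rightarrow> nat \<Rightarrow> rat) \<Rightarrow> rat list list" where
  "matrix n d = map (\<lambda>i. map (\<lambda>j. d i j) [1..<Suc n]) [1..<Suc n]"

lemma entry_matrix:
  assumes "i \<in> {1..n}" "j \<in> {1..n}"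
  shows "entry (matrix n d) i j = d i j"
proof -
  obtain i' j' where "i = Suc i'" "j = Suc j'" "i' < n" "j' < n"
    using assms by (cases i; cases j) auto
  then show ?thesis by (simp add: entry_def matrix_def nth_default_def del: upt_Suc)
qed

lemma species_matrix: "species (matrix n d) = [1..<Suc n]"
  unfolding species_def matrix_def map_Suc_upt by simp

lemma encode_solution:
  assumes "species M = [1..<Suc n]" "lists_graph (fst (fst (output_lists (species M) E))) (snd (fst (output_lists (species M) E))) G"
  shows "encodes_solution n (enc (output_lists (species M) E)) G (\<lambda>i. i)"
proof -
  have "enc (output_lists (species M) E) =
      Lst [enc_graph (fst (fst (output_lists (species M) E))) (snd (fst (output_lists (species M) E))), enc_labels n (\<lambda>i. i)]"
    using assms(1) by (simp add: output_lists_def encode_prod encode_list enc_graph_def enc_labels_def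
      encode_nat enc_nat_def case_prod_beta)
  then show ?thesis using assms(2) unfolding encodes_solution_def by blast
qed

lemma solve_tree_correct:
  assumes n: "2 \<le> n" and \<delta>: "bme_instance n (real_matrix d)"
    and G: "is_tree G" "leaves G = {1..n}" "\<And>v. v \<in> internal G \<Longrightarrow> 3 \<le> vertex_degree G v" "verts G \<subseteq> {1..2 * n}"
    and lists: "lists_graph vs es G"
  shows "\<exists>T' \<phi>. encodes_solution n (enc (solve_tree (matrix n d) vs es)) T' \<phi> \<and> feasible n T' \<phi> \<and>
    bme_cost n (real_matrix d) T' \<phi> \<le> general_cost n (real_matrix d) G"
proof -
  let ?M = "matrix n d" and ?E = "decompose vs es"
  let ?f = "list_cost (entry ?M) (species ?M)"
  define R where "R = resolve ?M ?E"
  have sp: "species ?M = [1..<Suc n]" by (rule species_matrix)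
  have set: "set (species ?M) = {1..n}" "distinct (species ?M)" unfolding sp by auto
  have wf: "wf_bundles {1..n} ?E" and GE: "bundle_graph {1..n} ?E = G"
    using decompose_correct[OF lists G(1,3)] by (simp_all add: G(2))
  have f: "?f E = bundle_cost {1..n} (entry ?M) E" if "wf_bundles {1..n} E" for E
    using list_cost_eq[of "species ?M" E] that set by simp
  have len: "length (fresh_names ?M) = n" "distinct (fresh_names ?M)" "set (fresh_names ?M) \<inter> {1..2 * n} = {}"
    by (auto simp: fresh_names_def matrix_def distinct_map inj_on_def)
  have "verts G = {1..n} \<union> fst ` set ?E" unfolding GE[symmetric] bundle_graph_def by simp
  then have "set (fresh_names ?M) \<inter> ({1..n} \<union> fst ` set ?E) = {}" using G(4) len(3) by blast
  from fold_resolve_correct[OF f wf len(2) this]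
  have R: "wf_bundles {1..n} R" "excess R = excess ?E - n"
      "bundle_cost {1..n} (entry ?M) R \<le> bundle_cost {1..n} (entry ?M) ?E"
    unfolding len(1) R_def resolve_def by auto
  have "excess R = 0" using R(2) excess_le[OF wf] by simp
  note sol = cubic_bundles_solution[OF R(1) this \<delta>]
  \<comment> \<open>The program compares costs over the rationals; embedding them into the reals
    carries the comparison over.\<close>
  have cost: "real_of_rat (bundle_cost {1..n} (entry ?M) E) = bundle_cost {1..n} (real_matrix d) E" for E
    unfolding bundle_cost_def of_rat_sum
    by (intro sum.cong refl) (auto simp: of_rat_mult of_rat_path_weight entry_matrix real_matrix_def)
  have "bundle_cost {1..n} (real_matrix d) R \<le> bundle_cost {1..n} (real_matrix d) ?E"
    using R(3) unfolding cost[symmetric] by (simp add: of_rat_less_eq)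
  then have "bme_cost n (real_matrix d) (bundle_graph {1..n} R) (\<lambda>i. i) \<le> general_cost n (real_matrix d) G"
    using sol(2) general_cost_bundle_graph[OF wf \<delta>] GE by simp
  moreover have "encodes_solution n (enc (solve_tree ?M vs es)) (bundle_graph {1..n} R) (\<lambda>i. i)"
    using encode_solution[OF sp, of R "bundle_graph {1..n} R"] output_lists_correct[of "species ?M" R] R(1) set
    by (simp add: solve_tree_def R_def)
  ultimately show ?thesis using sol(1) by blast
qed

section \<open>Polynomial running time of the algorithm\<close>

text \<open>A function of several arguments is analysed once, on tuples; these rules then allow any
  polynomial-time terms as its arguments.\<close>

lemma FP_apply2:
  assumes "FP (\<lambda>p. h (fst p) (snd p))" "FP f" "FP g"
  shows "FP (\<lambda>a. h (f a) (g a))"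
  using FP_compose[OF assms(1) FP_Pair[OF assms(2,3)]] by simp

lemma FP_apply3:
  assumes "FP (\<lambda>p. h (fst p) (fst (snd p)) (snd (snd p)))" "FP f" "FP g" "FP k"
  shows "FP (\<lambda>a. h (f a) (g a) (k a))"
  using FP_compose[OF assms(1) FP_Pair[OF assms(2) FP_Pair[OF assms(3,4)]]] by simp

lemma FP_Suc [FP_intros]: "FP f \<Longrightarrow> FP (\<lambda>a. Suc (f a))"
  using FP_plus(1)[OF _ FP_const[of 1]] by simp

lemma FP_entry [FP_intros]: "FP M \<Longrightarrow> FP i \<Longrightarrow> FP j \<Longrightarrow> FP (\<lambda>a. entry (M a) (i a) (j a))"
  by (rule FP_apply3[of entry], unfold entry_def, intro FP_intros)

lemma FP_pairs [FP_intros]: "FP V \<Longrightarrow> FP (\<lambda>a. pairs (V a))"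
  by (rule FP_compose[of pairs], unfold pairs_def, intro FP_intros)

lemma FP_crossing [FP_intros]: "FP V \<Longrightarrow> FP S \<Longrightarrow> FP (\<lambda>a. crossing (V a) (S a))"
  by (rule FP_apply2[of crossing], unfold crossing_def, intro FP_intros)

lemma FP_cheapest_crossing [FP_intros]:
  "FP M \<Longrightarrow> FP V \<Longrightarrow> FP S \<Longrightarrow> FP (\<lambda>a. cheapest_crossing (entry (M a)) (V a) (S a))"
  by (rule FP_apply3[of "\<lambda>M. cheapest_crossing (entry M)"], unfold cheapest_crossing_def, intro FP_intros)

lemma FP_prim_step [FP_intros]:
  "FP M \<Longrightarrow> FP V \<Longrightarrow> FP s \<Longrightarrow> FP (\<lambda>a. prim_step (entry (M a)) (V a) (s a))"
  by (rule FP_apply3[of "\<lambda>M. prim_step (entry M)"], unfold prim_step_def, intro FP_intros)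

lemma sz_filter_le: "sz (filter P xs) \<le> sz xs"
  by (induction xs) (auto simp: sz_simps)

lemma FP_prim [FP_intros]:
  assumes "FP M" "FP V"
  shows "FP (\<lambda>a. prim (entry (M a)) (V a))"
proof -
  have "FP (\<lambda>q. fold (\<lambda>_. prim_step (entry (fst q)) (snd q)) (snd q) ([1], []))"
  \<comment> \<open>A round adds one vertex and one pair, that is three names from the vertex list
    and the 1 of the pair.\<close>
  proof (rule FP_fold_additive[of _ _ _ "[:1, 3:]"])
    show "FP (\<lambda>p. prim_step (entry (fst (fst p))) (snd (fst p)) (snd (snd p)))" by (intro FP_intros)
    show "sz (prim_step (entry (fst a)) (snd a) s) \<le> sz s + poly [:1, 3:] (sz a + sz y)" for a s and y :: nat
    proof (cases "crossing (snd a) (fst s) = []")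
      case False
      let ?c = "cheapest_crossing (entry (fst a)) (snd a) (fst s)"
      have "nth_default (0, 0) (crossing (snd a) (fst s)) 0 \<in> set (crossing (snd a) (fst s))"
        using False by (simp add: nth_default_def)
      then have "?c \<in> set (crossing (snd a) (fst s))"
        unfolding cheapest_crossing_def by (metis best_cases insertE)
      then have "fst ?c \<in> set (snd a)" "snd ?c \<in> set (snd a)" by (auto simp: set_crossing)
      then have "sz (fst ?c) \<le> sz (snd a)" "sz (snd ?c) \<le> sz (snd a)" by (auto intro: sz_member)
      then show ?thesis using False by (simp add: prim_step_def sz_simps)
    qed (simp add: prim_step_def)
  qed (intro FP_intros)+
  then have "FP (\<lambda>q. prim (entry (fst q)) (snd q))" unfolding prim_def by (rule FP_snd)
  from FP_apply2[OF this assms] show ?thesis .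
qed

lemma FP_adjacent [FP_intros]: "FP es \<Longrightarrow> FP u \<Longrightarrow> FP v \<Longrightarrow> FP (\<lambda>a. adjacent (es a) (u a) (v a))"
  by (rule FP_apply3[of adjacent], unfold adjacent_def, intro FP_intros)

lemma FP_neighbours [FP_intros]: "FP es \<Longrightarrow> FP R \<Longrightarrow> FP u \<Longrightarrow> FP (\<lambda>a. neighbours (es a) (R a) (u a))"
  by (rule FP_apply3[of neighbours], unfold neighbours_def, intro FP_intros)

lemma FP_inner_neighbours [FP_intros]:
  "FP es \<Longrightarrow> FP R \<Longrightarrow> FP u \<Longrightarrow> FP (\<lambda>a. inner_neighbours (es a) (R a) (u a))"
  by (rule FP_apply3[of inner_neighbours], unfold inner_neighbours_def, intro FP_intros)

lemma FP_outer [FP_intros]: "FP es \<Longrightarrow> FP R \<Longrightarrow> FP u \<Longrightarrow> FP (\<lambda>a. outer (es a) (R a) (u a))"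
  by (rule FP_apply3[of outer], unfold outer_def, intro FP_intros)

lemma FP_leaf_bundle [FP_intros]: "FP es \<Longrightarrow> FP R \<Longrightarrow> FP u \<Longrightarrow> FP (\<lambda>a. leaf_bundle (es a) (R a) (u a))"
  by (rule FP_apply3[of leaf_bundle], unfold leaf_bundle_def, intro FP_intros)

lemma FP_remaining [FP_intros]: "FP vs \<Longrightarrow> FP E \<Longrightarrow> FP (\<lambda>a. remaining (vs a) (E a))"
  by (rule FP_apply2[of remaining], unfold remaining_def, intro FP_intros)

lemma FP_peel [FP_intros]: "FP vs \<Longrightarrow> FP es \<Longrightarrow> FP E \<Longrightarrow> FP (\<lambda>a. peel (vs a) (es a) (E a))"
  by (rule FP_apply3[of peel], unfold peel_def, intro FP_intros)

lemma FP_decompose [FP_intros]: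
  assumes "FP vs" "FP es"
  shows "FP (\<lambda>a. decompose (vs a) (es a))"
proof -
  have "FP (\<lambda>q. fold (\<lambda>_. peel (fst q) (snd q)) (fst q) [])"
  \<comment> \<open>A new bundle has a centre and a list of children, each at most as large as the
    vertex list.\<close>
  proof (rule FP_fold_additive[of _ _ _ "[:1, 2:]"])
    show "FP (\<lambda>p. peel (fst (fst p)) (snd (fst p)) (snd (snd p)))" by (intro FP_intros)
    show "sz (peel (fst a) (snd a) E) \<le> sz E + poly [:1, 2:] (sz a + sz y)" for a E and y :: nat
    proof -
      let ?R = "remaining (fst a) E"
      let ?C = "filter (outer (snd a) ?R) ?R"
      let ?u = "nth_default 0 ?C 0"
      let ?b = "leaf_bundle (snd a) ?R ?u"
      have R: "sz ?R \<le> sz (fst a)" unfolding remaining_def by (rule sz_filter_le)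
      have nb: "sz (neighbours (snd a) ?R v) \<le> sz (fst a)" for v
        unfolding neighbours_def by (rule order_trans[OF sz_filter_le R])
      have drop: "sz (drop 1 xs) \<le> sz xs" for xs :: "nat list"
        using sum_list_drop_le[of sz 1 xs] by (simp only: sz_simps)
      have "sz (snd ?b) \<le> sz (fst a)"
        using order_trans[OF drop nb] order_trans[OF sz_filter_le nb] by (simp add: leaf_bundle_def)
      moreover have "sz (fst ?b) \<le> sz (fst a)" if "?C \<noteq> []"
      proof -
        have "?u \<in> set ?C" using that by (simp add: nth_default_def del: set_filter)
        then have "sz ?u \<le> sz ?R" by (intro sz_member) simp
        then show ?thesis using R by (simp add: leaf_bundle_def)
      qed
      ultimately show ?thesis
        by (cases "?C = []") (simp_all add: peel_def sz_simps)
    qed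
  qed (intro FP_intros)+
  then have "FP (\<lambda>q. decompose (fst q) (snd q))" unfolding decompose_def .
  from FP_apply2[OF this assms] show ?thesis .
qed

lemma FP_climb_step [FP_intros]: "FP e \<Longrightarrow> FP s \<Longrightarrow> FP (\<lambda>a. climb_step (e a) (s a))"
  by (rule FP_apply2[of climb_step], unfold climb_step_def, intro FP_intros)

lemma FP_climb [FP_intros]:
  assumes "FP E" "FP u" "FP v"
  shows "FP (\<lambda>a. climb (E a) (u a) (v a))"
proof -
  have "FP (\<lambda>q. fold climb_step (fst q) (fst (snd q), snd (snd q), 1))"
  \<comment> \<open>At most two names are replaced by that of the centre, and dividing by the length
    lengthens the product by at most \<open>sz e + 1\<close>.\<close>
  proof (rule FP_fold_additive[of "\<lambda>_. climb_step" _ _ "[:2, 3:]"])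
    show "FP (\<lambda>p :: (bundles \<times> nat \<times> nat) \<times> (nat \<times> nat list) \<times> nat \<times> nat \<times> rat.
        climb_step (fst (snd p)) (snd (snd p)))" by (intro FP_intros)
    show "sz (climb_step e s) \<le> sz s + poly [:2, 3:] (sz a + sz e)" for a :: "bundles \<times> nat \<times> nat" and e s
    proof -
      have "rat_bits (rat_of_nat (length (snd e))) \<le> sz e"
        using length_le_sz[of "snd e"] floorlog_le_self[of "length (snd e)"]
        by (simp add: rat_bits_of_nat sz_simps(2))
      then have w: "sz (w / rat_of_nat (length (snd e))) \<le> sz w + sz e + 1" for w
        using rat_bits_divide[of w "rat_of_nat (length (snd e))"] by (simp add: sz_simps(3))
      have "sz (fst e) \<le> sz e" by (simp add: sz_simps(2))
      then show ?thesis using w[of "snd (snd s)"] by (simp add: climb_step_def sz_simps(2))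
    qed
  qed (intro FP_intros)+
  then have "FP (\<lambda>q. climb (fst q) (fst (snd q)) (snd (snd q)))" unfolding climb_def by (intro FP_snd)
  from FP_apply3[OF this assms] show ?thesis .
qed

lemma FP_list_cost [FP_intros]:
  "FP M \<Longrightarrow> FP V \<Longrightarrow> FP E \<Longrightarrow> FP (\<lambda>a. list_cost (entry (M a)) (V a) (E a))"
  by (rule FP_apply3[of "\<lambda>M. list_cost (entry M)"], unfold list_cost_def, intro FP_intros)

lemma FP_split_bundle [FP_intros]:
  "FP r \<Longrightarrow> FP q \<Longrightarrow> FP e \<Longrightarrow> FP (\<lambda>a. split_bundle (r a) (q a) (e a))"
  by (rule FP_apply3[of split_bundle], unfold split_bundle_def, intro FP_intros)

lemma FP_split_candidates [FP_intros]: "FP r \<Longrightarrow> FP E \<Longrightarrow> FP (\<lambda>a. split_candidates (r a) (E a))"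
  by (rule FP_apply2[of split_candidates], unfold split_candidates_def, intro FP_intros)

lemma FP_fresh_names [FP_intros]: "FP M \<Longrightarrow> FP (\<lambda>a. fresh_names (M a))"
  by (rule FP_compose[of fresh_names], unfold fresh_names_def, intro FP_intros)

lemma FP_species [FP_intros]: "FP M \<Longrightarrow> FP (\<lambda>a. species (M a))"
  by (rule FP_compose[of species], unfold species_def, intro FP_intros)

lemma FP_resolve_step [FP_intros]:
  "FP M \<Longrightarrow> FP r \<Longrightarrow> FP E \<Longrightarrow> FP (\<lambda>a. resolve_step (list_cost (entry (M a)) (species (M a))) (r a) (E a))"
  by (rule FP_apply3[of "\<lambda>M. resolve_step (list_cost (entry M) (species M))"], unfold resolve_step_def, intro FP_intros)

text \<open>A split redistributes the children and adds two copies of \<open>r\<close> and two list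
  heads. The growth does not depend on \<open>E\<close>, which makes repeated splitting
  additive.\<close>

lemma sz_split_candidate:
  assumes "E' \<in> set (split_candidates r E)"
  shows "sz E' \<le> sz E + (2 * sz r + 2)"
proof -
  obtain pre u cs post q where E: "E = pre @ (u, cs) # post" "q \<in> set cs"
    "E' = pre @ split_bundle r q (u, cs) @ post" using assms unfolding split_candidates_iff by blast
  have "sum_list (map sz (filter (\<lambda>c. c \<noteq> q) xs)) + sz q \<le> sum_list (map sz xs)" if "q \<in> set xs" for xs
    using that
  proof (induction xs)
    case (Cons x xs)
    show ?case
    proof (cases "x = q")
      case True
      have "sum_list (map sz (filter (\<lambda>c. c \<noteq> q) xs)) \<le> sum_list (map sz xs)"
        using sz_filter_le[of "\<lambda>c. c \<noteq> q" xs] by (simp add: sz_simps(1))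
      then show ?thesis using True by simp
    next
      case False
      then show ?thesis using Cons by simp
    qed
  qed simp
  from this[OF E(2)] show ?thesis by (simp add: E split_bundle_def sz_simps(1,2))
qed

lemma FP_resolve [FP_intros]:
  assumes "FP M" "FP E"
  shows "FP (\<lambda>a. resolve (M a) (E a))"
proof -
  have "FP (\<lambda>q. fold (resolve_step (list_cost (entry (fst q)) (species (fst q)))) (fresh_names (fst q)) (snd q))"
  proof (rule FP_fold_additive[of _ _ _ "[:2, 2:]"])
    show "FP (\<lambda>p. resolve_step (list_cost (entry (fst (fst p))) (species (fst (fst p)))) (fst (snd p)) (snd (snd p)))"
      by (intro FP_intros)
    show "sz (resolve_step (list_cost (entry (fst a)) (species (fst a))) r E) \<le> sz E + poly [:2, 2:] (sz a + sz r)"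
      for a r E
    proof (cases "split_candidates r E = []")
      case False
      let ?b = "resolve_step (list_cost (entry (fst a)) (species (fst a))) r E"
      have "nth_default [] (split_candidates r E) 0 \<in> set (split_candidates r E)"
        using False by (simp add: nth_default_def)
      then have "?b \<in> set (split_candidates r E)"
        using False best_cases unfolding resolve_step_def by (metis insertE)
      from sz_split_candidate[OF this] show ?thesis by simp
    qed (simp add: resolve_step_def)
  qed (intro FP_intros)+
  then have "FP (\<lambda>q. resolve (fst q) (snd q))" unfolding resolve_def .
  from FP_apply2[OF this assms] show ?thesis .
qed

lemma FP_edge_list [FP_intros]: "FP E \<Longrightarrow> FP (\<lambda>a. edge_list (E a))"
  by (rule FP_compose[of edge_list], unfold edge_list_def, intro FP_intros)

lemma FP_output_lists [FP_intros]: "FP V \<Longrightarrow> FP E \<Longrightarrow> FP (\<lambda>a. output_lists (V a) (E a))"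
  by (rule FP_apply2[of output_lists], unfold output_lists_def, intro FP_intros)

lemma FP_multiple [FP_intros]: "FP A \<Longrightarrow> FP V \<Longrightarrow> FP (\<lambda>a. multiple (A a) (V a))"
  by (rule FP_apply2[of multiple], unfold multiple_def, intro FP_intros)

lemma FP_rename [FP_intros]: "FP n \<Longrightarrow> FP I \<Longrightarrow> FP i \<Longrightarrow> FP (\<lambda>a. rename (n a) (I a) (i a))"
  by (rule FP_apply3[of rename], unfold rename_def, intro FP_intros)

lemma FP_attach_lists [FP_intros]: "FP V \<Longrightarrow> FP A \<Longrightarrow> FP (\<lambda>a. attach_lists (V a) (A a))"
  by (rule FP_apply2[of attach_lists], unfold attach_lists_def, intro FP_intros)

lemma FP_solve_tree [FP_intros]:
  "FP M \<Longrightarrow> FP vs \<Longrightarrow> FP es \<Longrightarrow> FP (\<lambda>a. solve_tree (M a) (vs a) (es a))"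
  by (rule FP_apply3[of solve_tree], unfold solve_tree_def, intro FP_intros)

lemma FP_mst_tree [FP_intros]: "FP M \<Longrightarrow> FP (\<lambda>a. mst_tree (M a))"
  by (rule FP_compose[of mst_tree], unfold mst_tree_def, intro FP_intros)

lemma attach_leaves_verts:
  assumes "spanning_tree n G"
  shows "verts (attach_leaves n G) \<subseteq> {1..2 * n}"
proof -
  have "internal G \<subseteq> {1..n}" using assms by (auto simp: internal_def spanning_tree_def)
  then show ?thesis unfolding attach_leaves_eq[OF assms] attached_def by auto
qed

lemma solve_attached_tree:
  assumes n: "2 \<le> n" and \<delta>: "metric_instance n (real_matrix d)"
    and T: "minimum_spanning_tree n (real_matrix d) T\<^sub>0" and "lists_graph vs es (attach_leaves n T\<^sub>0)"
  shows "\<exists>T' \<phi>. encodes_solution n (enc (solve_tree (matrix n d) vs es)) T' \<phi> \<and> feasible n T' \<phi> \<and>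
    bme_cost n (real_matrix d) T' \<phi> \<le> general_cost n (real_matrix d) (attach_leaves n T\<^sub>0)"
proof -
  have st: "spanning_tree n T\<^sub>0" using T by (simp add: minimum_spanning_tree_def)
  have "bme_instance n (real_matrix d)" using \<delta> by (simp add: metric_instance_def)
  from solve_tree_correct[OF n this attach_leaves_tree[OF st n] attach_leaves_verts[OF st] assms(4)]
  show ?thesis .
qed

lemma enc_matrix_eq: "enc_matrix n d = enc (matrix n d)"
  by (simp add: enc_matrix_def matrix_def encode_list encode_rat del: upt_Suc)

lemma enc_graph_eq: "enc_graph vs es = enc (vs, es)"
  by (simp add: enc_graph_def encode_prod encode_list encode_nat enc_nat_def case_prod_beta)

lemma approximation_poly_time:
  "poly_time (\<lambda>(n, d). enc_matrix n d) {(n, d). 2 \<le> n \<and> metric_instance n (real_matrix d)}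
     (\<lambda>(n, d) v. \<exists>T' \<phi>. encodes_solution n v T' \<phi> \<and> feasible n T' \<phi> \<and>
        bme_cost n (real_matrix d) T' \<phi> \<le> 2 * bme_opt n (real_matrix d) \<and>
        (\<exists>T\<^sub>0. algorithm_output n (real_matrix d) T\<^sub>0 T' \<phi>))"
proof (rule FP_poly_time[of "\<lambda>M. solve_tree M (fst (mst_tree M)) (snd (mst_tree M))" _ _ "\<lambda>(n, d). matrix n d"])
  show "FP (\<lambda>M. solve_tree M (fst (mst_tree M)) (snd (mst_tree M)))" by (intro FP_intros)
  fix x :: "nat \<times> (nat \<Rightarrow> nat \<Rightarrow> rat)" assume x: "x \<in> {(n, d). 2 \<le> n \<and> metric_instance n (real_matrix d)}"
  obtain n d where nd: "x = (n, d)" by (cases x)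
  show "(case x of (n, d) \<Rightarrow> enc_matrix n d) = enc (case x of (n, d) \<Rightarrow> matrix n d)"
    by (simp add: nd enc_matrix_eq)
  have n: "2 \<le> n" and \<delta>: "metric_instance n (real_matrix d)" using x nd by auto
  let ?\<delta> = "real_matrix d" and ?M = "matrix n d"
  let ?v = "enc (solve_tree ?M (fst (mst_tree ?M)) (snd (mst_tree ?M)))"
  have bme: "bme_instance n ?\<delta>" using \<delta> by (simp add: metric_instance_def)
  have "\<forall>i\<in>{1..n}. \<forall>j\<in>{1..n}. of_rat (entry ?M i j) = ?\<delta> i j"
    by (simp add: entry_matrix real_matrix_def)
  from prim_correct[OF _ species_matrix bme this] n obtain T where T: "minimum_spanning_tree n ?\<delta> T"
      and lists: "lists_graph (species ?M) (prim (entry ?M) (species ?M)) T"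
    by auto
  have st: "spanning_tree n T" using T by (simp add: minimum_spanning_tree_def)
  have "lists_graph (fst (mst_tree ?M)) (snd (mst_tree ?M)) (attach_leaves n T)"
    unfolding mst_tree_def by (rule attach_lists_correct[OF st n species_matrix lists])
  from solve_attached_tree[OF n \<delta> T this] obtain T' \<phi> where
    T': "encodes_solution n ?v T' \<phi>" "feasible n T' \<phi>" "bme_cost n ?\<delta> T' \<phi> \<le> general_cost n ?\<delta> (attach_leaves n T)"
    by blast
  then have out: "algorithm_output n ?\<delta> T T' \<phi>" using T by (simp add: algorithm_output_def)
  then have "bme_cost n ?\<delta> T' \<phi> \<le> 2 * bme_opt n ?\<delta>" by (rule algorithm_output_le[OF _ n \<delta>])
  then have "\<exists>T' \<phi>. encodes_solution n ?v T' \<phi> \<and> feasible n T' \<phi> \<and>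
      bme_cost n ?\<delta> T' \<phi> \<le> 2 * bme_opt n ?\<delta> \<and> (\<exists>T\<^sub>0. algorithm_output n ?\<delta> T\<^sub>0 T' \<phi>)"
    using T'(1,2) out by blast
  then show "(case x of (n, d) \<Rightarrow> \<lambda>v. \<exists>T' \<phi>. encodes_solution n v T' \<phi> \<and> feasible n T' \<phi> \<and>
      bme_cost n (real_matrix d) T' \<phi> \<le> 2 * bme_opt n (real_matrix d) \<and>
      (\<exists>T\<^sub>0. algorithm_output n (real_matrix d) T\<^sub>0 T' \<phi>))
    (enc (solve_tree (case x of (n, d) \<Rightarrow> matrix n d) (fst (mst_tree (case x of (n, d) \<Rightarrow> matrix n d)))
      (snd (mst_tree (case x of (n, d) \<Rightarrow> matrix n d)))))"
    by (simp only: nd case_prod_conv)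
qed

lemma refinement_poly_time:
  "poly_time (\<lambda>(n, d, vs, es). Lst [enc_matrix n d, enc_graph vs es])
     {(n, d, vs, es). 2 \<le> n \<and> metric_instance n (real_matrix d) \<and>
        (\<exists>T\<^sub>0. minimum_spanning_tree n (real_matrix d) T\<^sub>0 \<and>
           lists_graph vs es (attach_leaves n T\<^sub>0))}
     (\<lambda>(n, d, vs, es) v. \<exists>T' \<phi>. encodes_solution n v T' \<phi> \<and> feasible n T' \<phi> \<and>
        bme_cost n (real_matrix d) T' \<phi>
          \<le> general_cost n (real_matrix d) \<lparr>verts = set vs, edges = set (map (\<lambda>(u, v). {u, v}) es)\<rparr>)"
    (is "poly_time ?e ?X ?R")
proof (rule FP_poly_time[of "\<lambda>a. solve_tree (fst a) (fst (snd a)) (snd (snd a))" _ _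
    "\<lambda>(n, d, vs, es). (matrix n d, vs, es)"])
  show "FP (\<lambda>a. solve_tree (fst a) (fst (snd a)) (snd (snd a)))" by (intro FP_intros)
  fix x assume x: "x \<in> ?X"
  obtain n d vs es where nd: "x = (n, d, vs, es)" by (cases x)
  show "?e x = enc (case x of (n, d, vs, es) \<Rightarrow> (matrix n d, vs, es))"
    by (simp add: nd enc_matrix_eq enc_graph_eq encode_prod)
  obtain T where n: "2 \<le> n" and \<delta>: "metric_instance n (real_matrix d)"
    and T: "minimum_spanning_tree n (real_matrix d) T" and lists: "lists_graph vs es (attach_leaves n T)"
    using x nd by auto
  have "\<lparr>verts = set vs, edges = set (map (\<lambda>(u, v). {u, v}) es)\<rparr> = attach_leaves n T"
    using lists by (cases "attach_leaves n T") (simp add: lists_graph_def)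
  then show "?R x (enc (solve_tree (fst (case x of (n, d, vs, es) \<Rightarrow> (matrix n d, vs, es)))
      (fst (snd (case x of (n, d, vs, es) \<Rightarrow> (matrix n d, vs, es))))
      (snd (snd (case x of (n, d, vs, es) \<Rightarrow> (matrix n d, vs, es))))))"
    using solve_attached_tree[OF n \<delta> T lists] by (simp only: nd case_prod_conv fst_conv snd_conv)
qed

theorem theorem6:
  shows
    "\<comment> \<open>a polynomial-time 2-approximation algorithm, which is an implementation of the given one\<close>
    poly_time (\<lambda>(n, d). enc_matrix n d) {(n, d). 2 \<le> n \<and> metric_instance n (real_matrix d)}
       (\<lambda>(n, d) v. \<exists>T' \<phi>. encodes_solution n v T' \<phi> \<and> feasible n T' \<phi> \<and>
          bme_cost n (real_matrix d) T' \<phi> \<le> 2 * bme_opt n (real_matrix d) \<and>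
          (\<exists>T\<^sub>0. algorithm_output n (real_matrix d) T\<^sub>0 T' \<phi>)) \<and>
    \<comment> \<open>correctness of every run of the given algorithm, for real matrices\<close>
    (\<forall>n \<delta>. 2 \<le> n \<and> metric_instance n \<delta> \<longrightarrow>
       (\<exists>T\<^sub>0. minimum_spanning_tree n \<delta> T\<^sub>0) \<and>
       (\<forall>T\<^sub>0. minimum_spanning_tree n \<delta> T\<^sub>0 \<longrightarrow>
          is_tree (attach_leaves n T\<^sub>0) \<and> leaves (attach_leaves n T\<^sub>0) = {1..n} \<and>
          (\<exists>T' \<phi>. algorithm_output n \<delta> T\<^sub>0 T' \<phi>) \<and>
          (\<forall>T' \<phi>. algorithm_output n \<delta> T\<^sub>0 T' \<phi> \<longrightarrow> bme_cost n \<delta> T' \<phi> \<le> 2 * bme_opt n \<delta>))) \<and>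
    \<comment> \<open>the last step takes polynomial time, whichever minimum spanning tree was computed\<close>
    poly_time (\<lambda>(n, d, vs, es). Lst [enc_matrix n d, enc_graph vs es])
       {(n, d, vs, es). 2 \<le> n \<and> metric_instance n (real_matrix d) \<and>
          (\<exists>T\<^sub>0. minimum_spanning_tree n (real_matrix d) T\<^sub>0 \<and>
             lists_graph vs es (attach_leaves n T\<^sub>0))}
       (\<lambda>(n, d, vs, es) v. \<exists>T' \<phi>. encodes_solution n v T' \<phi> \<and> feasible n T' \<phi> \<and>
          bme_cost n (real_matrix d) T' \<phi>
            \<le> general_cost n (real_matrix d) \<lparr>verts = set vs, edges = set (map (\<lambda>(u, v). {u, v}) es)\<rparr>)"
proof (intro conjI allI impI)
  fix n \<delta> assume n: "2 \<le> n \<and> metric_instance n \<delta>"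
  then show "\<exists>T\<^sub>0. minimum_spanning_tree n \<delta> T\<^sub>0" by (intro exists_minimum_spanning_tree) simp
  fix T\<^sub>0 assume T: "minimum_spanning_tree n \<delta> T\<^sub>0"
  then have st: "spanning_tree n T\<^sub>0" by (simp add: minimum_spanning_tree_def)
  show "is_tree (attach_leaves n T\<^sub>0)" "leaves (attach_leaves n T\<^sub>0) = {1..n}"
    using attach_leaves_tree[OF st] n by auto
  show "\<exists>T' \<phi>. algorithm_output n \<delta> T\<^sub>0 T' \<phi>" using exists_algorithm_output[OF T] n by blast
  show "bme_cost n \<delta> T' \<phi> \<le> 2 * bme_opt n \<delta>" if "algorithm_output n \<delta> T\<^sub>0 T' \<phi>" for T' \<phi>
    using algorithm_output_le[OF that] n by blast
qed (rule approximation_poly_time, rule refinement_poly_time)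

end
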